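(* Let $(\Omega,\mathcal F,\mathbf P)$ be a probability space with a filtration $\mathcal F_0\subset\dots\subset\mathcal F_T\subset\mathcal F$ (all $\sigma$-algebras complete with respect to $\mathbf P$), let $(\Pi_t)_{t=0}^T$ be a bid-ask process (a process adapted to $(\mathcal F_t)$ with values in the set of $d\times d$ bid-ask matrices), and let $K_t=K(\Pi_t)$ be the corresponding solvency cones. The following conditions are equivalent: (a) $(\Pi_t)_{t=0}^T$ satisfies the robust no-arbitrage condition NA$^r$; (b) there exists a $d$-dimensional $\mathbf P$-martingale $Z=(Z_t)_{t=0}^T$ (with respect to $(\mathcal F_t)$) such that $Z_t\in L^0(\mathrm{ri}\,K_t^*,\mathcal F_t)$, $t=0,\dots,T$; (c) all elements $W_t$, $0\le t\le T$, of the sequence of set-valued maps $$W_T=K_T^*,\qquad W_t=\mathrm{cl}(\mathrm{ri}\,K_t^*\cap\mathrm{ri}\,Y_t),\quad Y_t=\mathrm{cl}(\mathrm{conv}\,\mathcal K(W_{t+1},\mathcal F_t)),\quad 0\le t\le T-1,$$ take nonempty values a.s.; (d) if $x_t\in L^0(-K_t,\mathcal F_t)$, $t=0,\dots,T$, and $\sum_{t=0}^T x_t=0$ a.s., then $x_t\in L^0(K_t\cap(-K_t),\mathcal F_t)$, $t=0,\dots,T$.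
   Context: Notation: $\mathrm{cl}$, $\mathrm{ri}$, $\mathrm{conv}$ denote closure, relative interior and convex hull in a finite-dimensional space; for a degenerate interval $\mathrm{ri}[a,a]=\{a\}$. For a cone $A$, $A^*=\{y:\langle x,y\rangle\ge 0\ \forall x\in A\}$. $\mathbf R^d_+=\{w\in\mathbf R^d:w_i\ge 0,\ i=1,\dots,d\}$. All set operations on set-valued maps are pointwise in $\omega$. All $\sigma$-algebras contain all $\mathbf P$-null sets. Market model. A matrix $\Pi=(\pi^{ij})_{i,j=1}^d$ is a bid-ask matrix if (i) $\pi^{ij}>0$; (ii) $\pi^{ii}=1$; (iii) $\pi^{ij}\le\pi^{ik}\pi^{kj}$ for all $i,j,k$. Its solvency cone $K(\Pi)\subset\mathbf R^d$ is the convex cone spanned by the standard basis vectors $e_i$, $1\le i\le d$, and the vectors $\pi^{ij}e_i-e_j$, $1\le i,j\le d$. For a bid-ask process $\Pi=(\Pi_t)_{t=0}^T$ put $A_t(\Pi)=\sum_{j=0}^t L^0(-K(\Pi_j),\mathcal F_j)$. Robust no-arbitrage: $(\Pi_t)_{t=0}^T$ satisfies NA$^r$ if there exists a bid-ask process $(\widetilde\Pi_t)_{t=0}^T$ such that $[1/\widetilde\pi_t^{ji},\widetilde\pi_t^{ij}]\subset\mathrm{ri}\,[1/\pi_t^{ji},\pi_t^{ij}]$ for all $i,j,t$, and $A_T(\widetilde\Pi)\cap L^0(\mathbf R^d_+,\mathcal F_T)=\{0\}$. A set-valued map $F$ (assigning to each $\omega\in\Omega$ a set $F(\omega)\subset\mathbf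 R^d$) is $\mathcal H$-measurable if $\{\omega:F(\omega)\cap V\ne\emptyset\}\in\mathcal H$ for every open $V\subset\mathbf R^d$. $L^0(F,\mathcal H)$ is the set of $\mathcal H$-measurable functions $\xi:\Omega\to\mathbf R^d$ with $\xi(\omega)\in F(\omega)$ for almost all $\omega$. Support of the regular conditional upper distribution. Let $\mathrm{CL}$ be the family of nonempty closed subsets of $\mathbf R^d$ with the Effros $\sigma$-algebra $\mathcal E(\mathrm{CL})$ generated by the sets $A_V=\{D\in\mathrm{CL}:D\cap V\ne\emptyset\}$, $V\subset\mathbf R^d$ open. For a sub-$\sigma$-algebra $\mathcal H\subset\mathcal F$ and an $\mathcal F$-measurable $F:\Omega\to\mathrm{CL}$ there is a function $\mathbf P^*:\Omega\times\mathcal E(\mathrm{CL})\to\mathbf R$ such that $\mathbf P^*(\omega,\cdot)$ is a probability measure for each $\omega$ and, for each $C\in\mathcal E(\mathrm{CL})$, $\mathbf P^*(\cdot,C)=\mathbf P(\{F\in C\}|\mathcal H)$ a.s. Put $\mu_F(\omega,V)=\mathbf P^*(\omega,A_V)$ for $V$ open and $$\mathcal K(F,\mathcal H;\omega)=\{x\in\mathbf R^d:\mu_F(\omega,B_\varepsilon(x))>0\ \ \forall\varepsilon>0\},$$ where $B_\varepsilon(x)$ is the open ball of radius $\varepsilon$ centred at $x$. This is an $\mathcal H$-measurable map with nonempty closed values, defined up to a null set. If $F$ is closed-valued and $\mathcal F$-measurable with $F=\emptyset$ only on a null set, then $\mathcal K(F,\mathcal H)$ is defined by replacing $F$ with $\{0\}$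 on that null set. If $F=\emptyset$ on a set of positive measure, then $\mathcal K(F,\mathcal H)=\emptyset$ for all $\omega$. With these conventions each $W_t$ is closed and $\mathcal F_t$-measurable, so the recursion is well defined. *)

theory Defs
  imports "HOL-Probability.Probability"
begin

section \<open>Bid-ask matrices and solvency cones\<close>

definition bid_ask_matrix :: "real ^ 'd ^ 'd \<Rightarrow> bool" where
  "bid_ask_matrix \<pi> \<longleftrightarrow>
     (\<forall>i j. \<pi> $ i $ j > 0) \<and> (\<forall>i. \<pi> $ i $ i = 1) \<and>
     (\<forall>i j k. \<pi> $ i $ j \<le> \<pi> $ i $ k * \<pi> $ k $ j)"

definition solvency_cone :: "real ^ 'd ^ 'd \<Rightarrow> (real ^ 'd) set" where
  "solvency_cone \<pi> = convex_cone hull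
     ({axis i 1 | i. True} \<union> {(\<pi> $ i $ j) *\<^sub>R axis i 1 - axis j 1 | i j. True})"

text \<open>In the convention used here the dual cone consists of the nonnegative functionals
  (the negative of the polar cone).\<close>

definition dual_cone :: "'a::real_inner set \<Rightarrow> 'a set" where
  "dual_cone A = {y. \<forall>x\<in>A. x \<bullet> y \<ge> 0}"

definition nonneg_orthant :: "(real ^ 'd) set" where
  "nonneg_orthant = {w. \<forall>i. w $ i \<ge> 0}"


section \<open>Filtrations, adapted processes and martingales\<close>

text \<open>Only the \<sigma>-algebras of the measures \<open>F t\<close>, \<open>t \<le> T\<close>, matter; the probability is always that
  of \<open>M\<close>.  Every \<sigma>-algebra involved contains all \<open>M\<close>-null sets.\<close>

definition complete_filtration :: "'w measure \<Rightarrow> (nat \<Rightarrow> 'w measure) \<Rightarrow> nat \<Rightarrow> bool" where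
  "complete_filtration M F T \<longleftrightarrow>
     complete_measure M \<and>
     (\<forall>t\<le>T. subalgebra M (F t) \<and> null_sets M \<subseteq> sets (F t)) \<and>
     (\<forall>s t. s \<le> t \<and> t \<le> T \<longrightarrow> sets (F s) \<subseteq> sets (F t))"

definition bid_ask_process ::
  "'w measure \<Rightarrow> (nat \<Rightarrow> 'w measure) \<Rightarrow> nat \<Rightarrow> (nat \<Rightarrow> 'w \<Rightarrow> real ^ 'd ^ 'd) \<Rightarrow> bool" where
  "bid_ask_process M F T \<pi> \<longleftrightarrow>
     (\<forall>t\<le>T. \<pi> t \<in> borel_measurable (F t) \<and> (\<forall>\<omega>\<in>space M. bid_ask_matrix (\<pi> t \<omega>)))"

definition martingale ::
  "'w measure \<Rightarrow> (nat \<Rightarrow> 'w measure) \<Rightarrow> nat \<Rightarrow> (nat \<Rightarrow> 'w \<Rightarrow> real ^ 'd) \<Rightarrow> bool" where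
  "martingale M F T Z \<longleftrightarrow>
     (\<forall>t\<le>T. Z t \<in> borel_measurable (F t) \<and> integrable M (Z t)) \<and>
     (\<forall>s t i. s \<le> t \<and> t \<le> T \<longrightarrow>
        (AE \<omega> in M. real_cond_exp M (F s) (\<lambda>\<omega>. Z t \<omega> $ i) \<omega> = Z s \<omega> $ i))"

text \<open>Measurable selections; functions are not identified when equal almost surely, so the class
  of the zero function is \<open>L0 M H (\<lambda>_. {0})\<close>.\<close>

definition L0 :: "'w measure \<Rightarrow> 'w measure \<Rightarrow> ('w \<Rightarrow> (real ^ 'd) set) \<Rightarrow> ('w \<Rightarrow> real ^ 'd) set" where
  "L0 M H G = {\<xi> \<in> borel_measurable H. AE \<omega> in M. \<xi> \<omega> \<in> G \<omega>}"


section \<open>Robust no-arbitrage\<close>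

definition attainable ::
  "'w measure \<Rightarrow> (nat \<Rightarrow> 'w measure) \<Rightarrow> (nat \<Rightarrow> 'w \<Rightarrow> real ^ 'd ^ 'd) \<Rightarrow> nat \<Rightarrow> ('w \<Rightarrow> real ^ 'd) set" where
  "attainable M F \<pi> t =
     {(\<lambda>\<omega>. \<Sum>j\<le>t. x j \<omega>) | x. \<forall>j\<le>t. x j \<in> L0 M (F j) (\<lambda>\<omega>. uminus ` solvency_cone (\<pi> j \<omega>))}"

definition robust_no_arbitrage ::
  "'w measure \<Rightarrow> (nat \<Rightarrow> 'w measure) \<Rightarrow> nat \<Rightarrow> (nat \<Rightarrow> 'w \<Rightarrow> real ^ 'd ^ 'd) \<Rightarrow> bool" where
  "robust_no_arbitrage M F T \<pi> \<longleftrightarrow>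
     (\<exists>\<rho>. bid_ask_process M F T \<rho> \<and>
        (\<forall>t\<le>T. \<forall>\<omega>\<in>space M. \<forall>i j.
           {1 / \<rho> t \<omega> $ j $ i .. \<rho> t \<omega> $ i $ j}
             \<subseteq> rel_interior {1 / \<pi> t \<omega> $ j $ i .. \<pi> t \<omega> $ i $ j}) \<and>
        attainable M F \<rho> T \<inter> L0 M (F T) (\<lambda>_. nonneg_orthant) = L0 M (F T) (\<lambda>_. {0}))"


section \<open>Support of the regular conditional upper distribution\<close>

definition CL :: "'a::topological_space set set" where
  "CL = {D. closed D \<and> D \<noteq> {}}"

definition hitting :: "'a::topological_space set \<Rightarrow> 'a set set" where
  "hitting V = {D \<in> CL. D \<inter> V \<noteq> {}}"

definition effros :: "'a::topological_space set measure" where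
  "effros = sigma CL {hitting V | V. open V}"

definition regular_cond_distr ::
  "'w measure \<Rightarrow> 'w measure \<Rightarrow> 'b measure \<Rightarrow> ('w \<Rightarrow> 'b) \<Rightarrow> ('w \<Rightarrow> 'b measure) \<Rightarrow> bool" where
  "regular_cond_distr M H N X \<kappa> \<longleftrightarrow>
     \<kappa> \<in> H \<rightarrow>\<^sub>M prob_algebra N \<and>
     (\<forall>C\<in>sets N. AE \<omega> in M.
        measure (\<kappa> \<omega>) C = real_cond_exp M H (indicator {\<omega>\<in>space M. X \<omega> \<in> C}) \<omega>)"

text \<open>The set \<open>\<K>(F, H; \<omega>)\<close> computed from a given version \<open>\<kappa>\<close> of the conditional distribution.\<close>

definition upper_support :: "('w \<Rightarrow> 'a::metric_space set measure) \<Rightarrow> 'w \<Rightarrow> 'a set" where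
  "upper_support \<kappa> \<omega> = {x. \<forall>\<epsilon>>0. measure (\<kappa> \<omega>) (hitting (ball x \<epsilon>)) > 0}"

text \<open>The map \<open>\<K>(F, H)\<close>.  The version of the conditional distribution is chosen arbitrarily;
  by lemma \<open>upper_support_unique\<close> below the choice matters only on a null set.\<close>

definition cond_upper_support ::
  "'w measure \<Rightarrow> 'w measure \<Rightarrow> ('w \<Rightarrow> 'a::euclidean_space set) \<Rightarrow> 'w \<Rightarrow> 'a set" where
  "cond_upper_support M H F =
     (if AE \<omega> in M. F \<omega> \<noteq> {}
      then upper_support
             (SOME \<kappa>. regular_cond_distr M H effros (\<lambda>\<omega>. if F \<omega> = {} then {0} else F \<omega>) \<kappa>)
      else (\<lambda>_. {}))"

lemma hitting_in_effros: "open V \<Longrightarrow> hitting V \<in> sets effros"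
  by (auto simp: effros_def hitting_def intro!: sigma_sets.Basic)

lemma upper_support_unique:
  fixes X :: "'w \<Rightarrow> 'a::euclidean_space set"
  assumes "regular_cond_distr M H effros X \<kappa>" "regular_cond_distr M H effros X \<kappa>'"
    and "subalgebra M H"
  shows "AE \<omega> in M. upper_support \<kappa> \<omega> = upper_support \<kappa>' \<omega>"
proof -
  obtain \<B> :: "'a set set" where \<B>: "countable \<B>" "\<And>B. B \<in> \<B> \<Longrightarrow> open B"
    "\<And>S. open S \<Longrightarrow> \<exists>U. U \<subseteq> \<B> \<and> S = \<Union>U"
    using univ_second_countable by blast
  have supp: "upper_support l \<omega> = {x. \<forall>B\<in>\<B>. x \<in> B \<longrightarrow> measure (l \<omega>) (hitting B) > 0}"
    if "regular_cond_distr M H effros X l" "\<omega> \<in> space M" for l \<omega>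
  proof -
    have "l \<omega> \<in> space (prob_algebra effros)"
      using that assms(3) by (auto simp: regular_cond_distr_def subalgebra_def dest: measurable_space)
    then interpret l: prob_space "l \<omega>" by (simp add: space_prob_algebra)
    have s: "sets (l \<omega>) = sets effros"
      using \<open>l \<omega> \<in> _\<close> by (simp add: space_prob_algebra)
    have mono: "measure (l \<omega>) (hitting A) \<le> measure (l \<omega>) (hitting B)" if "A \<subseteq> B" "open B" for A B
    proof (rule l.finite_measure_mono)
      show "hitting A \<subseteq> hitting B" using that(1) by (auto simp: hitting_def)
      show "hitting B \<in> sets (l \<omega>)" using hitting_in_effros[OF that(2)] by (simp add: s)
    qed
    show ?thesis
    proof (intro set_eqI iffI)
      fix x assume x: "x \<in> upper_support l \<omega>"
      have "measure (l \<omega>) (hitting B) > 0" if B: "B \<in> \<B>" "x \<in> B" for B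
      proof -
        obtain e where "e > 0" "ball x e \<subseteq> B"
          using \<B>(2) B open_contains_ball by blast
        then show ?thesis
          using x mono[of "ball x e" B] \<B>(2)[OF B(1)] by (auto simp: upper_support_def intro: less_le_trans)
      qed
      then show "x \<in> {x. \<forall>B\<in>\<B>. x \<in> B \<longrightarrow> measure (l \<omega>) (hitting B) > 0}" by blast
    next
      fix x assume x: "x \<in> {x. \<forall>B\<in>\<B>. x \<in> B \<longrightarrow> measure (l \<omega>) (hitting B) > 0}"
      have "measure (l \<omega>) (hitting (ball x e)) > 0" if "e > 0" for e
      proof -
        obtain U where U: "U \<subseteq> \<B>" "ball x e = \<Union>U"
          using \<B>(3)[OF open_ball, of x e] by metis
        have "x \<in> \<Union>U" using that by (simp flip: U(2))
        then obtain B where "B \<in> U" "x \<in> B" by blast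
        then have "B \<in> \<B>" "x \<in> B" "B \<subseteq> ball x e" using U by auto
        then show ?thesis
          using x mono[of B "ball x e"] by (auto intro: less_le_trans)
      qed
      then show "x \<in> upper_support l \<omega>" by (simp add: upper_support_def)
    qed
  qed
  have "AE \<omega> in M. \<forall>B\<in>\<B>. measure (\<kappa> \<omega>) (hitting B) = measure (\<kappa>' \<omega>) (hitting B)"
  proof (subst AE_ball_countable[OF \<B>(1)], intro ballI)
    fix B assume "B \<in> \<B>"
    then have "hitting B \<in> sets effros" using \<B>(2) hitting_in_effros by blast
    then have
      "AE \<omega> in M. measure (\<kappa> \<omega>) (hitting B) = real_cond_exp M H (indicator {\<omega>\<in>space M. X \<omega> \<in> hitting B}) \<omega>"
      "AE \<omega> in M. measure (\<kappa>' \<omega>) (hitting B) = real_cond_exp M H (indicator {\<omega>\<in>space M. X \<omega> \<in> hitting B}) \<omega>"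
      using assms(1,2) by (auto simp: regular_cond_distr_def)
    then show "AE \<omega> in M. measure (\<kappa> \<omega>) (hitting B) = measure (\<kappa>' \<omega>) (hitting B)"
      by eventually_elim simp
  qed
  then show ?thesis
    using AE_space by eventually_elim (simp add: supp[OF assms(1)] supp[OF assms(2)])
qed


section \<open>The backward recursion\<close>

text \<open>The values for \<open>t > T\<close> are immaterial.\<close>

function W_seq ::
  "'w measure \<Rightarrow> (nat \<Rightarrow> 'w measure) \<Rightarrow> nat \<Rightarrow> (nat \<Rightarrow> 'w \<Rightarrow> real ^ 'd ^ 'd) \<Rightarrow> nat \<Rightarrow>
     'w \<Rightarrow> (real ^ 'd) set" where
  "W_seq M F T \<pi> t =
     (if t < T
      then (let Y = (\<lambda>\<omega>. closure (convex hull
                       (cond_upper_support M (F t) (W_seq M F T \<pi> (Suc t)) \<omega>)))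
            in (\<lambda>\<omega>. closure (rel_interior (dual_cone (solvency_cone (\<pi> t \<omega>))) \<inter> rel_interior (Y \<omega>))))
      else (\<lambda>\<omega>. dual_cone (solvency_cone (\<pi> T \<omega>))))"
  by pat_completeness auto
termination
  by (relation "Wellfounded.measure (\<lambda>(M, F, T, \<pi>, t). T - t)") simp_all

declare W_seq.simps [simp del]

end

theory Submission
  imports Defs
begin

text \<open>
  The four conditions are linked by the cycle (b), (a), (d), (c), (b).

  (b) to (a): if \<open>Z\<close> is a strictly consistent martingale, the frictionless prices \<open>Z\<^sup>j / Z\<^sup>i\<close> lie in the
  relative interiors of the bid-ask intervals. For a trading strategy \<open>x\<close> with partial sums \<open>S\<close> and
  nonnegative final value one gets \<open>Z\<^sub>t \<bullet> S\<^sub>t \<ge> 0\<close> backwards in time, and then \<open>Z\<^sub>t \<bullet> S\<^sub>t = 0\<close> forwards,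
  so there is no arbitrage at these prices.

  (a) to (d): a position that is solvent but not reversible for \<open>\<Pi>\<close> is an interior point of the solvency
  cone of the tighter spreads, hence leaves a positive amount to consume, which would be an arbitrage.

  (d) to (c): if \<open>ri K\<^sub>t\<^sup>*\<close> and \<open>ri Y\<^sub>t\<close> are disjoint, they are properly separated by some \<open>\<eta>\<close> in
  \<open>-K\<^sub>t \<inter> Y\<^sub>t\<^sup>*\<close>. As \<open>(A \<inter> B)\<^sup>* = A\<^sup>* + B\<^sup>*\<close> for closed convex cones with meeting relative interiors, \<open>\<eta>\<close> splits
  successively into trades in \<open>K\<^sub>s\<close>, \<open>s > t\<close>; by (d) all of them are reversible, and then the separation
  is not proper.

  (c) to (b): the conditional expectations of countably many selections of \<open>W\<^sub>t\<^sub>+\<^sub>1\<close> generate a dense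
  subcone of \<open>Y\<^sub>t\<close>, so a point of \<open>ri Y\<^sub>t\<close> is a finite conic combination of them with measurable
  coefficients. This extends a consistent martingale by one step.

  Only three properties of the conditional upper support matter: it is closed and measurable, it contains
  the random set almost surely, and it is minimal with these properties. They require a regular
  conditional distribution on the Effros space; one exists because the space of closed sets is a
  measurable retract of the real line, by coding a Castaing representation in base four.
\<close>

section \<open>Convex cones\<close>

text \<open>Separation takes place only in \<open>R^d\<close>, for fixed \<omega>; closedness of the
  set of attainable claims and Hahn-Banach arguments in spaces of random variables are avoided. The
  price is that a separating functional depends on \<omega>. It is not selected directly: the cone
  of all candidates is generated by countably many measurable selections, and each of these is
  tested. Accordingly, relative interiority in a convex cone is expressed by functionals: every dual
  functional vanishing at the point vanishes on the whole cone.

  A second obstacle is integrability. The coefficients that express a point of \<open>ri Y_t\<close>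
  by conditional expectations are unbounded, so the same combination of the selections might fail to
  be integrable. Positivity of prices helps: the dual of \<open>K_t\<close> lies in the nonnegative
  orthant, so every conditional summand has nonnegative components and is dominated by the given
  integrable point.\<close>

lemma dual_coneD: "y \<in> dual_cone A \<Longrightarrow> x \<in> A \<Longrightarrow> 0 \<le> x \<bullet> y"
  by (simp add: dual_cone_def)

lemma dual_coneI: "(\<And>x. x \<in> A \<Longrightarrow> 0 \<le> x \<bullet> y) \<Longrightarrow> y \<in> dual_cone A"
  by (simp add: dual_cone_def)

lemma closed_dual_cone: "closed (dual_cone A)"
proof -
  have "dual_cone A = (\<Inter>x\<in>A. {y. 0 \<le> x \<bullet> y})"
    by (auto simp: dual_cone_def)
  then show ?thesis
    by (simp add: closed_INT closed_halfspace_ge)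
qed

lemma convex_cone_dual_cone: "convex_cone (dual_cone A)"
  by (auto simp: convex_cone_iff dual_cone_def inner_simps)

lemma dual_cone_antimono: "A \<subseteq> B \<Longrightarrow> dual_cone B \<subseteq> dual_cone A"
  by (auto simp: dual_cone_def)

lemma subset_dual_cone_dual_cone: "A \<subseteq> dual_cone (dual_cone A)"
  by (auto simp: dual_cone_def inner_commute)

lemma convex_cone_closure: "convex_cone A \<Longrightarrow> convex_cone (closure A)"
  for A :: "'a::euclidean_space set"
  by (simp add: convex_cone_def convex_closure conic_closure)

text \<open>The bipolar theorem, by separating a point from the closed cone. Since the cone contains
  0 and admits dilations, the separating level \<open>b\<close> is negative while the separating
  functional is nonnegative on \<open>S\<close>.\<close>

lemma dual_cone_dual_cone_eq_closure:
  fixes S :: "'a::euclidean_space set"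
  shows "dual_cone (dual_cone S) = closure (convex_cone hull S)"
proof
  show "closure (convex_cone hull S) \<subseteq> dual_cone (dual_cone S)"
    by (intro closure_minimal hull_minimal subset_dual_cone_dual_cone convex_cone_dual_cone
        closed_dual_cone)
  let ?C = "closure (convex_cone hull S)"
  have C: "convex_cone ?C"
    by (intro convex_cone_closure convex_cone_convex_cone_hull)
  show "dual_cone (dual_cone S) \<subseteq> ?C"
  proof
    fix z assume z: "z \<in> dual_cone (dual_cone S)"
    show "z \<in> ?C"
    proof (rule ccontr)
      assume "z \<notin> ?C"
      then obtain a b where ab: "a \<bullet> z < b" "\<And>x. x \<in> ?C \<Longrightarrow> a \<bullet> x > b"
        using separating_hyperplane_closed_point[of ?C z] C by (auto simp: convex_cone_def)
      have b: "b < 0"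
        using ab(2)[OF convex_cone_contains_0[OF C]] by simp
      have "0 \<le> x \<bullet> a" if "x \<in> S" for x
      proof (rule ccontr)
        assume "\<not> 0 \<le> x \<bullet> a"
        then have n: "a \<bullet> x < 0" by (simp add: inner_commute)
        have "x \<in> ?C" using that closure_subset hull_subset[of S convex_cone] by blast
        \<comment> \<open>At this multiple of \<open>x\<close> the functional \<open>a\<close> takes
          exactly the value \<open>b\<close>, which strict separation forbids.\<close>
        then have "(b / (a \<bullet> x)) *\<^sub>R x \<in> ?C"
          using n b by (intro convex_cone_scaleR[OF C]) (auto simp: divide_nonpos_nonpos)
        from ab(2)[OF this] n show False by simp
      qed
      then have "a \<in> dual_cone S" by (rule dual_coneI)
      from dual_coneD[OF z this] ab(1) b show False by simp
    qed
  qed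
qed

lemma dual_cone_dual_cone:
  fixes A :: "'a::euclidean_space set"
  assumes "convex_cone A" "closed A"
  shows "dual_cone (dual_cone A) = A"
  using assms by (simp add: dual_cone_dual_cone_eq_closure hull_same closure_closed)

lemma dual_cone_closure:
  fixes A :: "'a::euclidean_space set"
  shows "dual_cone (closure A) = dual_cone A"
proof
  show "dual_cone (closure A) \<subseteq> dual_cone A"
    by (intro dual_cone_antimono closure_subset)
  show "dual_cone A \<subseteq> dual_cone (closure A)"
  proof
    fix y assume y: "y \<in> dual_cone A"
    have "closure A \<subseteq> {x. 0 \<le> y \<bullet> x}"
      using y by (intro closure_minimal closed_halfspace_ge) (auto simp: dual_cone_def inner_commute)
    then show "y \<in> dual_cone (closure A)"
      by (auto simp: dual_cone_def inner_commute)
  qed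
qed

lemma dual_cone_hull:
  fixes A :: "'a::real_inner set"
  shows "dual_cone (convex_cone hull A) = dual_cone A"
proof
  show "dual_cone (convex_cone hull A) \<subseteq> dual_cone A"
    by (intro dual_cone_antimono hull_subset)
  show "dual_cone A \<subseteq> dual_cone (convex_cone hull A)"
  proof
    fix y assume y: "y \<in> dual_cone A"
    have "convex_cone hull A \<subseteq> {x. 0 \<le> y \<bullet> x}"
      using y by (intro hull_minimal convex_cone_halfspace_ge) (auto simp: dual_cone_def inner_commute)
    then show "y \<in> dual_cone (convex_cone hull A)"
      by (auto simp: dual_cone_def inner_commute)
  qed
qed

text \<open>Prolonging the segment from \<open>y\<close> through \<open>x\<close> inside
  \<open>A\<close> makes a dual functional that vanishes at \<open>x\<close> nonpositive at
  \<open>y\<close>. Conversely, a relative boundary point has a supporting functional that is not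
  constant on the cone. In this form separation and countable generating families can decide
  relative interiority.\<close>

lemma rel_interior_convex_cone_iff:
  fixes A :: "'a::euclidean_space set"
  assumes "convex_cone A"
  shows "x \<in> rel_interior A \<longleftrightarrow>
    x \<in> A \<and> (\<forall>\<eta>\<in>dual_cone A. \<eta> \<bullet> x = 0 \<longrightarrow> (\<forall>y\<in>A. \<eta> \<bullet> y = 0))"
proof
  have cv: "convex A" "A \<noteq> {}" using assms by (auto simp: convex_cone_def)
  assume x: "x \<in> rel_interior A"
  show "x \<in> A \<and> (\<forall>\<eta>\<in>dual_cone A. \<eta> \<bullet> x = 0 \<longrightarrow> (\<forall>y\<in>A. \<eta> \<bullet> y = 0))"
  proof (intro conjI ballI impI)
    show "x \<in> A" using x rel_interior_subset by blast
    fix \<eta> y assume \<eta>: "\<eta> \<in> dual_cone A" "\<eta> \<bullet> x = 0" and y: "y \<in> A"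
    obtain e where e: "e > 1" "(1 - e) *\<^sub>R y + e *\<^sub>R x \<in> A"
      using x y convex_rel_interior_iff[OF cv] by blast
    have "0 \<le> (1 - e) * (\<eta> \<bullet> y)"
      using dual_coneD[OF \<eta>(1) e(2)] \<eta>(2) by (simp add: inner_simps inner_commute)
    then have "\<eta> \<bullet> y \<le> 0" using e(1) by (simp add: zero_le_mult_iff)
    then show "\<eta> \<bullet> y = 0" using dual_coneD[OF \<eta>(1) y] by (simp add: inner_commute)
  qed
next
  have cv: "convex A" "A \<noteq> {}" using assms by (auto simp: convex_cone_def)
  assume x: "x \<in> A \<and> (\<forall>\<eta>\<in>dual_cone A. \<eta> \<bullet> x = 0 \<longrightarrow> (\<forall>y\<in>A. \<eta> \<bullet> y = 0))"
  show "x \<in> rel_interior A"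
  proof (rule ccontr)
    assume "x \<notin> rel_interior A"
    then obtain a where a: "\<And>y. y \<in> A \<Longrightarrow> a \<bullet> x \<le> a \<bullet> y" "\<And>y. y \<in> rel_interior A \<Longrightarrow> a \<bullet> x < a \<bullet> y"
      using supporting_hyperplane_rel_boundary[OF cv(1), of x] x by metis
    \<comment> \<open>Comparison with 0 and with twice \<open>x\<close> shows that the supporting
      hyperplane passes through the origin, so \<open>a\<close> lies in the dual cone.\<close>
    have "0 \<in> A" "2 *\<^sub>R x \<in> A"
      using assms x by (auto intro: convex_cone_contains_0 convex_cone_scaleR)
    then have "a \<bullet> x \<le> a \<bullet> 0" "a \<bullet> x \<le> a \<bullet> (2 *\<^sub>R x)" by (blast intro: a(1))+
    then have 0: "a \<bullet> x = 0" by simp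
    then have "a \<in> dual_cone A" using a(1) by (auto simp: dual_cone_def inner_commute)
    then have "\<forall>y\<in>A. a \<bullet> y = 0" using 0 x by blast
    moreover obtain y where "y \<in> rel_interior A" using cv rel_interior_eq_empty by blast
    ultimately show False using a(2) 0 rel_interior_subset by fastforce
  qed
qed

lemma rel_interior_convex_cone_add:
  fixes A :: "'a::euclidean_space set"
  assumes "convex_cone A" "x \<in> rel_interior A" "y \<in> A"
  shows "x + y \<in> rel_interior A"
  unfolding rel_interior_convex_cone_iff[OF assms(1)]
proof (intro conjI ballI impI)
  have x: "x \<in> A" using assms rel_interior_subset by blast
  then show "x + y \<in> A" using assms convex_cone_add by blast
  fix \<eta> z assume \<eta>: "\<eta> \<in> dual_cone A" "\<eta> \<bullet> (x + y) = 0" and z: "z \<in> A"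
  have "\<eta> \<bullet> x = 0"
    using dual_coneD[OF \<eta>(1) x] dual_coneD[OF \<eta>(1) assms(3)] \<eta>(2) by (simp add: inner_simps inner_commute)
  then show "\<eta> \<bullet> z = 0" using assms(2) \<eta>(1) z rel_interior_convex_cone_iff[OF assms(1)] by blast
qed

lemma rel_interior_convex_cone_scaleR:
  fixes A :: "'a::euclidean_space set"
  assumes "convex_cone A" "x \<in> rel_interior A" "0 < c"
  shows "c *\<^sub>R x \<in> rel_interior A"
  using assms by (auto simp: rel_interior_convex_cone_iff convex_cone_scaleR)

text \<open>The segment from \<open>y\<close> through \<open>x\<close> can be prolonged inside
  \<open>A\<close>; after dilation its end point is \<open>x - \<delta> y\<close>, and smaller steps
  are mixtures of that point with \<open>x\<close>. This reserves room for a strictly interior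
  summand in a conic combination.\<close>

lemma rel_interior_convex_cone_diff:
  fixes A :: "'a::euclidean_space set"
  assumes "convex_cone A" "x \<in> rel_interior A" "y \<in> A"
  obtains \<delta> where "0 < \<delta>" "\<And>s. 0 \<le> s \<Longrightarrow> s < \<delta> \<Longrightarrow> x - s *\<^sub>R y \<in> rel_interior A"
proof -
  have cv: "convex A" "A \<noteq> {}" using assms by (auto simp: convex_cone_def)
  obtain e where e: "e > 1" "(1 - e) *\<^sub>R y + e *\<^sub>R x \<in> A"
    using assms convex_rel_interior_iff[OF cv] by blast
  \<comment> \<open>Dividing the prolonged point \<open>(1 - e) y + e x\<close> by \<open>e\<close>
    leaves this coefficient, with a minus sign, on \<open>y\<close>.\<close>
  define \<delta> where "\<delta> = (e - 1) / e"
  have \<delta>: "\<delta> > 0" using e by (simp add: \<delta>_def)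
  have "(1 / e) *\<^sub>R ((1 - e) *\<^sub>R y + e *\<^sub>R x) \<in> A"
    using e by (intro convex_cone_scaleR[OF assms(1)]) auto
  also have "(1 / e) *\<^sub>R ((1 - e) *\<^sub>R y + e *\<^sub>R x) = x - \<delta> *\<^sub>R y"
    using e(1) by (simp add: \<delta>_def algebra_simps diff_divide_distrib)
  finally have xd: "x - \<delta> *\<^sub>R y \<in> A" .
  show ?thesis
  proof (rule that[OF \<delta>])
    fix s :: real assume s: "0 \<le> s" "s < \<delta>"
    have "(1 - s / \<delta>) *\<^sub>R x + (s / \<delta>) *\<^sub>R (x - \<delta> *\<^sub>R y) \<in> rel_interior A"
      using s \<delta> assms xd
      by (intro rel_interior_convex_cone_add rel_interior_convex_cone_scaleR convex_cone_scaleR) auto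
    also have "(1 - s / \<delta>) *\<^sub>R x + (s / \<delta>) *\<^sub>R (x - \<delta> *\<^sub>R y) = x - s *\<^sub>R y"
      using \<delta> by (simp add: algebra_simps)
    finally show "x - s *\<^sub>R y \<in> rel_interior A" .
  qed
qed

text \<open>Disjoint relative interiors mean that 0 is not relatively interior to the Minkowski
  difference of \<open>A\<close> and \<open>B\<close>. A supporting functional at 0 then separates
  the cones properly, which \<open>sep\<close> excludes.\<close>

lemma rel_interior_cones_meet:
  fixes A B :: "'a::euclidean_space set"
  assumes A: "convex_cone A" and B: "convex_cone B"
    and sep: "\<And>\<eta>. \<eta> \<in> dual_cone A \<Longrightarrow> - \<eta> \<in> dual_cone B \<Longrightarrow> (\<forall>x\<in>A \<union> B. \<eta> \<bullet> x = 0)"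
  shows "rel_interior A \<inter> rel_interior B \<noteq> {}"
proof -
  let ?f = "\<lambda>p::'a\<times>'a. fst p - snd p"
  have lin: "linear ?f" by (rule linearI) (auto simp: algebra_simps)
  have cv: "convex (A \<times> B)" using A B by (auto simp: convex_cone_def intro: convex_Times)
  let ?D = "?f ` (A \<times> B)"
  have cD: "convex ?D" using lin cv by (rule convex_linear_image)
  have 00: "0 \<in> A" "0 \<in> B" using A B by (auto intro: convex_cone_contains_0)
  have 0: "0 \<in> ?D" using 00 by (intro image_eqI[of _ _ "(0,0)"]) auto
  have "0 \<in> rel_interior ?D"
  proof (rule ccontr)
    assume "0 \<notin> rel_interior ?D"
    then obtain a where a: "\<And>y. y \<in> ?D \<Longrightarrow> a \<bullet> 0 \<le> a \<bullet> y" "\<And>y. y \<in> rel_interior ?D \<Longrightarrow> a \<bullet> 0 < a \<bullet> y"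
      using supporting_hyperplane_rel_boundary[OF cD 0] by metis
    have a': "0 \<le> a \<bullet> (x - y)" if "x \<in> A" "y \<in> B" for x y
    proof -
      have "x - y \<in> ?D" using that by (intro image_eqI[of _ _ "(x,y)"]) auto
      from a(1)[OF this] show ?thesis by simp
    qed
    have "a \<in> dual_cone A"
      using a'[OF _ 00(2)] by (simp add: dual_cone_def inner_commute)
    moreover have "- a \<in> dual_cone B"
      using a'[OF 00(1)] by (simp add: dual_cone_def inner_commute)
    ultimately have z: "\<forall>x\<in>A \<union> B. a \<bullet> x = 0" by (rule sep)
    have "?D \<noteq> {}" using 0 by blast
    then have "rel_interior ?D \<noteq> {}" using rel_interior_eq_empty[OF cD] by simp
    then obtain y where y: "y \<in> rel_interior ?D" by blast
    then have "y \<in> ?D" by (rule subsetD[OF rel_interior_subset])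
    then have "a \<bullet> y = 0" using z by (auto simp: inner_diff_right)
    then show False using a(2)[OF y] by simp
  qed
  also have "rel_interior ?D = ?f ` (rel_interior A \<times> rel_interior B)"
    unfolding rel_interior_convex_linear_image[OF lin cv, symmetric]
    using A B by (simp only: rel_interior_Times convex_cone_def)
  finally have m: "0 \<in> ?f ` (rel_interior A \<times> rel_interior B)" .
  show ?thesis
  proof (rule imageE[OF m])
    fix p assume "0 = fst p - snd p" and p: "p \<in> rel_interior A \<times> rel_interior B"
    then have "fst p = snd p" by (metis eq_iff_diff_eq_0)
    then show ?thesis using p by (metis IntI SigmaD1 SigmaD2 empty_iff prod.collapse)
  qed
qed

text \<open>Strong duality for minimising \<open>\<eta>\<close> over \<open>A \<inter> B\<close>.
  The set \<open>?Q\<close> collects the values of the perturbed problem in which the two copies of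
  the variable differ by \<open>a - b\<close>; it is supported at the origin by some
  \<open>(u, s)\<close>. The common relatively interior point is the constraint qualification that
  forces \<open>s > 0\<close>, and \<open>\<eta> + u / s\<close> is the summand from the dual of
  \<open>A\<close>.\<close>

lemma dual_cone_Int_decompose:
  fixes A B :: "'a::euclidean_space set"
  assumes A: "convex_cone A" and B: "convex_cone B"
    and ne: "rel_interior A \<inter> rel_interior B \<noteq> {}"
    and \<eta>: "\<eta> \<in> dual_cone (A \<inter> B)"
  shows "\<exists>k\<in>dual_cone A. \<eta> - k \<in> dual_cone B"
proof -
  let ?f = "\<lambda>p::'a\<times>'a\<times>real. (fst p - fst (snd p), \<eta> \<bullet> fst p + snd (snd p))"
  have lin: "linear ?f" by (rule linearI) (auto simp: inner_simps algebra_simps)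
  let ?Q = "?f ` (A \<times> B \<times> {0..})"
  have cQ: "convex ?Q"
    using A B by (intro convex_linear_image[OF lin] convex_Times) (auto simp: convex_cone_def)
  have 00: "0 \<in> A" "0 \<in> B" using A B by (auto intro: convex_cone_contains_0)
  have Q: "(a - b, \<eta> \<bullet> a + r) \<in> ?Q" if "a \<in> A" "b \<in> B" "r \<ge> 0" for a b r
    using that by (intro image_eqI[of _ _ "(a,b,r)"]) auto
  have 0: "(0,0) \<in> ?Q" using Q[of 0 0 0] 00 by simp
  \<comment> \<open>Otherwise the segment from \<open>(0, 1)\<close> through the origin could be
    prolonged to \<open>(0, 1 - e)\<close> with \<open>e > 1\<close>, giving a point of
    \<open>A \<inter> B\<close> at which \<open>\<eta>\<close> is negative.\<close>
  have n0: "(0,0) \<notin> rel_interior ?Q"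
  proof
    assume r: "(0,0) \<in> rel_interior ?Q"
    have 1: "(0,1) \<in> ?Q" using Q[of 0 0 1] 00 by simp
    have ne: "?Q \<noteq> {}" using 0 by blast
    obtain e where e: "e > 1" "(1 - e) *\<^sub>R (0,1) + e *\<^sub>R (0,0) \<in> ?Q"
      using bspec[OF iffD1[OF convex_rel_interior_iff[OF cQ ne] r] 1] by auto
    then have "(0, 1 - e) \<in> ?Q" by simp
    then obtain p where "p \<in> A \<times> B \<times> {0..}" "(0, 1 - e) = ?f p" by blast
    then obtain a b r where "a \<in> A" "b \<in> B" "r \<ge> 0" "a - b = 0" "\<eta> \<bullet> a + r = 1 - e"
      by (cases p) auto
    then have "a \<in> A \<inter> B" "\<eta> \<bullet> a < 0" using \<open>e > 1\<close> by auto
    then show False using dual_coneD[OF \<eta>, of a] by (simp add: inner_commute)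
  qed
  obtain us where us: "\<And>y. y \<in> ?Q \<Longrightarrow> us \<bullet> (0,0) \<le> us \<bullet> y" "\<And>y. y \<in> rel_interior ?Q \<Longrightarrow> us \<bullet> (0,0) < us \<bullet> y"
    by (rule supporting_hyperplane_rel_boundary[OF cQ 0 n0]) (rule that)
  obtain u s where us_eq: "us = (u,s)" by (cases us)
  have key: "0 \<le> u \<bullet> (a - b) + s * (\<eta> \<bullet> a + r)" if "a \<in> A" "b \<in> B" "r \<ge> 0" for a b r
    using us(1)[OF Q[OF that]] by (simp add: us_eq inner_Pair)
  have s0: "s \<ge> 0" using key[of 0 0 1] 00 by simp
  \<comment> \<open>With \<open>s = 0\<close> the functional \<open>u\<close> is nonnegative on
    \<open>A\<close> and nonpositive on \<open>B\<close>, so it vanishes at the common relatively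
    interior point and hence on both cones; the support at the origin would not be proper.\<close>
  have "s \<noteq> 0"
  proof
    assume s: "s = 0"
    obtain a0 where a0: "a0 \<in> rel_interior A" "a0 \<in> rel_interior B" using ne by blast
    then have a0': "a0 \<in> A" "a0 \<in> B" using rel_interior_subset by blast+
    have u: "u \<in> dual_cone A" "- u \<in> dual_cone B"
      using key[of _ 0 0] key[of 0 _ 0] 00 s by (auto simp: dual_cone_def inner_commute)
    have "u \<bullet> a0 = 0"
      using dual_coneD[OF u(1) a0'(1)] dual_coneD[OF u(2) a0'(2)] by (simp add: inner_commute)
    then have "u \<bullet> a0 = 0" "(- u) \<bullet> a0 = 0" by simp_all
    then have "\<forall>y\<in>A. u \<bullet> y = 0" "\<forall>y\<in>B. (- u) \<bullet> y = 0"
      using a0 u unfolding rel_interior_convex_cone_iff[OF A] rel_interior_convex_cone_iff[OF B]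
      by blast+
    then have "us \<bullet> y = 0" if "y \<in> ?Q" for y
      using that by (auto simp: us_eq s inner_diff_right)
    moreover have "?Q \<noteq> {}" using 0 by blast
    then have "rel_interior ?Q \<noteq> {}" using rel_interior_eq_empty[OF cQ] by simp
    then obtain y where y: "y \<in> rel_interior ?Q" by blast
    moreover have "y \<in> ?Q" by (rule subsetD[OF rel_interior_subset y])
    ultimately show False using us(2)[OF y] by (simp add: us_eq)
  qed
  with s0 have sp: "s > 0" by simp
  show ?thesis
  proof (intro bexI)
    show "\<eta> + (1 / s) *\<^sub>R u \<in> dual_cone A"
    proof (rule dual_coneI)
      fix a assume "a \<in> A"
      from key[OF this 00(2), of 0] have "0 \<le> (1 / s) * (u \<bullet> a + s * (\<eta> \<bullet> a))"
        using sp by simp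
      then show "0 \<le> a \<bullet> (\<eta> + (1 / s) *\<^sub>R u)"
        using sp by (simp add: inner_simps inner_commute algebra_simps add_divide_distrib)
    qed
    show "\<eta> - (\<eta> + (1 / s) *\<^sub>R u) \<in> dual_cone B"
    proof (rule dual_coneI)
      fix b assume "b \<in> B"
      from key[OF 00(1) this, of 0] have "u \<bullet> b \<le> 0" by simp
      then show "0 \<le> b \<bullet> (\<eta> - (\<eta> + (1 / s) *\<^sub>R u))"
        using sp by (simp add: inner_simps inner_commute divide_nonpos_pos)
    qed
  qed
qed

text \<open>The number of summands is fixed by the type \<open>'j\<close>, with room for the at most
  \<open>DIM('a) + 1\<close> points of Caratheodory's theorem and zero coefficients for the rest. A
  coefficient vector of fixed length is what allows a measurable choice later.\<close>

lemma conic_caratheodory: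
  fixes c :: "nat \<Rightarrow> 'a::euclidean_space"
  assumes x: "x \<in> convex_cone hull (range c)" and card: "DIM('a) < CARD('j)"
  obtains i :: "'j::finite \<Rightarrow> nat" and l :: "real ^ 'j"
  where "\<And>j. 0 \<le> l $ j" "x = (\<Sum>j\<in>UNIV. (l $ j) *\<^sub>R c (i j))"
proof -
  obtain y t where y: "y \<in> convex hull (range c)" and t: "t \<ge> 0" "x = t *\<^sub>R y"
    using x by (auto simp: convex_cone_hull_convex_hull_nonempty)
  obtain S where S: "finite S" "S \<subseteq> range c" "card S \<le> DIM('a) + 1" "y \<in> convex hull S"
    using y unfolding caratheodory[of "range c"] by blast
  obtain u where u: "\<forall>v\<in>S. 0 \<le> u v" "(\<Sum>v\<in>S. u v *\<^sub>R v) = y"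
    using S(1,4) by (auto simp: convex_hull_finite)
  obtain f :: "'a \<Rightarrow> 'j" where f: "inj_on f S"
    using card_le_inj[of S "UNIV :: 'j set"] S card by fastforce
  \<comment> \<open>For \<open>j\<close> outside the image of \<open>S\<close> under
    \<open>f\<close> the index is arbitrary; the coefficient there is 0.\<close>
  define i where "i j = (SOME n. c n = inv_into S f j)" for j
  have i: "c (i (f v)) = v" if "v \<in> S" for v
  proof -
    have "v \<in> range c" using S(2) that by blast
    then obtain n where "c n = v" by blast
    then show ?thesis unfolding i_def using inv_into_f_f[OF f that] by (metis (mono_tags, lifting) someI)
  qed
  define l :: "real ^ 'j" where "l = (\<chi> j. if j \<in> f ` S then t * u (inv_into S f j) else 0)"
  show ?thesis
  proof (rule that)
    show "0 \<le> l $ j" for j using t u(1) f by (auto simp: l_def)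
    have "(\<Sum>j\<in>UNIV. (l $ j) *\<^sub>R c (i j)) = (\<Sum>j\<in>f ` S. (l $ j) *\<^sub>R c (i j))"
      by (intro sum.mono_neutral_right) (auto simp: l_def)
    also have "\<dots> = (\<Sum>v\<in>S. (l $ f v) *\<^sub>R c (i (f v)))"
      using f by (simp add: sum.reindex)
    also have "\<dots> = (\<Sum>v\<in>S. t *\<^sub>R (u v *\<^sub>R v))"
      using f by (intro sum.cong) (auto simp: l_def i)
    also have "\<dots> = x" unfolding t(2) u(2)[symmetric] scaleR_sum_right ..
    finally show "x = (\<Sum>j\<in>UNIV. (l $ j) *\<^sub>R c (i j))" by simp
  qed
qed

section \<open>Measurable set-valued maps\<close>

text \<open>Empty and non-closed values are allowed, in contrast to measurability into
  \<open>effros\<close>: \<open>W_seq\<close> may be empty, and countable generating sets are not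
  closed in general.\<close>

definition effros_measurable :: "'w measure \<Rightarrow> ('w \<Rightarrow> 'a::topological_space set) \<Rightarrow> bool" where
  "effros_measurable H S \<longleftrightarrow> (\<forall>V. open V \<longrightarrow> {\<omega>\<in>space H. S \<omega> \<inter> V \<noteq> {}} \<in> sets H)"

lemma effros_measurableD:
  "effros_measurable H S \<Longrightarrow> open V \<Longrightarrow> {\<omega>\<in>space H. S \<omega> \<inter> V \<noteq> {}} \<in> sets H"
  by (simp add: effros_measurable_def)

lemma effros_measurable_cong:
  assumes "\<And>\<omega>. \<omega> \<in> space H \<Longrightarrow> S \<omega> = S' \<omega>"
  shows "effros_measurable H S \<longleftrightarrow> effros_measurable H S'"
proof -
  have "{\<omega>\<in>space H. S \<omega> \<inter> V \<noteq> {}} = {\<omega>\<in>space H. S' \<omega> \<inter> V \<noteq> {}}" for V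
    using assms by auto
  then show ?thesis by (simp add: effros_measurable_def)
qed

lemma effros_measurable_closure:
  assumes "effros_measurable H S"
  shows "effros_measurable H (\<lambda>\<omega>. closure (S \<omega>))"
  using assms by (simp add: effros_measurable_def Int_commute open_Int_closure_eq_empty)

section \<open>Measurability through distance functions and zero sets\<close>

lemma infdist_less_iff:
  assumes "A \<noteq> {}"
  shows "infdist x A < e \<longleftrightarrow> A \<inter> ball x e \<noteq> {}"
proof -
  have "infdist x A < e \<longleftrightarrow> (\<exists>a\<in>A. dist x a < e)"
    unfolding infdist_notempty[OF assms] by (intro cINF_less_iff) (auto simp: assms intro!: bdd_belowI[of _ 0])
  then show ?thesis by auto
qed

lemma borel_measurable_infdist_multifun:
  assumes "effros_measurable H S" "\<And>\<omega>. \<omega> \<in> space H \<Longrightarrow> S \<omega> \<noteq> {}"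
  shows "(\<lambda>\<omega>. infdist x (S \<omega>)) \<in> borel_measurable H"
proof (rule borel_measurableI_less)
  fix e
  have "{\<omega>\<in>space H. infdist x (S \<omega>) < e} = {\<omega>\<in>space H. S \<omega> \<inter> ball x e \<noteq> {}}"
    using infdist_less_iff[OF assms(2)] by blast
  then show "{\<omega>\<in>space H. infdist x (S \<omega>) < e} \<in> sets H"
    using effros_measurableD[OF assms(1)] by simp
qed

text \<open>Simple functions converging to \<open>v\<close> reduce the claim to finitely many fixed
  arguments at a time, and continuity passes to the limit.\<close>

lemma borel_measurable_caratheodory_compose:
  fixes f :: "'w \<Rightarrow> 'a::{metric_space, second_countable_topology} \<Rightarrow> 'b::metric_space"
  assumes f: "\<And>x. (\<lambda>\<omega>. f \<omega> x) \<in> borel_measurable H"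
    and c: "\<And>\<omega>. \<omega> \<in> space H \<Longrightarrow> continuous_on UNIV (f \<omega>)"
    and v: "v \<in> borel_measurable H"
  shows "(\<lambda>\<omega>. f \<omega> (v \<omega>)) \<in> borel_measurable H"
proof -
  obtain F where F: "\<And>i. simple_function H (F i)" "\<And>x. x \<in> space H \<Longrightarrow> (\<lambda>i. F i x) \<longlonglongrightarrow> v x"
    using borel_measurable_implies_sequence_metric[OF v, of undefined] by blast
  show ?thesis
  proof (rule borel_measurable_LIMSEQ_metric)
    fix i
    have "(\<lambda>\<omega>. f \<omega> (F i \<omega>)) \<in> borel_measurable H"
    proof (rule measurable_compose_countable'[where I = "F i ` space H" and f = "\<lambda>x \<omega>. f \<omega> x"])
      show "F i \<in> H \<rightarrow>\<^sub>M count_space (F i ` space H)"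
        using F(1)[of i] by (subst measurable_count_space_eq2) (auto simp: simple_function_def)
      show "countable (F i ` space H)"
        using F(1)[of i] by (auto simp: simple_function_def intro: countable_finite)
    qed (rule f)
    then show "(\<lambda>\<omega>. f \<omega> (F i \<omega>)) \<in> borel_measurable H" .
  next
    fix \<omega> assume w: "\<omega> \<in> space H"
    have "isCont (f \<omega>) (v \<omega>)" using c[OF w] by (simp add: continuous_on_eq_continuous_at)
    then show "(\<lambda>i. f \<omega> (F i \<omega>)) \<longlonglongrightarrow> f \<omega> (v \<omega>)"
      using F(2)[OF w] by (rule isCont_tendsto_compose)
  qed
qed

lemma borel_measurable_infdist_compose:
  fixes S :: "'w \<Rightarrow> 'a::{metric_space, second_countable_topology} set"
  assumes "effros_measurable H S" "\<And>\<omega>. \<omega> \<in> space H \<Longrightarrow> S \<omega> \<noteq> {}" "v \<in> borel_measurable H"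
  shows "(\<lambda>\<omega>. infdist (v \<omega>) (S \<omega>)) \<in> borel_measurable H"
proof (rule borel_measurable_caratheodory_compose[where f = "\<lambda>\<omega> x. infdist x (S \<omega>)"])
  show "(\<lambda>\<omega>. infdist x (S \<omega>)) \<in> borel_measurable H" for x
    using assms(1,2) by (rule borel_measurable_infdist_multifun)
  show "continuous_on UNIV (\<lambda>x. infdist x (S \<omega>))" for \<omega>
    by (intro continuous_intros)
qed fact

lemma sets_Collect_in_multifun:
  fixes S :: "'w \<Rightarrow> 'a::{metric_space, second_countable_topology} set"
  assumes "effros_measurable H S" "\<And>\<omega>. \<omega> \<in> space H \<Longrightarrow> S \<omega> \<noteq> {}" "\<And>\<omega>. \<omega> \<in> space H \<Longrightarrow> closed (S \<omega>)"
    "v \<in> borel_measurable H"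
  shows "{\<omega>\<in>space H. v \<omega> \<in> S \<omega>} \<in> sets H"
proof -
  note [measurable] = borel_measurable_infdist_compose[OF assms(1,2,4)]
  have "{\<omega>\<in>space H. v \<omega> \<in> S \<omega>} = {\<omega>\<in>space H. infdist (v \<omega>) (S \<omega>) = 0}"
    using assms(2,3) by (auto simp: in_closed_iff_infdist_zero)
  then show ?thesis by simp
qed

text \<open>An open set is a countable union of compact sets. On a compact set a continuous function
  has a zero iff its modulus gets below every \<open>1 / Suc k\<close> on a countable dense subset,
  which is a countable condition on \<omega>. Dual cones, hyperplanes and intersections are measured
  in this way.\<close>

lemma effros_measurable_zero_set:
  fixes f :: "'w \<Rightarrow> 'a::euclidean_space \<Rightarrow> real"
  assumes f: "\<And>x. (\<lambda>\<omega>. f \<omega> x) \<in> borel_measurable H"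
    and c: "\<And>\<omega>. \<omega> \<in> space H \<Longrightarrow> continuous_on UNIV (f \<omega>)"
  shows "effros_measurable H (\<lambda>\<omega>. {x. f \<omega> x = 0})"
  unfolding effros_measurable_def
proof (intro allI impI)
  note [measurable] = f
  fix V :: "'a set" assume "open V"
  then obtain C :: "nat \<Rightarrow> 'a set" where C: "\<And>n. compact (C n)" "V = (\<Union>n. C n)"
    using open_Union_compact_subsets by metis
  have "\<exists>D. countable D \<and> D \<subseteq> C n \<and> C n \<subseteq> closure D" for n
    using separable[of "C n"] by metis
  then obtain D where D: "\<And>n. countable (D n)" "\<And>n. D n \<subseteq> C n" "\<And>n. C n \<subseteq> closure (D n)"
    by metis
  have eq: "{x. f \<omega> x = 0} \<inter> C n \<noteq> {} \<longleftrightarrow> (\<forall>k. \<exists>q\<in>D n. \<bar>f \<omega> q\<bar> < 1 / Suc k)" if w: "\<omega> \<in> space H" for \<omega> n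
  proof
    assume "{x. f \<omega> x = 0} \<inter> C n \<noteq> {}"
    then obtain x where x: "f \<omega> x = 0" "x \<in> C n" by auto
    then have "x \<in> closure (D n)" using D(3) by blast
    then obtain s where s: "\<And>i. s i \<in> D n" "s \<longlonglongrightarrow> x" by (auto simp: closure_sequential)
    have "isCont (f \<omega>) x" using c[OF w] by (simp add: continuous_on_eq_continuous_at)
    then have "(\<lambda>i. f \<omega> (s i)) \<longlonglongrightarrow> 0" using s(2) isCont_tendsto_compose x(1) by fastforce
    show "\<forall>k. \<exists>q\<in>D n. \<bar>f \<omega> q\<bar> < 1 / Suc k"
    proof
      fix k :: nat
      have "0 < 1 / real (Suc k)" by simp
      then obtain N where "\<forall>i\<ge>N. norm (f \<omega> (s i) - 0) < 1 / Suc k"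
        using LIMSEQ_D[OF \<open>(\<lambda>i. f \<omega> (s i)) \<longlonglongrightarrow> 0\<close>] by blast
      then have "\<bar>f \<omega> (s N)\<bar> < 1 / Suc k" by simp
      then show "\<exists>q\<in>D n. \<bar>f \<omega> q\<bar> < 1 / Suc k" using s(1) by blast
    qed
  next
    assume a: "\<forall>k. \<exists>q\<in>D n. \<bar>f \<omega> q\<bar> < 1 / Suc k"
    then obtain q where "q \<in> D n" by blast
    then have ne: "C n \<noteq> {}" using D(2) by blast
    have "continuous_on (C n) (\<lambda>x. \<bar>f \<omega> x\<bar>)"
      by (intro continuous_intros continuous_on_subset[OF c[OF w]]) auto
    then obtain x where x: "x \<in> C n" "\<forall>y\<in>C n. \<bar>f \<omega> x\<bar> \<le> \<bar>f \<omega> y\<bar>"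
      using continuous_attains_inf[OF C(1) ne] by blast
    have "\<bar>f \<omega> x\<bar> \<le> 0"
    proof (rule ccontr)
      assume "\<not> \<bar>f \<omega> x\<bar> \<le> 0"
      then obtain k where "1 / Suc k < \<bar>f \<omega> x\<bar>" using nat_approx_posE[of "\<bar>f \<omega> x\<bar>"] by auto
      then show False using a x(2) D(2) by (meson less_le_not_le less_trans not_le subsetD)
    qed
    then show "{x. f \<omega> x = 0} \<inter> C n \<noteq> {}" using x(1) by auto
  qed
  have "{\<omega>\<in>space H. {x. f \<omega> x = 0} \<inter> V \<noteq> {}} =
      {\<omega>\<in>space H. \<exists>n. \<forall>k. \<exists>q\<in>D n. \<bar>f \<omega> q\<bar> < 1 / Suc k}"
  proof -
    have "{x. f \<omega> x = 0} \<inter> V \<noteq> {} \<longleftrightarrow> (\<exists>n. {x. f \<omega> x = 0} \<inter> C n \<noteq> {})" for \<omega>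
      unfolding C(2) by blast
    then show ?thesis using eq by (intro Collect_cong conj_cong refl) (simp only:)
  qed
  also have "\<dots> \<in> sets H"
    using D(1) by (intro sets.sets_Collect_countable_Ex sets.sets_Collect_countable_All
        sets.sets_Collect_countable_Ex') measurable
  finally show "{\<omega>\<in>space H. {x. f \<omega> x = 0} \<inter> V \<noteq> {}} \<in> sets H" .
qed

text \<open>The system is condensed into one equation: the weighted sum of the truncated moduli
  converges uniformly, so it is continuous in \<open>x\<close>, and it vanishes iff every
  \<open>f n\<close> does.\<close>

lemma effros_measurable_zero_sets:
  fixes f :: "nat \<Rightarrow> 'w \<Rightarrow> 'a::euclidean_space \<Rightarrow> real"
  assumes f: "\<And>n x. (\<lambda>\<omega>. f n \<omega> x) \<in> borel_measurable H"
    and c: "\<And>n \<omega>. \<omega> \<in> space H \<Longrightarrow> continuous_on UNIV (f n \<omega>)"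
  shows "effros_measurable H (\<lambda>\<omega>. {x. \<forall>n. f n \<omega> x = 0})"
proof -
  note [measurable] = f
  define g where "g n \<omega> x = (1/2)^n * min 1 \<bar>f n \<omega> x\<bar>" for n \<omega> x
  have g: "0 \<le> g n \<omega> x" "g n \<omega> x \<le> (1/2)^n" for n \<omega> x
    by (auto simp: g_def mult_left_le)
  have sm: "summable (\<lambda>n. g n \<omega> x)" for \<omega> x
    by (rule summable_comparison_test'[OF summable_geometric[of "1/2"], of 0]) (use g in auto)
  have g0: "g n \<omega> x = 0 \<longleftrightarrow> f n \<omega> x = 0" for n \<omega> x
    by (auto simp: g_def min_def)
  have "(\<Sum>n. g n \<omega> x) = 0 \<longleftrightarrow> (\<forall>n. f n \<omega> x = 0)" for \<omega> x
    using suminf_eq_zero_iff[OF sm g(1)] by (simp only: g0)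
  moreover have "effros_measurable H (\<lambda>\<omega>. {x. (\<Sum>n. g n \<omega> x) = 0})"
  proof (rule effros_measurable_zero_set)
    show "(\<lambda>\<omega>. \<Sum>n. g n \<omega> x) \<in> borel_measurable H" for x
      unfolding g_def by measurable
    fix \<omega> assume w: "\<omega> \<in> space H"
    have "uniform_limit UNIV (\<lambda>n x. \<Sum>i<n. g i \<omega> x) (\<lambda>x. \<Sum>n. g n \<omega> x) sequentially"
      by (rule Weierstrass_m_test[where M = "\<lambda>n. (1/2)^n"]) (use g in auto)
    then show "continuous_on UNIV (\<lambda>x. \<Sum>n. g n \<omega> x)"
      by (rule uniform_limit_theorem[rotated])
        (auto simp: g_def intro!: always_eventually continuous_intros c[OF w])
  qed
  ultimately show ?thesis by simp
qed

section \<open>Measurable selections and Castaing representations\<close>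

lemma dense_sequence:
  obtains q :: "nat \<Rightarrow> 'a::second_countable_topology" where "\<And>V. open V \<Longrightarrow> V \<noteq> {} \<Longrightarrow> \<exists>n. q n \<in> V"
proof -
  obtain D :: "'a set" where D: "countable D" "\<And>V. open V \<Longrightarrow> V \<noteq> {} \<Longrightarrow> \<exists>d\<in>D. d \<in> V"
    using countable_dense_setE by metis
  have "D \<noteq> {}" using D(2)[of UNIV] by auto
  then have "\<exists>n. from_nat_into D n \<in> V" if "open V" "V \<noteq> {}" for V
    using D(2)[OF that] from_nat_into_surj[OF D(1)] by metis
  then show ?thesis by (rule that)
qed

text \<open>The Kuratowski--Ryll-Nardzewski selection theorem.\<close>

lemma measurable_selection:
  fixes S :: "'w \<Rightarrow> 'a::polish_space set"
  assumes S: "effros_measurable H S"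
    and cl: "\<And>\<omega>. \<omega> \<in> space H \<Longrightarrow> closed (S \<omega>)" and ne: "\<And>\<omega>. \<omega> \<in> space H \<Longrightarrow> S \<omega> \<noteq> {}"
  obtains f where "f \<in> borel_measurable H" "\<And>\<omega>. \<omega> \<in> space H \<Longrightarrow> f \<omega> \<in> S \<omega>"
proof -
  obtain q :: "nat \<Rightarrow> 'a" where q: "\<And>V. open V \<Longrightarrow> V \<noteq> {} \<Longrightarrow> \<exists>n. q n \<in> V"
    using dense_sequence by metis
  define r :: "nat \<Rightarrow> real" where "r k = (1/2)^k" for k
  have r0: "r k > 0" for k by (simp add: r_def)
  \<comment> \<open>The ball of radius \<open>(1/2)^k\<close> around \<open>q (N k \<omega>)\<close>
    meets \<open>S \<omega>\<close>. The next index is the first whose smaller ball meets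
    \<open>S \<omega>\<close> inside the current ball, which keeps consecutive centres close; taking
    the least index keeps it measurable.\<close>
  define N where "N = rec_nat (\<lambda>\<omega>. LEAST n. S \<omega> \<inter> ball (q n) (r 0) \<noteq> {})
     (\<lambda>k Nk \<omega>. LEAST n. S \<omega> \<inter> (ball (q n) (r (Suc k)) \<inter> ball (q (Nk \<omega>)) (r k)) \<noteq> {})"
  have N0: "N 0 \<omega> = (LEAST n. S \<omega> \<inter> ball (q n) (r 0) \<noteq> {})" for \<omega> by (simp add: N_def)
  have NS: "N (Suc k) \<omega> = (LEAST n. S \<omega> \<inter> (ball (q n) (r (Suc k)) \<inter> ball (q (N k \<omega>)) (r k)) \<noteq> {})" for k \<omega>
    by (simp add: N_def)
  have hit: "Measurable.pred H (\<lambda>\<omega>. S \<omega> \<inter> V \<noteq> {})" if "open V" for V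
    using effros_measurableD[OF S that] by (simp add: pred_def)
  have ex: "\<exists>n. S \<omega> \<inter> (ball (q n) e \<inter> V) \<noteq> {}" if "S \<omega> \<inter> V \<noteq> {}" "e > 0" for \<omega> V e
  proof -
    obtain s where s: "s \<in> S \<omega>" "s \<in> V" using \<open>S \<omega> \<inter> V \<noteq> {}\<close> by blast
    have "\<exists>n. q n \<in> ball s e" by (rule q) (use \<open>e > 0\<close> in auto)
    then obtain n where "dist s (q n) < e" by auto
    then have "s \<in> ball (q n) e" by (simp add: dist_commute)
    then show ?thesis using s by blast
  qed
  have I: "S \<omega> \<inter> ball (q (N k \<omega>)) (r k) \<noteq> {}" if w: "\<omega> \<in> space H" for k \<omega>
  proof (induction k)
    case 0
    have "\<exists>n. S \<omega> \<inter> ball (q n) (r 0) \<noteq> {}" using ex[of \<omega> UNIV "r 0"] ne[OF w] r0 by simp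
    then show ?case unfolding N0 by (rule LeastI_ex)
  next
    case (Suc k)
    have "S \<omega> \<inter> (ball (q (N (Suc k) \<omega>)) (r (Suc k)) \<inter> ball (q (N k \<omega>)) (r k)) \<noteq> {}"
      unfolding NS by (rule LeastI_ex) (rule ex[OF Suc r0])
    then show ?case by blast
  qed
  have d: "dist (q (N k \<omega>)) (q (N (Suc k) \<omega>)) < 2 * r k" if w: "\<omega> \<in> space H" for k \<omega>
  proof -
    have "S \<omega> \<inter> (ball (q (N (Suc k) \<omega>)) (r (Suc k)) \<inter> ball (q (N k \<omega>)) (r k)) \<noteq> {}"
      unfolding NS by (rule LeastI_ex) (rule ex[OF I[OF w] r0])
    then obtain s where "dist (q (N (Suc k) \<omega>)) s < r (Suc k)" "dist (q (N k \<omega>)) s < r k" by auto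
    moreover have "r (Suc k) \<le> r k" by (simp add: r_def)
    ultimately show ?thesis
      using dist_triangle2[of "q (N k \<omega>)" "q (N (Suc k) \<omega>)" s] by simp
  qed
  have mN: "N k \<in> H \<rightarrow>\<^sub>M count_space UNIV" for k
  proof (induction k)
    case 0
    have "(\<lambda>\<omega>. LEAST n. S \<omega> \<inter> ball (q n) (r 0) \<noteq> {}) \<in> H \<rightarrow>\<^sub>M count_space UNIV"
      by (intro measurable_Least hit open_ball)
    then show ?case by (simp add: N0[abs_def])
  next
    case (Suc k)
    have "Measurable.pred H (\<lambda>\<omega>. S \<omega> \<inter> (ball (q n) (r (Suc k)) \<inter> ball (q (N k \<omega>)) (r k)) \<noteq> {})" for n
      using Suc by (rule measurable_compose_countable[rotated]) (intro hit open_Int open_ball)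
    then have "(\<lambda>\<omega>. LEAST n. S \<omega> \<inter> (ball (q n) (r (Suc k)) \<inter> ball (q (N k \<omega>)) (r k)) \<noteq> {}) \<in> H \<rightarrow>\<^sub>M count_space UNIV"
      by (rule measurable_Least)
    then show ?case by (simp add: NS[abs_def])
  qed
  define f where "f \<omega> = lim (\<lambda>k. q (N k \<omega>))" for \<omega>
  have conv: "convergent (\<lambda>k. q (N k \<omega>))" if w: "\<omega> \<in> space H" for \<omega>
  proof (rule Cauchy_convergent)
    show "Cauchy (\<lambda>k. q (N k \<omega>))"
    proof (rule metric_CauchyI)
      fix e :: real assume e: "0 < e"
      \<comment> \<open>The bound telescopes because
        \<open>2 * r k = 4 * r k - 4 * r (Suc k)\<close>.\<close>
      have b: "dist (q (N m \<omega>)) (q (N (m + j) \<omega>)) \<le> 4 * r m - 4 * r (m + j)" for m j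
      proof (induction j)
        case (Suc j)
        have "dist (q (N m \<omega>)) (q (N (m + Suc j) \<omega>)) \<le>
            dist (q (N m \<omega>)) (q (N (m + j) \<omega>)) + dist (q (N (m + j) \<omega>)) (q (N (Suc (m + j)) \<omega>))"
          using dist_triangle by simp
        also have "\<dots> \<le> (4 * r m - 4 * r (m + j)) + 2 * r (m + j)"
          using Suc d[OF w, of "m + j"] by simp
        also have "\<dots> = 4 * r m - 4 * r (m + Suc j)" by (simp add: r_def)
        finally show ?case .
      qed simp
      have "r \<longlonglongrightarrow> 0" unfolding r_def[abs_def] by (rule LIMSEQ_realpow_zero) auto
      then have "eventually (\<lambda>k. r k < e / 8) sequentially"
        using e by (intro order_tendstoD) auto
      then obtain K where K: "\<forall>k\<ge>K. r k < e / 8" by (auto simp: eventually_sequentially)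
      have "dist (q (N K \<omega>)) (q (N m \<omega>)) < e / 2" if "m \<ge> K" for m
        using b[of K "m - K"] K[rule_format, of K] r0[of m] that by simp
      then have "dist (q (N m \<omega>)) (q (N n \<omega>)) < e" if "m \<ge> K" "n \<ge> K" for m n
        using that dist_triangle3[of "q (N m \<omega>)" "q (N n \<omega>)" "q (N K \<omega>)"] by (smt (verit) field_sum_of_halves)
      then show "\<exists>M. \<forall>m\<ge>M. \<forall>n\<ge>M. dist (q (N m \<omega>)) (q (N n \<omega>)) < e" by blast
    qed
  qed
  show ?thesis
  proof (rule that)
    show "f \<in> borel_measurable H"
    proof (rule borel_measurable_LIMSEQ_metric)
      show "(\<lambda>\<omega>. q (N k \<omega>)) \<in> borel_measurable H" for k
        by (rule measurable_compose[OF mN]) simp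
    qed (use conv in \<open>simp add: f_def convergent_LIMSEQ_iff\<close>)
    fix \<omega> assume w: "\<omega> \<in> space H"
    have lim: "(\<lambda>k. q (N k \<omega>)) \<longlonglongrightarrow> f \<omega>"
      using conv[OF w] by (simp add: f_def convergent_LIMSEQ_iff)
    then have "(\<lambda>k. infdist (q (N k \<omega>)) (S \<omega>)) \<longlonglongrightarrow> infdist (f \<omega>) (S \<omega>)"
      by (rule tendsto_infdist)
    moreover have "(\<lambda>k. infdist (q (N k \<omega>)) (S \<omega>)) \<longlonglongrightarrow> 0"
    proof (rule tendsto_sandwich[of "\<lambda>_. 0" _ _ r])
      show "r \<longlonglongrightarrow> 0" unfolding r_def[abs_def] by (rule LIMSEQ_realpow_zero) auto
      show "\<forall>\<^sub>F k in sequentially. infdist (q (N k \<omega>)) (S \<omega>) \<le> r k"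
        using I[OF w] ne[OF w] by (intro always_eventually allI less_imp_le) (simp add: infdist_less_iff)
    qed (auto simp: infdist_nonneg)
    ultimately have "infdist (f \<omega>) (S \<omega>) = 0" by (rule LIMSEQ_unique)
    then show "f \<omega> \<in> S \<omega>" using cl[OF w] ne[OF w] by (simp add: in_closed_iff_infdist_zero)
  qed
qed

text \<open>For each ball of a countable family one selection is taken from the part of
  \<open>S\<close> near that ball. Arbitrarily small radii around dense centres make the selections
  dense.\<close>

lemma castaing_representation:
  fixes S :: "'w \<Rightarrow> 'a::polish_space set"
  assumes S: "effros_measurable H S"
    and cl: "\<And>\<omega>. \<omega> \<in> space H \<Longrightarrow> closed (S \<omega>)" and ne: "\<And>\<omega>. \<omega> \<in> space H \<Longrightarrow> S \<omega> \<noteq> {}"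
  obtains f :: "nat \<Rightarrow> 'w \<Rightarrow> 'a" where "\<And>n. f n \<in> borel_measurable H"
    "\<And>\<omega>. \<omega> \<in> space H \<Longrightarrow> closure (range (\<lambda>n. f n \<omega>)) = S \<omega>"
proof -
  obtain q :: "nat \<Rightarrow> 'a" where q: "\<And>V. open V \<Longrightarrow> V \<noteq> {} \<Longrightarrow> \<exists>n. q n \<in> V"
    using dense_sequence by metis
  define B where "B p = ball (q (fst p)) (1 / Suc (snd p))" for p :: "nat \<times> nat"
  \<comment> \<open>The closure restores closedness after cutting with an open ball, and the
    fallback to all of \<open>S \<omega>\<close> keeps the map nonempty where the ball is
    missed.\<close>
  define S' where "S' p \<omega> = (if S \<omega> \<inter> B p \<noteq> {} then closure (S \<omega> \<inter> B p) else S \<omega>)" for p \<omega>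
  have "\<exists>f. f \<in> borel_measurable H \<and> (\<forall>\<omega>\<in>space H. f \<omega> \<in> S' p \<omega>)" for p
  proof -
    have "effros_measurable H (S' p)"
      unfolding effros_measurable_def
    proof (intro allI impI)
      fix V :: "'a set" assume V: "open V"
      have "{\<omega>\<in>space H. S' p \<omega> \<inter> V \<noteq> {}} = {\<omega>\<in>space H. S \<omega> \<inter> (B p \<inter> V) \<noteq> {}} \<union>
         ({\<omega>\<in>space H. S \<omega> \<inter> V \<noteq> {}} - {\<omega>\<in>space H. S \<omega> \<inter> B p \<noteq> {}})"
        using open_Int_closure_eq_empty[OF V, of "S \<omega> \<inter> B p" for \<omega>]
        by (auto simp: S'_def Int_ac)
      also have "\<dots> \<in> sets H"
        using V by (intro sets.Un sets.Diff effros_measurableD[OF S]) (auto simp: B_def)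
      finally show "{\<omega>\<in>space H. S' p \<omega> \<inter> V \<noteq> {}} \<in> sets H" .
    qed
    moreover have "closed (S' p \<omega>)" "S' p \<omega> \<noteq> {}" if "\<omega> \<in> space H" for \<omega>
      using cl[OF that] ne[OF that] by (auto simp: S'_def)
    ultimately show ?thesis
      using measurable_selection[of H "S' p"] by metis
  qed
  then obtain g where g: "\<And>p. g p \<in> borel_measurable H" "\<And>p \<omega>. \<omega> \<in> space H \<Longrightarrow> g p \<omega> \<in> S' p \<omega>"
    by metis
  show ?thesis
  proof (rule that[of "\<lambda>n. g (prod_decode n)"])
    show "g (prod_decode n) \<in> borel_measurable H" for n by (rule g)
    fix \<omega> assume w: "\<omega> \<in> space H"
    have sub: "S' p \<omega> \<subseteq> S \<omega>" for p
      using cl[OF w] by (auto simp: S'_def intro: closure_minimal[THEN subsetD, rotated])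
    show "closure (range (\<lambda>n. g (prod_decode n) \<omega>)) = S \<omega>"
    proof
      show "closure (range (\<lambda>n. g (prod_decode n) \<omega>)) \<subseteq> S \<omega>"
        using subsetD[OF sub g(2)[OF w]] cl[OF w] by (intro closure_minimal) blast+
      show "S \<omega> \<subseteq> closure (range (\<lambda>n. g (prod_decode n) \<omega>))"
      proof
        fix s assume s: "s \<in> S \<omega>"
        show "s \<in> closure (range (\<lambda>n. g (prod_decode n) \<omega>))"
          unfolding closure_approachable
        proof (intro allI impI)
          fix e :: real assume "0 < e"
          then obtain j where j: "1 / Suc j < e / 2" using nat_approx_posE[of "e/2"] by auto
          have "\<exists>m. q m \<in> ball s (1 / Suc j)" by (rule q) auto
          then obtain m where m: "dist s (q m) < 1 / Suc j" by auto
          have "s \<in> B (m,j)" using m by (simp add: B_def dist_commute)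
          then have "S \<omega> \<inter> B (m,j) \<noteq> {}" using s by blast
          then have "g (m,j) \<omega> \<in> closure (S \<omega> \<inter> B (m,j))" using g(2)[OF w, of "(m,j)"] by (simp add: S'_def)
          also have "\<dots> \<subseteq> cball (q m) (1 / Suc j)" by (intro closure_minimal) (auto simp: B_def)
          finally have "dist (q m) (g (m,j) \<omega>) \<le> 1 / Suc j" by simp
          then have "dist (g (m,j) \<omega>) s < e"
            using m j dist_triangle[of s "g (m,j) \<omega>" "q m"] by (simp add: dist_commute)
          then show "\<exists>y\<in>range (\<lambda>n. g (prod_decode n) \<omega>). dist y s < e"
            by (intro bexI[of _ "g (m,j) \<omega>"]) (auto intro!: image_eqI[of _ _ "prod_encode (m,j)"])
        qed
      qed
    qed
  qed
qed

text \<open>A Castaing representation of the closure turns membership in the dual into countably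
  many linear inequalities, each the zero set of a negative part.\<close>

lemma effros_measurable_dual_cone:
  fixes S :: "'w \<Rightarrow> 'a::euclidean_space set"
  assumes S: "effros_measurable H S" and ne: "\<And>\<omega>. \<omega> \<in> space H \<Longrightarrow> S \<omega> \<noteq> {}"
  shows "effros_measurable H (\<lambda>\<omega>. dual_cone (S \<omega>))"
proof -
  have "\<exists>f. (\<forall>n. f n \<in> borel_measurable H) \<and>
      (\<forall>\<omega>\<in>space H. closure (range (\<lambda>n::nat. f n \<omega>)) = closure (S \<omega>))"
    by (rule castaing_representation[OF effros_measurable_closure[OF S] closed_closure])
      (simp add: ne, blast)
  then obtain f where f: "\<And>n. f n \<in> borel_measurable H"
      "\<And>\<omega>. \<omega> \<in> space H \<Longrightarrow> closure (range (\<lambda>n::nat. f n \<omega>)) = closure (S \<omega>)"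
    by blast
  note [measurable] = f(1)
  have "effros_measurable H (\<lambda>\<omega>. {y. \<forall>n::nat. max 0 (- (f n \<omega> \<bullet> y)) = 0})"
  proof (rule effros_measurable_zero_sets)
    show "(\<lambda>\<omega>. max 0 (- (f n \<omega> \<bullet> y))) \<in> borel_measurable H" for n y
      by measurable
    show "continuous_on UNIV (\<lambda>y. max 0 (- (f n \<omega> \<bullet> y)))" for n \<omega>
      by (intro continuous_intros)
  qed
  also have "?this \<longleftrightarrow> ?thesis"
  proof (rule effros_measurable_cong)
    fix \<omega> assume w: "\<omega> \<in> space H"
    have "dual_cone (S \<omega>) = dual_cone (range (\<lambda>n. f n \<omega>))"
      unfolding dual_cone_closure[of "S \<omega>", symmetric] f(2)[OF w, symmetric] by (rule dual_cone_closure)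
    also have "\<dots> = {y. \<forall>n::nat. max 0 (- (f n \<omega> \<bullet> y)) = 0}"
    proof -
      have "max 0 (- a) = 0 \<longleftrightarrow> 0 \<le> a" for a :: real by linarith
      then show ?thesis by (simp add: dual_cone_def)
    qed
    finally show "{y. \<forall>n::nat. max 0 (- (f n \<omega> \<bullet> y)) = 0} = dual_cone (S \<omega>)" ..
  qed
  finally show ?thesis .
qed

text \<open>With \<open>c = - 1\<close> this is the set of ways to split \<open>v\<close> into a
  summand from \<open>S\<close> and a remainder in \<open>S'\<close>. Both conditions say that a
  distance, continuous in \<open>x\<close>, vanishes.\<close>

lemma effros_measurable_Int_shift:
  fixes S S' :: "'w \<Rightarrow> 'a::euclidean_space set"
  assumes S: "effros_measurable H S" "\<And>\<omega>. \<omega> \<in> space H \<Longrightarrow> S \<omega> \<noteq> {}" "\<And>\<omega>. \<omega> \<in> space H \<Longrightarrow> closed (S \<omega>)"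
    and S': "effros_measurable H S'" "\<And>\<omega>. \<omega> \<in> space H \<Longrightarrow> S' \<omega> \<noteq> {}" "\<And>\<omega>. \<omega> \<in> space H \<Longrightarrow> closed (S' \<omega>)"
    and v: "v \<in> borel_measurable H"
  shows "effros_measurable H (\<lambda>\<omega>. {x \<in> S \<omega>. v \<omega> + c *\<^sub>R x \<in> S' \<omega>})"
proof -
  define f where "f n \<omega> x = (if n = (0::nat) then infdist x (S \<omega>) else infdist (v \<omega> + c *\<^sub>R x) (S' \<omega>))" for n \<omega> x
  note [measurable] = v
  have "effros_measurable H (\<lambda>\<omega>. {x. \<forall>n. f n \<omega> x = 0})"
  proof (rule effros_measurable_zero_sets)
    show "(\<lambda>\<omega>. f n \<omega> x) \<in> borel_measurable H" for n x
      using borel_measurable_infdist_multifun[OF S(1,2)] borel_measurable_infdist_compose[OF S'(1,2), of "\<lambda>\<omega>. v \<omega> + c *\<^sub>R x"]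
      by (cases "n = 0") (simp_all add: f_def)
    show "continuous_on UNIV (f n \<omega>)" for n \<omega>
      unfolding f_def[abs_def] by (cases "n = 0") (auto intro!: continuous_intros)
  qed
  also have "?this \<longleftrightarrow> ?thesis"
  proof (rule effros_measurable_cong)
    fix \<omega> assume w: "\<omega> \<in> space H"
    show "{x. \<forall>n. f n \<omega> x = 0} = {x \<in> S \<omega>. v \<omega> + c *\<^sub>R x \<in> S' \<omega>}"
      using S(2,3)[OF w] S'(2,3)[OF w]
      by (auto simp: f_def in_closed_iff_infdist_zero split: if_splits)
  qed
  finally show ?thesis .
qed

lemma effros_measurable_Int:
  fixes S S' :: "'w \<Rightarrow> 'a::euclidean_space set"
  assumes S: "effros_measurable H S" "\<And>\<omega>. \<omega> \<in> space H \<Longrightarrow> S \<omega> \<noteq> {}" "\<And>\<omega>. \<omega> \<in> space H \<Longrightarrow> closed (S \<omega>)"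
    and S': "effros_measurable H S'" "\<And>\<omega>. \<omega> \<in> space H \<Longrightarrow> S' \<omega> \<noteq> {}" "\<And>\<omega>. \<omega> \<in> space H \<Longrightarrow> closed (S' \<omega>)"
  shows "effros_measurable H (\<lambda>\<omega>. S \<omega> \<inter> S' \<omega>)"
proof -
  have "{x \<in> S \<omega>. 0 + 1 *\<^sub>R x \<in> S' \<omega>} = S \<omega> \<inter> S' \<omega>" for \<omega> by auto
  then show ?thesis using effros_measurable_Int_shift[OF assms, of "\<lambda>_. 0" 1] by simp
qed

section \<open>Regular conditional distributions\<close>

text \<open>Right continuity of a distribution function, for use where bounds are available only at
  the rationals in \<open>(x, b)\<close>.\<close>

lemma emeasure_atMost_lower_bound:
  fixes N :: "real measure" and x b :: real
  assumes N: "finite_measure N" "sets N = sets borel" and b: "x < b"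
    and c: "\<And>q::rat. x < of_rat q \<Longrightarrow> of_rat q < b \<Longrightarrow> c \<le> emeasure N {..of_rat q}"
  shows "c \<le> emeasure N {..x}"
proof -
  interpret finite_measure N by fact
  define y where "y n = x + (b - x) / real (Suc n)" for n
  have dec: "decseq (\<lambda>n. {..y n})"
    using b by (auto simp: decseq_def y_def frac_le intro: order_trans)
  have "(\<lambda>n. x + (b - x) * inverse (real (Suc n))) \<longlonglongrightarrow> x + (b - x) * 0"
    by (intro tendsto_intros LIMSEQ_inverse_real_of_nat)
  then have y_lim: "y \<longlonglongrightarrow> x" by (simp add: y_def[abs_def] divide_inverse)
  have Inter: "(\<Inter>n. {..y n}) = {..x}"
  proof (intro set_eqI iffI)
    fix z assume "z \<in> (\<Inter>n. {..y n})"
    then have "\<forall>n. z \<le> y n" by auto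
    then show "z \<in> {..x}" using LIMSEQ_le_const[OF y_lim, of z] by auto
  next
    fix z assume "z \<in> {..x}"
    then show "z \<in> (\<Inter>n. {..y n})" using b by (auto simp: y_def intro: order_trans)
  qed
  have "(\<lambda>n. emeasure N {..y n}) \<longlonglongrightarrow> emeasure N (\<Inter>n. {..y n})"
    by (rule Lim_emeasure_decseq[OF _ dec]) (auto simp: N(2))
  then have lim: "(\<lambda>n. emeasure N {..y n}) \<longlonglongrightarrow> emeasure N {..x}" by (simp add: Inter)
  have "c \<le> emeasure N {..y n}" for n
  proof -
    have "(b - x) / real (Suc n) \<le> (b - x) / 1" using b by (intro frac_le) auto
    then have "x < y n" "y n \<le> b" using b by (auto simp: y_def)
    then obtain q :: rat where q: "x < of_rat q" "of_rat q < y n" using of_rat_dense by blast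
    then have "c \<le> emeasure N {..of_rat q}" using c \<open>y n \<le> b\<close> by simp
    also have "\<dots> \<le> emeasure N {..y n}" using q by (intro emeasure_mono) (auto simp: N(2))
    finally show ?thesis .
  qed
  then show ?thesis by (intro LIMSEQ_le_const[OF lim]) auto
qed

lemma emeasure_lborel_unit_ennreal:
  "emeasure lborel ({0..1} \<inter> {u. ennreal u \<le> c}) = min c 1"
proof (cases "c \<ge> 1")
  case True
  then have "{0..1} \<inter> {u. ennreal u \<le> c} = {0..1::real}"
    by (auto intro: order_trans[of _ 1] simp: ennreal_le_1)
  then show ?thesis using True by (simp add: min_def)
next
  case False
  then obtain r where r: "c = ennreal r" "0 \<le> r" by (cases c) auto
  with False have "r < 1" using ennreal_1 ennreal_le_iff[of r 1] by (metis ennreal_leI not_le)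
  then have "{0..1} \<inter> {u. ennreal u \<le> c} = {0..r}"
    using r by (auto simp: ennreal_le_iff)
  then show ?thesis using r \<open>r < 1\<close> by (simp add: min_def ennreal_le_1)
qed

text \<open>The versions \<open>E q\<close> of the conditional distribution function at rationals
  are monotone only almost surely. Instead of repairing them, the kernel is the image of the uniform
  law under a quantile function, hence a probability measure for every \<omega>. It is identified
  after integration over an event of \<open>H\<close>: there both sides are finite measures on the
  line, which are right continuous automatically.\<close>

lemma regular_cond_distr_unit_interval:
  fixes Y :: "'w \<Rightarrow> real"
  assumes M: "prob_space M" and H: "subalgebra M H" and Y: "Y \<in> borel_measurable M"
    and Y01: "\<And>\<omega>. 0 \<le> Y \<omega> \<and> Y \<omega> \<le> 1"
  shows "\<exists>\<nu>. regular_cond_distr M H borel Y \<nu>"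
proof -
  interpret prob_space M by fact
  interpret finite_measure_subalgebra M H by unfold_locales (rule H)
  have spH: "space H = space M" and setsH: "sets H \<subseteq> sets M" using H by (auto simp: subalgebra_def)
  note [measurable] = Y
  define E where "E q = nn_cond_exp M H (indicator {\<omega>\<in>space M. Y \<omega> \<le> of_rat q})" for q :: rat
  have E_meas[measurable]: "E q \<in> borel_measurable H" for q by (simp add: E_def)
  let ?I = "{q::rat. 0 \<le> q \<and> q \<le> 1}"
  have I: "?I \<noteq> {}" "countable ?I" by (auto intro: exI[of _ 0])
  \<comment> \<open>The conditional quantile function: its law under the uniform distribution has the
    conditional distribution function.\<close>
  define X where "X \<omega> u = (SUP q\<in>?I. if E q \<omega> < ennreal u then real_of_rat q else 0)" for \<omega> and u :: real
  have bdd: "bdd_above ((\<lambda>q. if E q \<omega> < ennreal u then real_of_rat q else 0) ` ?I)" for \<omega> u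
    by (intro bdd_aboveI[of _ 1]) auto
  \<comment> \<open>The value 0 contributed by rationals that fail the test is harmless because
    \<open>x\<close> is nonnegative; half-lines ending below 0 are treated separately.\<close>
  have X_le: "X \<omega> u \<le> x \<longleftrightarrow> (\<forall>q\<in>?I. x < of_rat q \<longrightarrow> ennreal u \<le> E q \<omega>)" if "0 \<le> x" for \<omega> u x
    unfolding X_def cSUP_le_iff[OF I(1) bdd] using that by (auto simp: not_less not_le split: if_splits)
  have X01: "0 \<le> X \<omega> u" "X \<omega> u \<le> 1" for \<omega> u
  proof -
    have "(if E 0 \<omega> < ennreal u then real_of_rat 0 else 0) \<le> X \<omega> u"
      unfolding X_def by (rule cSUP_upper[OF _ bdd]) auto
    then show "0 \<le> X \<omega> u" by (simp split: if_splits)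
    show "X \<omega> u \<le> 1" using X_le[of 1] by auto
  qed
  have X_meas: "case_prod X \<in> borel_measurable (H \<Otimes>\<^sub>M borel)"
    unfolding X_def[abs_def] case_prod_beta
    using bdd by (intro borel_measurable_cSUP[OF I(2)]) measurable
  define U where "U = uniform_measure lborel {0..1::real}"
  interpret U: prob_space U unfolding U_def by (rule prob_space_uniform_measure) auto
  have setsU[measurable_cong]: "sets U = sets borel" and spU: "space U = UNIV" by (auto simp: U_def)
  have U_le: "emeasure U {u. ennreal u \<le> c} = min c 1" for c
    by (simp add: U_def emeasure_lborel_unit_ennreal divide_ennreal_def)
  have Xw[measurable]: "X \<omega> \<in> borel_measurable borel" if "\<omega> \<in> space M" for \<omega>
    using measurable_compose_Pair1[OF _ X_meas] that by (simp add: spH)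
  define \<nu> where "\<nu> \<omega> = distr U borel (X \<omega>)" for \<omega>
  have \<nu>_meas: "\<nu> \<in> H \<rightarrow>\<^sub>M prob_algebra borel"
  proof (rule measurable_prob_algebraI)
    fix \<omega> assume "\<omega> \<in> space H"
    then show "prob_space (\<nu> \<omega>)" unfolding \<nu>_def using Xw spH by (intro U.prob_space_distr) simp
  next
    show "\<nu> \<in> H \<rightarrow>\<^sub>M subprob_algebra borel"
      unfolding \<nu>_def[abs_def]
    proof (rule measurable_distr2[where M = borel])
      show "(\<lambda>\<omega>. U) \<in> H \<rightarrow>\<^sub>M subprob_algebra borel"
        by (intro measurable_const) (auto simp: space_subprob_algebra setsU U.prob_space_axioms prob_space_imp_subprob_space)
    qed (rule X_meas)
  qed
  have \<nu>_le: "emeasure (\<nu> \<omega>) {..x} = emeasure U {u. X \<omega> u \<le> x}" if "\<omega> \<in> space M" for \<omega> x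
    unfolding \<nu>_def using Xw[OF that] by (subst emeasure_distr) (auto simp: spU vimage_def)
  have AE_mono: "AE \<omega> in M. \<forall>q r. q \<le> r \<longrightarrow> E q \<omega> \<le> E r \<omega>"
    unfolding AE_all_countable
  proof (intro allI)
    fix q r :: rat
    show "AE \<omega> in M. q \<le> r \<longrightarrow> E q \<omega> \<le> E r \<omega>"
    proof (cases "q \<le> r")
      case True
      then have "real_of_rat q \<le> of_rat r" by (simp add: of_rat_less_eq)
      then have "AE \<omega> in M. E q \<omega> \<le> E r \<omega>"
        unfolding E_def by (intro nn_cond_exp_mono) (auto simp: indicator_def)
      then show ?thesis by auto
    qed simp
  qed
  have AE_1: "AE \<omega> in M. \<forall>q. E q \<omega> \<le> 1"
    unfolding AE_all_countable
  proof
    fix q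
    have "AE \<omega> in M. E q \<omega> \<le> nn_cond_exp M H (\<lambda>_. 1) \<omega>"
      unfolding E_def by (intro nn_cond_exp_mono) (auto simp: indicator_def)
    moreover have "AE \<omega> in M. 1 = nn_cond_exp M H (\<lambda>_. 1) \<omega>"
      by (rule nn_cond_exp_F_meas) simp
    ultimately show "AE \<omega> in M. E q \<omega> \<le> 1" by eventually_elim simp
  qed
  \<comment> \<open>The condition \<open>X \<omega> u \<le> x\<close> constrains only rationals
    strictly above \<open>x\<close>, so only \<open>E q\<close> with \<open>x < q\<close> is
    reached. Right continuity of the integrated measures closes this gap.\<close>
  have up: "emeasure (\<nu> \<omega>) {..x} \<le> E q \<omega>" if "\<omega> \<in> space M" "0 \<le> x" "x < of_rat q" "real_of_rat q < 1" for x q \<omega>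
  proof -
    have "0 < real_of_rat q" using that by linarith
    then have "0 \<le> q" by simp
    moreover have "q \<le> 1" using that(4) by simp
    ultimately have "{u. X \<omega> u \<le> x} \<subseteq> {u. ennreal u \<le> E q \<omega>}" using that X_le[OF that(2)] by auto
    moreover have "{u. ennreal u \<le> E q \<omega>} \<in> sets U" by (simp add: setsU)
    ultimately have "emeasure (\<nu> \<omega>) {..x} \<le> emeasure U {u. ennreal u \<le> E q \<omega>}"
      unfolding \<nu>_le[OF that(1)] by (rule emeasure_mono)
    then show ?thesis unfolding U_le by simp
  qed
  have low: "AE \<omega> in M. \<forall>q. 0 \<le> q \<longrightarrow> E q \<omega> \<le> emeasure (\<nu> \<omega>) {..of_rat q}"
    using AE_mono AE_1 AE_space
  proof eventually_elim
    case (elim \<omega>)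
    show ?case
    proof (intro allI impI)
      fix q :: rat assume q: "0 \<le> q"
      have "min (E q \<omega>) 1 = emeasure U {u. ennreal u \<le> E q \<omega>}" by (rule U_le[symmetric])
      also have "\<dots> \<le> emeasure U {u. X \<omega> u \<le> of_rat q}"
      proof (rule emeasure_mono)
        show "{u. X \<omega> u \<le> of_rat q} \<in> sets U" using Xw[OF elim(3)] by (simp add: setsU)
        show "{u. ennreal u \<le> E q \<omega>} \<subseteq> {u. X \<omega> u \<le> of_rat q}"
          using elim(1) q by (auto simp: X_le of_rat_less intro: order_trans less_imp_le)
      qed
      finally show "E q \<omega> \<le> emeasure (\<nu> \<omega>) {..of_rat q}"
        using elim(2) by (simp add: \<nu>_le[OF elim(3)] min_def)
    qed
  qed
  have \<nu>_measM: "\<nu> \<in> M \<rightarrow>\<^sub>M subprob_algebra borel"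
    using measurable_from_subalg[OF H \<nu>_meas] by (rule measurable_prob_algebraD)
  have int_eq: "(\<integral>\<^sup>+\<omega>. indicator A \<omega> * emeasure (\<nu> \<omega>) C \<partial>M) = emeasure M (A \<inter> {\<omega>\<in>space M. Y \<omega> \<in> C})"
    if A: "A \<in> sets H" and C: "C \<in> sets borel" for A C
  proof -
    have AM[measurable]: "A \<in> sets M" using A setsH by auto
    \<comment> \<open>With \<open>M\<close> restricted to \<open>A\<close>, \<open>\<mu>1\<close> is
      the mixture of the kernel and \<open>\<mu>2\<close> the law of \<open>Y\<close>; the claim is
      that these two measures on the line coincide.\<close>
    define MA where "MA = density M (indicator A)"
    define \<mu>1 where "\<mu>1 = MA \<bind> \<nu>"
    define \<mu>2 where "\<mu>2 = distr MA borel Y"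
    have sets1: "sets \<mu>1 = sets borel"
      unfolding \<mu>1_def by (rule sets_bind) (auto simp: MA_def \<nu>_def not_empty)
    have sets2: "sets \<mu>2 = sets borel" by (simp add: \<mu>2_def)
    have e1: "emeasure \<mu>1 D = (\<integral>\<^sup>+\<omega>. indicator A \<omega> * emeasure (\<nu> \<omega>) D \<partial>M)" if D: "D \<in> sets borel" for D
    proof -
      have [measurable]: "(\<lambda>\<omega>. emeasure (\<nu> \<omega>) D) \<in> borel_measurable M"
        using \<nu>_measM D by (rule measurable_emeasure_kernel)
      have "emeasure \<mu>1 D = (\<integral>\<^sup>+\<omega>. emeasure (\<nu> \<omega>) D \<partial>MA)"
        unfolding \<mu>1_def by (rule emeasure_bind[OF _ _ D]) (use \<nu>_measM not_empty in \<open>auto simp: MA_def\<close>)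
      also have "\<dots> = (\<integral>\<^sup>+\<omega>. indicator A \<omega> * emeasure (\<nu> \<omega>) D \<partial>M)"
        unfolding MA_def by (subst nn_integral_density) auto
      finally show ?thesis .
    qed
    have e2: "emeasure \<mu>2 D = emeasure M (A \<inter> {\<omega>\<in>space M. Y \<omega> \<in> D})" if D[measurable]: "D \<in> sets borel" for D
    proof -
      have "emeasure \<mu>2 D = emeasure MA (Y -` D \<inter> space M)"
        unfolding \<mu>2_def by (subst emeasure_distr) (auto simp: MA_def)
      also have "\<dots> = emeasure M (A \<inter> (Y -` D \<inter> space M))"
        unfolding MA_def by (subst emeasure_density) (auto simp: nn_integral_indicator[symmetric] indicator_inter_arith[symmetric] simp del: nn_integral_indicator)
      also have "A \<inter> (Y -` D \<inter> space M) = A \<inter> {\<omega>\<in>space M. Y \<omega> \<in> D}" by auto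
      finally show ?thesis .
    qed
    have UB: "(UNIV :: real set) \<in> sets borel" by simp
    have fin1: "finite_measure \<mu>1"
    proof
      have "emeasure \<mu>1 UNIV \<le> (\<integral>\<^sup>+\<omega>. 1 \<partial>M)"
        unfolding e1[OF UB]
      proof (rule nn_integral_mono)
        fix \<omega> assume "\<omega> \<in> space M"
        then have "subprob_space (\<nu> \<omega>)" by (rule subprob_space_kernel[OF \<nu>_measM])
        then show "indicator A \<omega> * emeasure (\<nu> \<omega>) UNIV \<le> 1"
          by (auto simp: indicator_def intro: subprob_space.subprob_emeasure_le_1)
      qed
      then have "emeasure \<mu>1 UNIV \<le> 1" by (simp add: emeasure_space_1)
      then show "emeasure \<mu>1 (space \<mu>1) \<noteq> \<infinity>"
        using sets_eq_imp_space_eq[OF sets1] by (auto simp: top_unique)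
    qed
    have fin2: "finite_measure \<mu>2"
    proof
      have "emeasure \<mu>2 UNIV \<le> 1" using prob_le_1[of A] by (simp add: e2[of UNIV, simplified] emeasure_eq_measure)
      then show "emeasure \<mu>2 (space \<mu>2) \<noteq> \<infinity>"
        using sets_eq_imp_space_eq[OF sets2] by (auto simp: top_unique)
    qed
    have Eint: "(\<integral>\<^sup>+\<omega>. indicator A \<omega> * E q \<omega> \<partial>M) = emeasure \<mu>2 {..of_rat q}" for q
    proof -
      have "(\<integral>\<^sup>+\<omega>. indicator A \<omega> * E q \<omega> \<partial>M) = (\<integral>\<^sup>+\<omega>. indicator A \<omega> * indicator {\<omega>\<in>space M. Y \<omega> \<le> of_rat q} \<omega> \<partial>M)"
        unfolding E_def using A by (intro nn_cond_exp_intg) auto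
      also have "\<dots> = (\<integral>\<^sup>+\<omega>. indicator (A \<inter> {\<omega>\<in>space M. Y \<omega> \<le> of_rat q}) \<omega> \<partial>M)"
        by (simp add: indicator_inter_arith)
      also have "\<dots> = emeasure \<mu>2 {..of_rat q}" by (simp add: e2)
      finally show ?thesis .
    qed
    have up': "emeasure \<mu>1 {..x} \<le> emeasure \<mu>2 {..of_rat q}" if "0 \<le> x" "x < of_rat q" "real_of_rat q < 1" for x q
      unfolding Eint[symmetric] e1[OF atMost_borel]
      by (intro nn_integral_mono mult_left_mono up) (use that in auto)
    have low': "emeasure \<mu>2 {..of_rat q} \<le> emeasure \<mu>1 {..of_rat q}" if "0 \<le> q" for q
      unfolding Eint[symmetric] e1[OF atMost_borel]
    proof (rule nn_integral_mono_AE)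
      show "AE \<omega> in M. indicator A \<omega> * E q \<omega> \<le> indicator A \<omega> * emeasure (\<nu> \<omega>) {..of_rat q}"
        using low by eventually_elim (use that in \<open>auto intro: mult_left_mono\<close>)
    qed
    have eq: "emeasure \<mu>1 {..x} = emeasure \<mu>2 {..x}" for x
    proof -
      \<comment> \<open>Both measures live on the unit interval, so outside \<open>[0, 1)\<close> a
        half-line has mass 0 or the mass of \<open>A\<close>; inside, \<open>up'\<close> and
        \<open>low'\<close> give the two inequalities.\<close>
      consider "x < 0" | "0 \<le> x" "x < 1" | "1 \<le> x" by linarith
      then show ?thesis
      proof cases
        case 1
        have "emeasure (\<nu> \<omega>) {..x} = 0" if "\<omega> \<in> space M" for \<omega>
        proof -
          have "\<not> X \<omega> u \<le> x" for u using 1 X01(1)[of \<omega> u] by linarith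
          then have "{u. X \<omega> u \<le> x} = {}" by simp
          then show ?thesis using \<nu>_le[OF that, of x] by simp
        qed
        then have "(\<integral>\<^sup>+\<omega>. indicator A \<omega> * emeasure (\<nu> \<omega>) {..x} \<partial>M) = (\<integral>\<^sup>+\<omega>. 0 \<partial>M)"
          by (intro nn_integral_cong) simp
        moreover have "A \<inter> {\<omega>\<in>space M. Y \<omega> \<in> {..x}} = {}" 
        proof -
          have "\<not> Y \<omega> \<le> x" for \<omega> using 1 Y01[of \<omega>] by linarith
          then show ?thesis by auto
        qed
        then have "emeasure \<mu>2 {..x} = 0" by (simp only: e2[OF atMost_borel] emeasure_empty)
        ultimately show ?thesis by (simp add: e1)
      next
        case 2
        show ?thesis
        proof (rule antisym)
          show "emeasure \<mu>1 {..x} \<le> emeasure \<mu>2 {..x}"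
            by (rule emeasure_atMost_lower_bound[OF fin2 sets2 2(2)]) (use up' 2 in auto)
          show "emeasure \<mu>2 {..x} \<le> emeasure \<mu>1 {..x}"
          proof (rule emeasure_atMost_lower_bound[OF fin1 sets1 2(2)])
            fix q :: rat assume q: "x < of_rat q" "of_rat q < (1::real)"
            then have "0 < real_of_rat q" using 2 by linarith
            then have "0 \<le> q" by simp
            have "emeasure \<mu>2 {..x} \<le> emeasure \<mu>2 {..of_rat q}"
              using q by (intro emeasure_mono) (auto simp: sets2)
            also have "\<dots> \<le> emeasure \<mu>1 {..of_rat q}" by (rule low'[OF \<open>0 \<le> q\<close>])
            finally show "emeasure \<mu>2 {..x} \<le> emeasure \<mu>1 {..of_rat q}" .
          qed
        qed
      next
        case 3
        have "emeasure (\<nu> \<omega>) {..x} = 1" if "\<omega> \<in> space M" for \<omega>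
        proof -
          have "X \<omega> u \<le> x" for u using 3 X01(2)[of \<omega> u] by linarith
          then have "{u. X \<omega> u \<le> x} = space U" by (simp add: spU)
          then show ?thesis using \<nu>_le[OF that, of x] U.emeasure_space_1 by simp
        qed
        then have "(\<integral>\<^sup>+\<omega>. indicator A \<omega> * emeasure (\<nu> \<omega>) {..x} \<partial>M) = (\<integral>\<^sup>+\<omega>. indicator A \<omega> \<partial>M)"
          by (intro nn_integral_cong) simp
        moreover have "A \<inter> {\<omega>\<in>space M. Y \<omega> \<in> {..x}} = A"
        proof -
          have "Y \<omega> \<le> x" for \<omega> using 3 Y01[of \<omega>] by linarith
          then show ?thesis using sets.sets_into_space[OF AM] by auto
        qed
        then have "emeasure \<mu>2 {..x} = emeasure M A" by (simp only: e2[OF atMost_borel])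
        ultimately show ?thesis by (simp add: e1)
      qed
    qed
    have "\<mu>1 = \<mu>2"
    proof (rule measure_eqI_generator_eq[where E = "range atMost" and \<Omega> = UNIV and A = "\<lambda>n. {..real n}"])
      show "Int_stable (range (atMost :: real \<Rightarrow> real set))" by (auto simp: Int_stable_def)
      show "emeasure \<mu>1 D = emeasure \<mu>2 D" if "D \<in> range atMost" for D using that eq by auto
      show "sets \<mu>1 = sigma_sets UNIV (range atMost)" "sets \<mu>2 = sigma_sets UNIV (range atMost)"
        by (auto simp: sets1 sets2 borel_eq_atMost)
      show "(\<Union>n. {..real n}) = UNIV" using real_arch_simple by auto
      show "emeasure \<mu>1 {..real n} \<noteq> \<infinity>" for n
        using finite_measure.emeasure_finite[OF fin1] by simp
    qed auto
    then show ?thesis using e1[OF C] e2[OF C] by simp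
  qed
  show ?thesis
  proof (intro exI)
    show "regular_cond_distr M H borel Y \<nu>"
      unfolding regular_cond_distr_def
    proof (intro conjI ballI \<nu>_meas)
      fix C :: "real set" assume C[measurable]: "C \<in> sets borel"
      let ?S = "{\<omega>\<in>space M. Y \<omega> \<in> C}"
      have pr: "prob_space (\<nu> \<omega>)" if "\<omega> \<in> space M" for \<omega>
        using measurable_space[OF \<nu>_meas] that by (simp add: spH space_prob_algebra)
      have mH: "(\<lambda>\<omega>. measure (\<nu> \<omega>) C) \<in> borel_measurable H"
        using measurable_compose[OF \<nu>_meas measurable_measure_prob_algebra[OF C]] .
      have mM: "(\<lambda>\<omega>. measure (\<nu> \<omega>) C) \<in> borel_measurable M"
        using measurable_from_subalg[OF H mH] .
      have "AE \<omega> in M. real_cond_exp M H (indicator ?S) \<omega> = measure (\<nu> \<omega>) C"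
      proof (rule real_cond_exp_charact[OF _ _ _ mH])
        show "integrable M (indicat_real ?S)" by (rule integrable_const_bound[of _ 1]) auto
        show "integrable M (\<lambda>\<omega>. measure (\<nu> \<omega>) C)"
          using pr mM by (intro integrable_const_bound[of _ 1]) (auto intro: prob_space.prob_le_1)
        fix A assume A: "A \<in> sets H"
        then have [measurable]: "A \<in> sets M" using setsH by auto
        have "(\<integral>\<omega>\<in>A. indicat_real ?S \<omega> \<partial>M) = (\<integral>\<omega>. indicator (A \<inter> ?S) \<omega> \<partial>M)"
          by (simp add: set_lebesgue_integral_def indicator_inter_arith)
        also have "\<dots> = enn2real (emeasure M (A \<inter> ?S))" by (simp add: measure_def)
        also have "\<dots> = enn2real (\<integral>\<^sup>+\<omega>. ennreal (indicator A \<omega> * measure (\<nu> \<omega>) C) \<partial>M)"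
          unfolding int_eq[OF A C, symmetric]
          using pr by (intro arg_cong[of _ _ enn2real] nn_integral_cong)
            (auto simp: indicator_def finite_measure.emeasure_eq_measure prob_space.finite_measure)
        also have "\<dots> = (\<integral>\<omega>. indicator A \<omega> * measure (\<nu> \<omega>) C \<partial>M)"
          using mM by (intro integral_eq_nn_integral[symmetric]) auto
        finally show "(\<integral>\<omega>\<in>A. indicat_real ?S \<omega> \<partial>M) = (\<integral>\<omega>\<in>A. measure (\<nu> \<omega>) C \<partial>M)"
          by (simp add: set_lebesgue_integral_def)
      qed
      then show "AE \<omega> in M. measure (\<nu> \<omega>) C = real_cond_exp M H (indicator ?S) \<omega>"
        by eventually_elim simp
    qed
  qed
qed

text \<open>The conditional law of the real variable \<open>h (X \<omega>)\<close> is pushed forward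
  along \<open>g\<close>. Since \<open>g\<close> undoes \<open>h\<close>, \<open>X\<close> lies in
  \<open>C\<close> exactly if \<open>h (X \<omega>)\<close> lies in the preimage of \<open>C\<close>
  under \<open>g\<close>.\<close>

lemma regular_cond_distr_retract:
  fixes h :: "'b \<Rightarrow> real"
  assumes M: "prob_space M" and H: "subalgebra M H" and X: "X \<in> M \<rightarrow>\<^sub>M N"
    and h: "h \<in> borel_measurable N" "\<And>x. 0 \<le> h x \<and> h x \<le> 1"
    and g: "g \<in> borel \<rightarrow>\<^sub>M N" "\<And>x. x \<in> space N \<Longrightarrow> g (h x) = x"
  shows "\<exists>\<kappa>. regular_cond_distr M H N X \<kappa>"
proof -
  have "(\<lambda>\<omega>. h (X \<omega>)) \<in> borel_measurable M" using X h(1) by (rule measurable_compose)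
  then obtain \<nu> where \<nu>: "regular_cond_distr M H borel (\<lambda>\<omega>. h (X \<omega>)) \<nu>"
    using regular_cond_distr_unit_interval[OF M H] h(2) by blast
  then have \<nu>m: "\<nu> \<in> H \<rightarrow>\<^sub>M prob_algebra borel" by (simp add: regular_cond_distr_def)
  have "regular_cond_distr M H N X (\<lambda>\<omega>. distr (\<nu> \<omega>) N g)"
    unfolding regular_cond_distr_def
  proof (intro conjI ballI)
    show "(\<lambda>\<omega>. distr (\<nu> \<omega>) N g) \<in> H \<rightarrow>\<^sub>M prob_algebra N"
      using measurable_compose[OF \<nu>m measurable_distr_prob_space[OF g(1)]] .
    fix C assume C: "C \<in> sets N"
    have gC: "g -` C \<in> sets borel" using measurable_sets[OF g(1) C] by simp
    have "AE \<omega> in M. measure (\<nu> \<omega>) (g -` C) = real_cond_exp M H (indicator {\<omega>\<in>space M. h (X \<omega>) \<in> g -` C}) \<omega>"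
      using \<nu> gC by (auto simp: regular_cond_distr_def)
    moreover have "{\<omega>\<in>space M. h (X \<omega>) \<in> g -` C} = {\<omega>\<in>space M. X \<omega> \<in> C}"
      using g(2) measurable_space[OF X] by auto
    moreover have "measure (distr (\<nu> \<omega>) N g) C = measure (\<nu> \<omega>) (g -` C)" if "\<omega> \<in> space M" for \<omega>
    proof -
      have "sets (\<nu> \<omega>) = sets borel"
        using measurable_space[OF \<nu>m] that H by (simp add: subalgebra_def space_prob_algebra)
      moreover from sets_eq_imp_space_eq[OF this] have "space (\<nu> \<omega>) = UNIV" by simp
      ultimately show ?thesis
        using C g(1) by (subst measure_distr) (auto cong: measurable_cong_sets)
    qed
    ultimately show "AE \<omega> in M. measure (distr (\<nu> \<omega>) N g) C = real_cond_exp M H (indicator {\<omega>\<in>space M. X \<omega> \<in> C}) \<omega>"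
      using AE_space[of M] by (auto elim: AE_mp)
  qed
  then show ?thesis by blast
qed

text \<open>Only the digits 0 and 1 occur in base four, so the tail beyond a position stays below
  \<open>1/4\<close> and no number has two readings. After multiplication by \<open>4 ^ k\<close>
  the earlier digits form an integer, and digit \<open>k\<close> decides whether the fractional part
  reaches \<open>1/4\<close>.\<close>

lemma frac_four_power_digit:
  fixes a :: "nat \<Rightarrow> bool"
  defines "r \<equiv> (\<Sum>m. of_bool (a m) / 4 ^ Suc m :: real)"
  shows "1/4 \<le> frac (4 ^ k * r) \<longleftrightarrow> a k"
proof -
  define t where "t m = (of_bool (a m) / 4 ^ Suc m :: real)" for m
  have t: "0 \<le> t m" "t m \<le> (1/4) ^ Suc m" for m by (auto simp: t_def power_divide)
  have sg: "summable (\<lambda>m. (1/4::real) ^ Suc m)" by (subst summable_Suc_iff) (rule summable_geometric, simp)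
  have st: "summable t" by (rule summable_comparison_test'[OF sg, of 0]) (use t in auto)
  define z where "z = (\<Sum>m<k. 4 ^ k * t m)"
  have zI: "z \<in> \<int>"
    unfolding z_def
  proof (rule Ints_sum)
    fix m assume "m \<in> {..<k}"
    then have "k = (k - Suc m) + Suc m" by simp
    then have "4 ^ k = (4::real) ^ (k - Suc m) * 4 ^ Suc m" by (metis power_add)
    then have "4 ^ k * t m = of_bool (a m) * 4 ^ (k - Suc m)" by (simp add: t_def)
    then show "4 ^ k * t m \<in> \<int>" by (simp add: of_bool_def)
  qed
  define u where "u = 4 ^ k * (\<Sum>m. t (m + Suc k))"
  have stk: "summable (\<lambda>m. t (m + Suc k))" using st by (rule summable_ignore_initial_segment)
  have u0: "0 \<le> u" unfolding u_def by (intro mult_nonneg_nonneg suminf_nonneg stk t) auto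
  \<comment> \<open>In the worst case all later digits are 1, and the shifted tail is
    \<open>1/16 + 1/64 + ... = 1/12\<close>.\<close>
  have "(\<Sum>m. t (m + Suc k)) \<le> (\<Sum>m. (1/4) ^ (k + 2) * (1/4) ^ m)"
    by (intro suminf_le stk summable_mult summable_geometric) (use t(2)[of "m + Suc k" for m] in \<open>auto simp: power_add mult_ac\<close>)
  also have "\<dots> = (1/4) ^ (k + 2) * (4/3)"
    by (subst suminf_mult) (auto simp: suminf_geometric summable_geometric)
  finally have "u \<le> 4 ^ k * ((1/4) ^ (k + 2) * (4/3))" unfolding u_def by (intro mult_left_mono) auto
  also have "\<dots> = 1/12" by (simp add: power_add power_divide)
  finally have u1: "u \<le> 1/12" .
  have "r = (\<Sum>m. t (m + Suc k)) + (\<Sum>m<Suc k. t m)"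
    unfolding r_def t_def[symmetric] by (rule suminf_split_initial_segment[OF st])
  then have "4 ^ k * r = u + (4 ^ k * (\<Sum>m<k. t m) + 4 ^ k * t k)"
    by (simp add: u_def distrib_left)
  moreover have "4 ^ k * (\<Sum>m<k. t m) = z" by (simp add: z_def sum_distrib_left)
  moreover have "4 ^ k * t k = of_bool (a k) / 4" by (simp add: t_def)
  ultimately have e: "4 ^ k * r = z + (of_bool (a k) / 4 + u)" by simp
  have "frac (4 ^ k * r) = of_bool (a k) / 4 + u"
    unfolding frac_unique_iff e using zI u0 u1 by (auto simp: of_bool_def)
  then show ?thesis using u0 u1 by (auto simp: of_bool_def)
qed

section \<open>The Effros space as a measurable retract of the line\<close>

lemma space_effros: "space effros = CL"
  by (auto simp: effros_def hitting_def space_measure_of_conv)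

lemma measurable_effrosI:
  assumes "effros_measurable M X" "\<And>\<omega>. \<omega> \<in> space M \<Longrightarrow> closed (X \<omega>)" "\<And>\<omega>. \<omega> \<in> space M \<Longrightarrow> X \<omega> \<noteq> {}"
  shows "X \<in> M \<rightarrow>\<^sub>M effros"
  unfolding effros_def
proof (rule measurable_measure_of)
  show "{hitting V |V. open V} \<subseteq> Pow CL" by (auto simp: hitting_def)
  show X: "X \<in> space M \<rightarrow> CL" using assms(2,3) by (auto simp: CL_def)
  fix Y assume "Y \<in> {hitting V |V. open (V::'b set)}"
  then obtain V where V: "Y = hitting V" "open V" by blast
  have "X -` Y \<inter> space M = {\<omega>\<in>space M. X \<omega> \<inter> V \<noteq> {}}"
    using X by (auto simp: V hitting_def)
  then show "X -` Y \<inter> space M \<in> sets M" using effros_measurableD[OF assms(1) V(2)] by simp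
qed

text \<open>A Castaing representation \<open>s\<close> of the identity on \<open>effros\<close>
  reduces a closed set to countably many points. The code records for each point, coordinate and
  rational \<open>q\<close> whether the coordinate is below \<open>q\<close>. Decoding takes suprema
  of the rationals not above the coordinate and closes up the resulting points, so it yields a
  nonempty closed set for every real, code or not.\<close>

lemma effros_retract:
  obtains h :: "'a::euclidean_space set \<Rightarrow> real" and g :: "real \<Rightarrow> 'a set"
  where "h \<in> borel_measurable effros" "\<And>D. 0 \<le> h D \<and> h D \<le> 1" "g \<in> borel \<rightarrow>\<^sub>M effros"
    "\<And>D. D \<in> space effros \<Longrightarrow> g (h D) = D"
proof -
  have "effros_measurable effros (\<lambda>D::'a set. D)"
    using hitting_in_effros by (auto simp: effros_measurable_def space_effros hitting_def)
  then have "\<exists>s. (\<forall>n. s n \<in> borel_measurable effros) \<and> (\<forall>D\<in>CL. closure (range (\<lambda>n::nat. s n D)) = (D::'a set))"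
    by (rule castaing_representation) (auto simp: CL_def space_effros)
  then obtain s where s[measurable]: "\<And>n. s n \<in> borel_measurable effros"
    and sD: "\<And>D. D \<in> CL \<Longrightarrow> closure (range (\<lambda>n::nat. s n D)) = (D::'a set)" by blast
  let ?I = "UNIV \<times> Basis \<times> UNIV :: (nat \<times> 'a \<times> rat) set"
  have I: "countable ?I" by (intro countable_SIGMA countable_finite[OF finite_Basis] countableI_type)
  define bit where "bit p D = (s (fst p) D \<bullet> fst (snd p) < of_rat (snd (snd p)))" for p D
  define h where "h D = (\<Sum>m. of_bool (bit (from_nat_into ?I m) D) / 4 ^ Suc m :: real)" for D
  define dec where "dec p r = (1/4 \<le> frac (4 ^ to_nat_on ?I p * r))" for p and r :: real
  \<comment> \<open>A real that is no code may give an infinite supremum, which is why it is taken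
    in the extended reals; \<open>real_of_ereal\<close> then returns 0, so \<open>x\<close> is total
    and measurable.\<close>
  define x where "x n b r = real_of_ereal (SUP q::rat. if dec (n,b,q) r then -\<infinity> else ereal (of_rat q))" for n b r
  define v where "v n r = (\<Sum>b\<in>Basis. x n b r *\<^sub>R b)" for n r
  define g where "g r = closure (range (\<lambda>n. v n r))" for r
  have dec_h: "dec p (h D) \<longleftrightarrow> bit p D" if "p \<in> ?I" for p D
    unfolding dec_def h_def frac_four_power_digit using from_nat_into_to_nat_on[OF I that] by simp
  show ?thesis
  proof (rule that)
    have [measurable]: "Measurable.pred effros (bit p)" for p unfolding bit_def[abs_def] by measurable
    show "h \<in> borel_measurable effros" unfolding h_def[abs_def] by measurable
    show "0 \<le> h D \<and> h D \<le> 1" for D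
    proof -
      have g1: "(\<lambda>m. (1/2::real) ^ Suc m) sums 1" by (rule power_half_series)
      have b: "0 \<le> of_bool c / (4::real) ^ Suc m" "of_bool c / (4::real) ^ Suc m \<le> (1/2) ^ Suc m" for c m
      proof -
        have "of_bool c / (4::real) ^ Suc m \<le> (1/4) ^ Suc m" by (auto simp: power_divide)
        also have "\<dots> \<le> (1/2) ^ Suc m" by (rule power_mono) auto
        finally show "of_bool c / (4::real) ^ Suc m \<le> (1/2) ^ Suc m" .
      qed simp
      have sm: "summable (\<lambda>m. of_bool (bit (from_nat_into ?I m) D) / (4::real) ^ Suc m)"
        by (rule summable_comparison_test'[OF sums_summable[OF g1], of 0]) (use b in auto)
      have "h D \<le> (\<Sum>m. (1/2) ^ Suc m)"
        unfolding h_def by (rule suminf_le[OF b(2) sm sums_summable[OF g1]])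
      then show ?thesis using sums_unique[OF g1] suminf_nonneg[OF sm b(1)] by (simp add: h_def)
    qed
    have [measurable]: "Measurable.pred borel (dec p)" for p unfolding dec_def[abs_def] frac_def by measurable
    have [measurable]: "v n \<in> borel_measurable borel" for n
      unfolding v_def[abs_def] x_def by measurable
    show "g \<in> borel \<rightarrow>\<^sub>M effros"
    proof (rule measurable_effrosI)
      have "effros_measurable borel (\<lambda>r. range (\<lambda>n. v n r))"
        unfolding effros_measurable_def
      proof (intro allI impI)
        fix V :: "'a set" assume "open V"
        then have [measurable]: "V \<in> sets borel" by (rule borel_open)
        have "{r\<in>space borel. range (\<lambda>n. v n r) \<inter> V \<noteq> {}} = {r\<in>space borel. \<exists>n. v n r \<in> V}" by auto
        also have "\<dots> \<in> sets borel" by measurable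
        finally show "{r\<in>space borel. range (\<lambda>n. v n r) \<inter> V \<noteq> {}} \<in> sets borel" .
      qed
      then show "effros_measurable borel g" unfolding g_def[abs_def] by (rule effros_measurable_closure)
    qed (auto simp: g_def)
    fix D :: "'a set" assume D: "D \<in> space effros"
    have "x n b (h D) = s n D \<bullet> b" if b: "b \<in> Basis" for n b
    proof -
      have "(SUP q::rat. if dec (n,b,q) (h D) then -\<infinity> else ereal (of_rat q)) = ereal (s n D \<bullet> b)"
      proof (rule antisym)
        show "(SUP q::rat. if dec (n,b,q) (h D) then -\<infinity> else ereal (of_rat q)) \<le> ereal (s n D \<bullet> b)"
          using b by (intro SUP_least) (simp add: dec_h bit_def)
        show "ereal (s n D \<bullet> b) \<le> (SUP q::rat. if dec (n,b,q) (h D) then -\<infinity> else ereal (of_rat q))"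
        proof (rule dense_le)
          fix y assume "y < ereal (s n D \<bullet> b)"
          then obtain z where "y < ereal z" "z < s n D \<bullet> b" using ereal_dense2 by fastforce
          then obtain q where q: "z < of_rat q" "of_rat q < s n D \<bullet> b" using of_rat_dense by blast
          have "y \<le> (if dec (n,b,q) (h D) then -\<infinity> else ereal (of_rat q))"
            using b q \<open>y < ereal z\<close> by (simp add: dec_h bit_def) (metis ereal_less_eq(3) less_imp_le order_trans)
          then show "y \<le> (SUP q::rat. if dec (n,b,q) (h D) then -\<infinity> else ereal (of_rat q))"
            by (rule SUP_upper2[rotated]) simp
        qed
      qed
      then show ?thesis by (simp add: x_def)
    qed
    then have "v n (h D) = s n D" for n by (simp add: v_def euclidean_representation)
    then show "g (h D) = D" using sD D by (simp add: g_def space_effros)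
  qed
qed

lemma regular_cond_distr_effros_exists:
  fixes X :: "'w \<Rightarrow> 'a::euclidean_space set"
  assumes "prob_space M" "subalgebra M H" "X \<in> M \<rightarrow>\<^sub>M effros"
  shows "\<exists>\<kappa>. regular_cond_distr M H effros X \<kappa>"
proof -
  obtain h :: "'a set \<Rightarrow> real" and g where "h \<in> borel_measurable effros" "\<And>D. 0 \<le> h D \<and> h D \<le> 1" "g \<in> borel \<rightarrow>\<^sub>M effros"
    "\<And>D. D \<in> space effros \<Longrightarrow> g (h D) = D"
    using effros_retract by metis
  then show ?thesis using regular_cond_distr_retract[OF assms] by blast
qed

section \<open>The support of the conditional upper distribution\<close>

text \<open>Integrating over the \<open>H\<close>-event where the conditional probability vanishes
  shows that this event meets \<open>E\<close> in a null set. For hitting events this gives the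
  inclusion of a random set in its support.\<close>

lemma cond_prob_0_imp_AE_notin:
  assumes M: "prob_space M" and H: "subalgebra M H" and E: "E \<in> sets M"
  shows "AE \<omega> in M. real_cond_exp M H (indicator E) \<omega> = 0 \<longrightarrow> \<omega> \<notin> E"
proof -
  interpret prob_space M by fact
  interpret finite_measure_subalgebra M H by unfold_locales (rule H)
  let ?p = "real_cond_exp M H (indicator E)"
  define A where "A = {\<omega>\<in>space H. ?p \<omega> = 0}"
  have AH: "A \<in> sets H" unfolding A_def by measurable
  have AM[measurable]: "A \<in> sets M" using AH H by (auto simp: subalgebra_def)
  note [measurable] = E
  have int: "integrable M (indicat_real E)" by (rule integrable_const_bound[of _ 1]) auto
  have "(\<integral>\<omega>\<in>A. indicat_real E \<omega> \<partial>M) = (\<integral>\<omega>\<in>A. ?p \<omega> \<partial>M)"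
    by (rule real_cond_exp_intA[OF int AH])
  also have "\<dots> = (\<integral>\<omega>. 0 \<partial>M)"
    unfolding set_lebesgue_integral_def by (rule Bochner_Integration.integral_cong) (auto simp: A_def indicator_def)
  finally have "(\<integral>\<omega>\<in>A. indicat_real E \<omega> \<partial>M) = 0" by simp
  moreover have "(\<integral>\<omega>\<in>A. indicat_real E \<omega> \<partial>M) = measure M (A \<inter> E)"
  proof -
    have "(\<integral>\<omega>\<in>A. indicat_real E \<omega> \<partial>M) = (\<integral>\<omega>. indicator (A \<inter> E) \<omega> \<partial>M)"
      by (simp add: set_lebesgue_integral_def indicator_inter_arith)
    then show ?thesis by simp
  qed
  ultimately have "A \<inter> E \<in> null_sets M" by (intro null_setsI) (auto simp: emeasure_eq_measure)
  from AE_not_in[OF this] show ?thesis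
    using AE_space by eventually_elim (use H in \<open>auto simp: A_def subalgebra_def\<close>)
qed

text \<open>The indicator of the \<open>H\<close>-event \<open>A\<close> is pulled out of the
  conditional expectation. With \<open>A\<close> the event that a competing map misses a basic open
  set, this gives minimality of the support.\<close>

lemma AE_notin_imp_cond_prob_0:
  assumes M: "prob_space M" and H: "subalgebra M H" and E: "E \<in> sets M" and A: "A \<in> sets H"
    and AE: "AE \<omega> in M. \<omega> \<in> A \<longrightarrow> \<omega> \<notin> E"
  shows "AE \<omega> in M. \<omega> \<in> A \<longrightarrow> real_cond_exp M H (indicator E) \<omega> = 0"
proof -
  interpret prob_space M by fact
  interpret finite_measure_subalgebra M H by unfold_locales (rule H)
  have [measurable]: "A \<in> sets M" "E \<in> sets M" using A E H by (auto simp: subalgebra_def)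
  have "AE \<omega> in M. real_cond_exp M H (\<lambda>\<omega>. indicator A \<omega> * indicator E \<omega>) \<omega> =
      indicator A \<omega> * real_cond_exp M H (indicator E) \<omega>"
    using A by (intro real_cond_exp_mult) (auto intro: integrable_const_bound[of _ 1] simp: indicator_def)
  moreover have "AE \<omega> in M. real_cond_exp M H (\<lambda>\<omega>. indicator A \<omega> * indicator E \<omega>) \<omega> = real_cond_exp M H (\<lambda>_. 0) \<omega>"
  proof (rule real_cond_exp_cong)
    show "AE \<omega> in M. indicator A \<omega> * indicator E \<omega> = (0::real)"
      using AE by eventually_elim (auto simp: indicator_def)
  qed auto
  moreover have "AE \<omega> in M. real_cond_exp M H (\<lambda>_. 0) \<omega> = 0"
    by (rule real_cond_exp_F_meas) auto
  ultimately show ?thesis by eventually_elim (auto simp: indicator_def)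
qed

lemma hitting_mono: "A \<subseteq> B \<Longrightarrow> hitting A \<subseteq> hitting B"
  by (auto simp: hitting_def)

text \<open>If the support misses \<open>V\<close>, then \<open>V\<close> is covered by open sets
  that are hit with probability 0, countably many by Lindelof, and a set hitting \<open>V\<close>
  hits one of them. So the hits of the support are read off from the kernel, which makes the support
  measurable.\<close>

lemma upper_support_Int_open_iff:
  fixes \<kappa> :: "'w \<Rightarrow> 'a::euclidean_space set measure"
  assumes "prob_space (\<kappa> \<omega>)" "sets (\<kappa> \<omega>) = sets effros" and V: "open V"
  shows "upper_support \<kappa> \<omega> \<inter> V \<noteq> {} \<longleftrightarrow> measure (\<kappa> \<omega>) (hitting V) > 0"
proof
  interpret prob_space "\<kappa> \<omega>" by fact
  assume "upper_support \<kappa> \<omega> \<inter> V \<noteq> {}"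
  then obtain x where x: "x \<in> upper_support \<kappa> \<omega>" "x \<in> V" by blast
  then obtain e where e: "e > 0" "ball x e \<subseteq> V" using V open_contains_ball by blast
  have "measure (\<kappa> \<omega>) (hitting (ball x e)) \<le> measure (\<kappa> \<omega>) (hitting V)"
    by (rule finite_measure_mono[OF hitting_mono[OF e(2)]]) (simp add: assms hitting_in_effros)
  then show "measure (\<kappa> \<omega>) (hitting V) > 0" using x e by (auto simp: upper_support_def intro: less_le_trans)
next
  interpret prob_space "\<kappa> \<omega>" by fact
  assume pos: "measure (\<kappa> \<omega>) (hitting V) > 0"
  show "upper_support \<kappa> \<omega> \<inter> V \<noteq> {}"
  proof
    assume emp: "upper_support \<kappa> \<omega> \<inter> V = {}"
    let ?F = "{B. open B \<and> measure (\<kappa> \<omega>) (hitting B) = 0}"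
    obtain F' where F': "F' \<subseteq> ?F" "countable F'" "\<Union>F' = \<Union>?F"
      by (rule Lindelof[of ?F]) auto
    have "V \<subseteq> \<Union>?F"
    proof
      fix x assume "x \<in> V"
      then have "x \<notin> upper_support \<kappa> \<omega>" using emp by blast
      then obtain e where "e > 0" "\<not> measure (\<kappa> \<omega>) (hitting (ball x e)) > 0"
        by (auto simp: upper_support_def)
      then have "x \<in> ball x e" "ball x e \<in> ?F" using measure_nonneg[of "\<kappa> \<omega>"] by (auto simp: not_less intro: antisym)
      then show "x \<in> \<Union>?F" by blast
    qed
    then have sub: "hitting V \<subseteq> (\<Union>B\<in>F'. hitting B)"
      unfolding F'(3)[symmetric] by (auto simp: hitting_def)
    have "(\<Union>B\<in>F'. hitting B) \<in> null_sets (\<kappa> \<omega>)"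
    proof (rule null_sets_UN'[OF F'(2)])
      fix B assume "B \<in> F'"
      then have "B \<in> ?F" using F'(1) by blast
      then show "hitting B \<in> null_sets (\<kappa> \<omega>)"
        by (intro null_setsI) (auto simp: emeasure_eq_measure assms(2) hitting_in_effros)
    qed
    then have "hitting V \<in> null_sets (\<kappa> \<omega>)"
      by (rule null_sets_subset) (simp_all add: sub assms(2) hitting_in_effros[OF V])
    then show False using pos by (simp add: measure_eq_emeasure_eq_ennreal null_setsD1 measure_def)
  qed
qed

lemma closed_upper_support:
  fixes \<kappa> :: "'w \<Rightarrow> 'a::euclidean_space set measure"
  assumes "prob_space (\<kappa> \<omega>)" "sets (\<kappa> \<omega>) = sets effros"
  shows "closed (upper_support \<kappa> \<omega>)"
  unfolding closed_limpt islimpt_approachable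
proof (intro allI impI)
  fix x assume x: "\<forall>e>0. \<exists>y\<in>upper_support \<kappa> \<omega>. y \<noteq> x \<and> dist y x < e"
  show "x \<in> upper_support \<kappa> \<omega>"
    unfolding upper_support_def
  proof (intro CollectI allI impI)
    fix e :: real assume "e > 0"
    then obtain y where "y \<in> upper_support \<kappa> \<omega>" "dist y x < e" using x by blast
    then have "y \<in> upper_support \<kappa> \<omega> \<inter> ball x e" by (simp add: dist_commute)
    then have "upper_support \<kappa> \<omega> \<inter> ball x e \<noteq> {}" by blast
    then show "measure (\<kappa> \<omega>) (hitting (ball x e)) > 0"
      using upper_support_Int_open_iff[of \<kappa> \<omega>, OF assms open_ball] by blast
  qed
qed

text \<open>For the last two claims a countable base collects the exceptional null sets: a point
  outside a closed set lies in a basic open set missing it. If \<open>K\<close> misses a basic set,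
  the conditional probability of hitting that set is 0; if \<open>G\<close> misses it on an event of
  \<open>H\<close>, that probability is 0 there.\<close>

lemma cond_upper_support_properties:
  fixes X :: "'w \<Rightarrow> 'a::euclidean_space set"
  assumes M: "prob_space M" and H: "subalgebra M H"
    and X: "effros_measurable M X" and cl: "\<forall>\<omega>\<in>space M. closed (X \<omega>)"
    and ne: "AE \<omega> in M. X \<omega> \<noteq> {}"
  defines "K \<equiv> cond_upper_support M H X"
  shows "effros_measurable H K"
    and "\<And>\<omega>. \<omega> \<in> space M \<Longrightarrow> closed (K \<omega>)"
    and "\<And>\<omega>. \<omega> \<in> space M \<Longrightarrow> K \<omega> \<noteq> {}"
    and "AE \<omega> in M. X \<omega> \<subseteq> K \<omega>"
    and "\<And>G. effros_measurable H G \<Longrightarrow> (\<And>\<omega>. \<omega> \<in> space M \<Longrightarrow> closed (G \<omega>)) \<Longrightarrow>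
      AE \<omega> in M. X \<omega> \<subseteq> G \<omega> \<Longrightarrow> AE \<omega> in M. K \<omega> \<subseteq> G \<omega>"
proof -
  interpret prob_space M by fact
  have spH: "space H = space M" using H by (auto simp: subalgebra_def)
  \<comment> \<open>The same replacement of empty values by \<open>{0}\<close> as in
    \<open>cond_upper_support\<close>, so that the kernel chosen there belongs to
    \<open>X'\<close>.\<close>
  define X' where "X' \<omega> = (if X \<omega> = {} then {0} else X \<omega>)" for \<omega>
  have X'X: "AE \<omega> in M. X' \<omega> = X \<omega>" using ne by eventually_elim (simp add: X'_def)
  have mX': "effros_measurable M X'"
    unfolding effros_measurable_def
  proof (intro allI impI)
    fix V :: "'a set" assume V: "open V"
    have "{\<omega>\<in>space M. X' \<omega> \<inter> V \<noteq> {}} = {\<omega>\<in>space M. X \<omega> \<inter> V \<noteq> {}} \<union>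
        (if 0 \<in> V then space M - {\<omega>\<in>space M. X \<omega> \<inter> UNIV \<noteq> {}} else {})"
      by (auto simp: X'_def)
    also have "\<dots> \<in> sets M" using effros_measurableD[OF X V] effros_measurableD[OF X open_UNIV] by auto
    finally show "{\<omega>\<in>space M. X' \<omega> \<inter> V \<noteq> {}} \<in> sets M" .
  qed
  have X'meas: "X' \<in> M \<rightarrow>\<^sub>M effros"
    using mX' cl by (intro measurable_effrosI) (auto simp: X'_def)
  obtain \<kappa> where \<kappa>: "regular_cond_distr M H effros X' \<kappa>" and K: "K = upper_support \<kappa>"
  proof -
    let ?\<kappa> = "SOME \<kappa>. regular_cond_distr M H effros X' \<kappa>"
    have "regular_cond_distr M H effros X' ?\<kappa>"
      using regular_cond_distr_effros_exists[OF M H X'meas] by (rule someI_ex)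
    moreover have "K = upper_support ?\<kappa>"
      unfolding K_def cond_upper_support_def X'_def using ne by simp
    ultimately show ?thesis by (rule that)
  qed
  have \<kappa>m: "\<kappa> \<in> H \<rightarrow>\<^sub>M prob_algebra effros" using \<kappa> by (simp add: regular_cond_distr_def)
  have pr: "prob_space (\<kappa> \<omega>)" "sets (\<kappa> \<omega>) = sets effros" if "\<omega> \<in> space M" for \<omega>
    using measurable_space[OF \<kappa>m] that by (auto simp: spH space_prob_algebra)
  have hit: "upper_support \<kappa> \<omega> \<inter> V \<noteq> {} \<longleftrightarrow> measure (\<kappa> \<omega>) (hitting V) > 0"
    if "\<omega> \<in> space M" "open V" for \<omega> V
    by (rule upper_support_Int_open_iff[of \<kappa> \<omega>, OF pr[OF that(1)] that(2)])
  show mK: "effros_measurable H K"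
    unfolding effros_measurable_def
  proof (intro allI impI)
    fix V :: "'a set" assume V: "open V"
    have [measurable]: "(\<lambda>\<omega>. measure (\<kappa> \<omega>) (hitting V)) \<in> borel_measurable H"
      using measurable_compose[OF \<kappa>m measurable_measure_prob_algebra[OF hitting_in_effros[OF V]]] .
    have "{\<omega>\<in>space H. K \<omega> \<inter> V \<noteq> {}} = {\<omega>\<in>space H. measure (\<kappa> \<omega>) (hitting V) > 0}"
      using hit[OF _ V] unfolding K spH by blast
    also have "\<dots> \<in> sets H" by measurable
    finally show "{\<omega>\<in>space H. K \<omega> \<inter> V \<noteq> {}} \<in> sets H" .
  qed
  show clK: "closed (K \<omega>)" if "\<omega> \<in> space M" for \<omega>
    unfolding K by (rule closed_upper_support[of \<kappa> \<omega>, OF pr[OF that]])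
  show "K \<omega> \<noteq> {}" if w: "\<omega> \<in> space M" for \<omega>
  proof -
    interpret k: prob_space "\<kappa> \<omega>" by (rule pr[OF w])
    have "hitting UNIV = space (\<kappa> \<omega>)"
      using sets_eq_imp_space_eq[OF pr(2)[OF w]] by (auto simp: hitting_def space_effros CL_def)
    then have "measure (\<kappa> \<omega>) (hitting UNIV) > 0" by (simp add: k.prob_space)
    then have "upper_support \<kappa> \<omega> \<inter> UNIV \<noteq> {}" using hit[OF w open_UNIV] by blast
    then show ?thesis by (simp add: K)
  qed
  obtain \<B> :: "'a set set" where \<B>: "countable \<B>" "\<And>B. B \<in> \<B> \<Longrightarrow> open B"
    "\<And>S. open S \<Longrightarrow> \<exists>U. U \<subseteq> \<B> \<and> S = \<Union>U"
    using univ_second_countable by blast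
  have sep: "\<exists>B\<in>\<B>. x \<in> B \<and> B \<inter> S = {}" if S: "closed S" "x \<notin> S" for x and S :: "'a set"
  proof -
    have "open (- S)" using S(1) by (simp add: open_closed)
    from \<B>(3)[OF this] obtain U where U: "U \<subseteq> \<B>" "- S = \<Union>U" by blast
    have "x \<in> \<Union>U" using S(2) U(2) by blast
    then obtain B where "B \<in> U" "x \<in> B" by blast
    then have "B \<in> \<B>" "x \<in> B" "B \<inter> S = {}" using U by auto
    then show ?thesis by blast
  qed
  define E where "E B = {\<omega>\<in>space M. X' \<omega> \<in> hitting B}" for B
  have E_iff: "\<omega> \<in> E B \<longleftrightarrow> X' \<omega> \<inter> B \<noteq> {}" if "\<omega> \<in> space M" for \<omega> B
    using measurable_space[OF X'meas that] that by (auto simp: E_def hitting_def space_effros)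
  have E_sets: "E B \<in> sets M" if "B \<in> \<B>" for B
    using measurable_sets[OF X'meas hitting_in_effros[OF \<B>(2)[OF that]]] by (simp add: E_def vimage_def Int_def conj_commute)
  have cond: "AE \<omega> in M. \<forall>B\<in>\<B>. measure (\<kappa> \<omega>) (hitting B) = real_cond_exp M H (indicator (E B)) \<omega>"
    unfolding AE_ball_countable[OF \<B>(1)]
    using \<kappa> hitting_in_effros[OF \<B>(2)] by (auto simp: regular_cond_distr_def E_def)
  have "AE \<omega> in M. \<forall>B\<in>\<B>. real_cond_exp M H (indicator (E B)) \<omega> = 0 \<longrightarrow> \<omega> \<notin> E B"
    unfolding AE_ball_countable[OF \<B>(1)] using cond_prob_0_imp_AE_notin[OF M H E_sets] by blast
  then show "AE \<omega> in M. X \<omega> \<subseteq> K \<omega>"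
    using cond X'X AE_space
  proof eventually_elim
    case (elim \<omega>)
    show ?case
    proof (rule subsetI, rule ccontr)
      fix x assume x: "x \<in> X \<omega>" "x \<notin> K \<omega>"
      then obtain B where B: "B \<in> \<B>" "x \<in> B" "B \<inter> K \<omega> = {}" using sep[OF clK[OF elim(4)]] by blast
      then have "\<not> measure (\<kappa> \<omega>) (hitting B) > 0"
        using hit[OF elim(4) \<B>(2)[OF B(1)]] unfolding K by blast
      then have "measure (\<kappa> \<omega>) (hitting B) = 0" using measure_nonneg[of "\<kappa> \<omega>" "hitting B"] by linarith
      then have "\<omega> \<notin> E B" using elim(1,2) B(1) by simp
      then show False using x B elim(3) by (auto simp: E_iff[OF elim(4)])
    qed
  qed
  fix G assume G: "effros_measurable H G" "\<And>\<omega>. \<omega> \<in> space M \<Longrightarrow> closed (G \<omega>)" "AE \<omega> in M. X \<omega> \<subseteq> G \<omega>"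
  define A where "A B = space H - {\<omega>\<in>space H. G \<omega> \<inter> B \<noteq> {}}" for B
  have A: "A B \<in> sets H" if "B \<in> \<B>" for B
    unfolding A_def using effros_measurableD[OF G(1) \<B>(2)[OF that]] by auto
  have "AE \<omega> in M. \<forall>B\<in>\<B>. \<omega> \<in> A B \<longrightarrow> real_cond_exp M H (indicator (E B)) \<omega> = 0"
    unfolding AE_ball_countable[OF \<B>(1)]
  proof (rule ballI, rule AE_notin_imp_cond_prob_0[OF M H E_sets A])
    fix B assume "B \<in> \<B>"
    show "AE \<omega> in M. \<omega> \<in> A B \<longrightarrow> \<omega> \<notin> E B"
      using G(3) X'X AE_space by eventually_elim (auto simp: A_def E_iff)
  qed
  then show "AE \<omega> in M. K \<omega> \<subseteq> G \<omega>"
    using cond AE_space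
  proof eventually_elim
    case (elim \<omega>)
    show ?case
    proof (rule subsetI, rule ccontr)
      fix x assume x: "x \<in> K \<omega>" "x \<notin> G \<omega>"
      then obtain B where B: "B \<in> \<B>" "x \<in> B" "B \<inter> G \<omega> = {}" using sep[OF G(2)[OF elim(3)]] by blast
      then have "\<omega> \<in> A B" using elim(3) by (auto simp: A_def spH)
      then have "measure (\<kappa> \<omega>) (hitting B) = 0" using elim(1,2) B(1) by simp
      then have "K \<omega> \<inter> B = {}" using hit[OF elim(3) \<B>(2)[OF B(1)]] unfolding K by auto
      then show False using x B by blast
    qed
  qed
qed

text \<open>Almost sure statements reach only countably many dilations; closedness adds the real
  ones. The hypothesis has \<open>K\<close> on the smaller side because minimality of the support
  yields inclusions of this kind.\<close>

lemma conic_if_rational_multiples: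
  fixes K :: "'a::euclidean_space set"
  assumes "closed K" and K: "\<And>q::rat. 0 < q \<Longrightarrow> K \<subseteq> (\<lambda>x. of_rat q *\<^sub>R x) ` K"
  shows "conic K"
  unfolding conic_def
proof (intro allI impI)
  fix x and c :: real assume x: "x \<in> K" and c: "0 \<le> c"
  have q: "of_rat q *\<^sub>R x \<in> K" if "0 < q" for q :: rat
  proof -
    have "0 < inverse q" using that by simp
    then obtain y where "y \<in> K" "x = of_rat (inverse q) *\<^sub>R y" using K x by blast
    then show ?thesis using that by (simp add: of_rat_inverse)
  qed
  \<comment> \<open>Approximation from above keeps the rationals positive also for
    \<open>c = 0\<close>.\<close>
  have ex: "\<exists>q::rat. c < of_rat q \<and> of_rat q < c + inverse (real (Suc n))" for n
    using of_rat_dense[of c "c + inverse (real (Suc n))"] by fastforce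
  define r where "r n = (SOME q::rat. c < of_rat q \<and> of_rat q < c + inverse (real (Suc n)))" for n :: nat
  have r: "c < of_rat (r n)" "of_rat (r n) < c + inverse (real (Suc n))" for n
    using someI_ex[OF ex, of n] unfolding r_def by auto
  have "(\<lambda>n. real_of_rat (r n)) \<longlonglongrightarrow> c"
  proof (rule tendsto_sandwich[of "\<lambda>_. c" _ _ "\<lambda>n. c + inverse (real (Suc n))"])
    have "(\<lambda>n. c + inverse (real (Suc n))) \<longlonglongrightarrow> c + 0"
      by (intro tendsto_intros LIMSEQ_inverse_real_of_nat)
    then show "(\<lambda>n. c + inverse (real (Suc n))) \<longlonglongrightarrow> c" by simp
  qed (use r in \<open>auto intro!: always_eventually less_imp_le\<close>)
  then have lim: "(\<lambda>n. of_rat (r n) *\<^sub>R x) \<longlonglongrightarrow> c *\<^sub>R x" by (intro tendsto_intros)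
  have "of_rat (r n) *\<^sub>R x \<in> K" for n
  proof (rule q)
    have "0 < real_of_rat (r n)" using r(1)[of n] c by linarith
    then show "0 < r n" by simp
  qed
  then show "c *\<^sub>R x \<in> K" by (rule closed_sequentially[OF \<open>closed K\<close> _ lim])
qed

text \<open>\<open>Y\<close> is defined as a bidual, so it is a closed convex cone at every \<omega>
  and its measurability follows from that of dual cones; only its agreement with the closed convex
  hull is almost sure. Minimality passes from the support to \<open>Y\<close> because a closed
  convex cone equals its bidual.\<close>

lemma cond_cone_hull:
  fixes X :: "'w \<Rightarrow> 'a::euclidean_space set"
  assumes M: "prob_space M" and H: "subalgebra M H"
    and X: "effros_measurable M X" and cl: "\<forall>\<omega>\<in>space M. closed (X \<omega>)"
    and cone: "AE \<omega> in M. convex_cone (X \<omega>)"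
  obtains Y where "effros_measurable H Y" "\<And>\<omega>. closed (Y \<omega>)" "\<And>\<omega>. convex_cone (Y \<omega>)"
    "AE \<omega> in M. closure (convex hull (cond_upper_support M H X \<omega>)) = Y \<omega>"
    "AE \<omega> in M. X \<omega> \<subseteq> Y \<omega>"
    "\<And>G. effros_measurable H G \<Longrightarrow> (\<And>\<omega>. closed (G \<omega>)) \<Longrightarrow>
      (\<And>\<omega>. convex_cone (G \<omega>)) \<Longrightarrow> AE \<omega> in M. X \<omega> \<subseteq> G \<omega> \<Longrightarrow> AE \<omega> in M. Y \<omega> \<subseteq> G \<omega>"
proof -
  have spH: "space H = space M" using H by (auto simp: subalgebra_def)
  have ne: "AE \<omega> in M. X \<omega> \<noteq> {}" using cone by eventually_elim (rule convex_cone_nonempty)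
  define K where "K = cond_upper_support M H X"
  note K = cond_upper_support_properties[OF M H X cl ne, folded K_def]
  define Y where "Y \<omega> = dual_cone (dual_cone (K \<omega>))" for \<omega>
  \<comment> \<open>Since \<open>X\<close> is a cone, minimality of the support compares \<open>K\<close> with its rational dilations,
    so \<open>K\<close> is conic almost surely.\<close>
  have "AE \<omega> in M. \<forall>q\<in>{q::rat. 0 < q}. K \<omega> \<subseteq> (\<lambda>x. of_rat q *\<^sub>R x) ` K \<omega>"
  proof (subst AE_ball_countable, simp, rule ballI)
    fix q :: rat assume "q \<in> {q. 0 < q}"
    then have q: "0 < real_of_rat q" by simp
    show "AE \<omega> in M. K \<omega> \<subseteq> (\<lambda>x. of_rat q *\<^sub>R x) ` K \<omega>"
    proof (rule K(5))
      show "effros_measurable H (\<lambda>\<omega>. (\<lambda>x. of_rat q *\<^sub>R x) ` K \<omega>)"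
        unfolding effros_measurable_def
      proof (intro allI impI)
        fix V :: "'a set" assume "open V"
        then have "open ((\<lambda>x. of_rat q *\<^sub>R x) -` V)"
          by (intro open_vimage continuous_intros)
        from effros_measurableD[OF K(1) this]
        show "{\<omega>\<in>space H. (\<lambda>x. of_rat q *\<^sub>R x) ` K \<omega> \<inter> V \<noteq> {}} \<in> sets H"
          by (rule back_subst[of "\<lambda>S. S \<in> sets H"]) auto
      qed
      show "closed ((\<lambda>x. of_rat q *\<^sub>R x) ` K \<omega>)" if "\<omega> \<in> space M" for \<omega>
        by (rule closed_scaling[OF K(2)[OF that]])
      show "AE \<omega> in M. X \<omega> \<subseteq> (\<lambda>x. of_rat q *\<^sub>R x) ` K \<omega>"
        using K(4) cone
      proof eventually_elim
        case (elim \<omega>)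
        show ?case
        proof
          fix x assume "x \<in> X \<omega>"
          then have "(1 / of_rat q) *\<^sub>R x \<in> X \<omega>" using elim(2) q by (intro convex_cone_scaleR) auto
          then have "(1 / of_rat q) *\<^sub>R x \<in> K \<omega>" using elim(1) by blast
          then show "x \<in> (\<lambda>x. of_rat q *\<^sub>R x) ` K \<omega>" using q by (intro image_eqI) auto
        qed
      qed
    qed
  qed
  then have "AE \<omega> in M. closure (convex hull (K \<omega>)) = Y \<omega>"
    using AE_space
  proof eventually_elim
    case (elim \<omega>)
    have "conic (K \<omega>)" using elim by (intro conic_if_rational_multiples K(2)) auto
    then have "conic (convex hull K \<omega>)" 
      by (metis Convex.cone_def cone_convex_hull conic_def)
    then have "convex_cone hull (K \<omega>) = convex hull (K \<omega>)"
      unfolding convex_cone_hull_separate_nonempty[OF K(3)[OF elim(2)]] by (rule hull_same)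
    then show ?case by (simp add: Y_def dual_cone_dual_cone_eq_closure)
  qed
  moreover have "effros_measurable H Y"
    unfolding Y_def[abs_def] using K(1,3) spH convex_cone_nonempty[OF convex_cone_dual_cone]
    by (intro effros_measurable_dual_cone) auto
  moreover have "AE \<omega> in M. X \<omega> \<subseteq> Y \<omega>"
    using K(4) by eventually_elim (use subset_dual_cone_dual_cone in \<open>auto simp: Y_def\<close>)
  moreover have "AE \<omega> in M. Y \<omega> \<subseteq> G \<omega>"
    if G: "effros_measurable H G" "\<And>\<omega>. closed (G \<omega>)"
      "\<And>\<omega>. convex_cone (G \<omega>)" "AE \<omega> in M. X \<omega> \<subseteq> G \<omega>" for G
  proof -
    have "AE \<omega> in M. K \<omega> \<subseteq> G \<omega>" by (rule K(5)[OF G(1) _ G(4)]) (rule G(2))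
    then show ?thesis
    proof eventually_elim
      case (elim \<omega>)
      then have "Y \<omega> \<subseteq> dual_cone (dual_cone (G \<omega>))" unfolding Y_def by (intro dual_cone_antimono)
      then show ?case by (simp add: dual_cone_dual_cone[OF G(3,2)])
    qed
  qed
  ultimately show ?thesis
    using that[of Y] closed_dual_cone convex_cone_dual_cone unfolding K_def Y_def by blast
qed

text \<open>Here completeness enters: \<open>A\<close> and \<open>B\<close> differ only within a
  null set, all of whose subsets belong to \<open>H\<close>.\<close>

lemma sets_complete_AE_cong:
  assumes "complete_measure M" "subalgebra M H" "null_sets M \<subseteq> sets H"
    and B: "B \<in> sets H" and A: "A \<subseteq> space M" and AE: "AE \<omega> in M. \<omega> \<in> A \<longleftrightarrow> \<omega> \<in> B"
  shows "A \<in> sets H"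
proof -
  interpret complete_measure M by fact
  obtain N where N: "{\<omega>\<in>space M. \<not> (\<omega> \<in> A \<longleftrightarrow> \<omega> \<in> B)} \<subseteq> N" "N \<in> null_sets M"
    using AE by (auto simp: eventually_ae_filter)
  have BM: "B \<subseteq> space M" using sets.sets_into_space[OF B] assms(2) by (simp add: subalgebra_def)
  have n: "S \<in> sets H" if "S \<subseteq> N" for S
    using complete2[OF that N(2)] assms(3) by blast
  have "A = (B - (B - A)) \<union> (A - B)" by auto
  moreover have "B - A \<subseteq> N" "A - B \<subseteq> N" using N(1) A BM by auto
  ultimately show ?thesis using n B by (metis sets.Un sets.Diff)
qed

lemma effros_measurable_complete_AE_cong:
  assumes "complete_measure M" "subalgebra M H" "null_sets M \<subseteq> sets H"
    and S': "effros_measurable H S'" and AE: "AE \<omega> in M. S \<omega> = S' \<omega>"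
  shows "effros_measurable H S"
  unfolding effros_measurable_def
proof (intro allI impI)
  fix V :: "'b set" assume V: "open V"
  have spH: "space H = space M" using assms(2) by (simp add: subalgebra_def)
  show "{\<omega>\<in>space H. S \<omega> \<inter> V \<noteq> {}} \<in> sets H"
    using AE by (intro sets_complete_AE_cong[OF assms(1-3) effros_measurableD[OF S' V]]) (auto simp: spH)
qed

lemma borel_measurable_complete_AE_cong:
  assumes "complete_measure M" "subalgebra M H" "null_sets M \<subseteq> sets H"
    and g: "g \<in> H \<rightarrow>\<^sub>M N" and AE: "AE \<omega> in M. f \<omega> = g \<omega>" and f: "f \<in> space M \<rightarrow> space N"
  shows "f \<in> H \<rightarrow>\<^sub>M N"
proof (rule measurableI)
  have spH: "space H = space M" using assms(2) by (simp add: subalgebra_def)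
  show "f \<omega> \<in> space N" if "\<omega> \<in> space H" for \<omega> using f that by (auto simp: spH)
  fix A assume A: "A \<in> sets N"
  show "f -` A \<inter> space H \<in> sets H"
    using AE by (intro sets_complete_AE_cong[OF assms(1-3) measurable_sets[OF g A]]) (auto simp: spH)
qed

lemma effros_measurable_subalgebra:
  assumes "subalgebra M H" "effros_measurable H S" shows "effros_measurable M S"
  using assms by (auto simp: effros_measurable_def subalgebra_def)

section \<open>One step of the martingale selection problem\<close>

text \<open>Dividing by \<open>1 + norm\<close> keeps a selection in the cone and bounds it, so that
  conditional expectations are available. The family need no longer be dense, but its dual cone is
  unchanged, and this is the form of generation that the later arguments need.\<close>

lemma castaing_cone:
  fixes S :: "'w \<Rightarrow> 'a::euclidean_space set"
  assumes S: "effros_measurable H S" and cl: "\<And>\<omega>. closed (S \<omega>)" and cone: "\<And>\<omega>. convex_cone (S \<omega>)"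
  obtains f :: "nat \<Rightarrow> 'w \<Rightarrow> 'a" where "\<And>n. f n \<in> borel_measurable H" "\<And>n \<omega>. norm (f n \<omega>) \<le> 1"
    "\<And>n \<omega>. \<omega> \<in> space H \<Longrightarrow> f n \<omega> \<in> S \<omega>"
    "\<And>\<omega>. \<omega> \<in> space H \<Longrightarrow> dual_cone (range (\<lambda>n. f n \<omega>)) = dual_cone (S \<omega>)"
proof -
  have ne: "S \<omega> \<noteq> {}" for \<omega> using cone convex_cone_nonempty by blast
  have "\<exists>g. (\<forall>n. g n \<in> borel_measurable H) \<and>
      (\<forall>\<omega>\<in>space H. closure (range (\<lambda>n::nat. g n \<omega>)) = S \<omega>)"
    by (rule castaing_representation[OF S]) (simp_all add: cl ne, blast)
  then obtain g where g[measurable]: "\<And>n. g n \<in> borel_measurable H"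
      and gS: "\<And>\<omega>. \<omega> \<in> space H \<Longrightarrow> closure (range (\<lambda>n::nat. g n \<omega>)) = S \<omega>"
    by blast
  define f where "f n \<omega> = (1 / (1 + norm (g n \<omega>))) *\<^sub>R g n \<omega>" for n \<omega>
  have pos: "0 < 1 / (1 + norm (g n \<omega>))" for n \<omega> by (simp add: add_pos_nonneg)
  show ?thesis
  proof (rule that[of f])
    show "f n \<in> borel_measurable H" for n unfolding f_def[abs_def] by measurable
    show "norm (f n \<omega>) \<le> 1" for n \<omega> by (simp add: f_def divide_le_eq add_pos_nonneg)
    fix \<omega> assume w: "\<omega> \<in> space H"
    have "g n \<omega> \<in> S \<omega>" for n
      using closure_subset[of "range (\<lambda>n. g n \<omega>)"] unfolding gS[OF w] by blast
    then show "f n \<omega> \<in> S \<omega>" for n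
      unfolding f_def using pos by (intro convex_cone_scaleR[OF cone] less_imp_le)
    have "dual_cone (range (\<lambda>n. f n \<omega>)) = dual_cone (range (\<lambda>n. g n \<omega>))"
    proof -
      have "0 \<le> f n \<omega> \<bullet> y \<longleftrightarrow> 0 \<le> g n \<omega> \<bullet> y" for n y
        using pos[of n \<omega>] unfolding f_def inner_scaleR_left by (metis zero_le_mult_iff less_le_not_le)
      then show ?thesis by (simp add: dual_cone_def)
    qed
    also have "\<dots> = dual_cone (S \<omega>)"
      unfolding gS[OF w, symmetric] by (rule dual_cone_closure[symmetric])
    finally show "dual_cone (range (\<lambda>n. f n \<omega>)) = dual_cone (S \<omega>)" .
  qed
qed

text \<open>A series of a generating sequence with strictly positive weights is relatively interior:
  a dual functional that vanishes at the sum vanishes at every term, hence on the whole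
  cone.\<close>

lemma measurable_selection_rel_interior:
  fixes S :: "'w \<Rightarrow> 'a::euclidean_space set"
  assumes S: "effros_measurable H S" and cl: "\<And>\<omega>. closed (S \<omega>)" and cone: "\<And>\<omega>. convex_cone (S \<omega>)"
  obtains g where "g \<in> borel_measurable H" "\<And>\<omega>. norm (g \<omega>) \<le> 1"
    "\<And>\<omega>. \<omega> \<in> space H \<Longrightarrow> g \<omega> \<in> rel_interior (S \<omega>)"
proof -
  obtain f :: "nat \<Rightarrow> 'w \<Rightarrow> 'a" where f[measurable]: "\<And>n. f n \<in> borel_measurable H" and f1: "\<And>n \<omega>. norm (f n \<omega>) \<le> 1"
    and fS: "\<And>n \<omega>. \<omega> \<in> space H \<Longrightarrow> f n \<omega> \<in> S \<omega>"
    and fd: "\<And>\<omega>. \<omega> \<in> space H \<Longrightarrow> dual_cone (range (\<lambda>n. f n \<omega>)) = dual_cone (S \<omega>)"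
    using castaing_cone[OF S cl cone] by blast
  have half: "(\<lambda>n. (1/2::real) ^ Suc n) sums 1" by (rule power_half_series)
  define t where "t \<omega> n = (1/2) ^ Suc n *\<^sub>R f n \<omega>" for \<omega> n
  have nt: "norm (t \<omega> n) \<le> (1/2) ^ Suc n" for \<omega> n
    using f1[of n \<omega>] by (simp add: t_def mult_left_le)
  have smn: "summable (\<lambda>n. norm (t \<omega> n))" for \<omega>
    by (rule summable_comparison_test'[OF sums_summable[OF half], of 0]) (use nt in auto)
  have sm: "summable (t \<omega>)" for \<omega> using smn by (rule summable_norm_cancel)
  define g where "g \<omega> = suminf (t \<omega>)" for \<omega>
  show ?thesis
  proof (rule that)
    show "g \<in> borel_measurable H" unfolding g_def[abs_def] t_def by measurable
    show "norm (g \<omega>) \<le> 1" for \<omega>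
    proof -
      have "norm (g \<omega>) \<le> (\<Sum>n. norm (t \<omega> n))" unfolding g_def by (rule summable_norm[OF smn])
      also have "\<dots> \<le> (\<Sum>n. (1/2) ^ Suc n)" by (rule suminf_le[OF nt smn sums_summable[OF half]])
      also have "\<dots> = 1" by (rule sums_unique[OF half, symmetric])
      finally show ?thesis .
    qed
    fix \<omega> assume w: "\<omega> \<in> space H"
    show "g \<omega> \<in> rel_interior (S \<omega>)"
      unfolding rel_interior_convex_cone_iff[OF cone]
    proof (intro conjI ballI impI)
      have "t \<omega> n \<in> S \<omega>" for n unfolding t_def by (intro convex_cone_scaleR[OF cone] fS[OF w]) simp
      then have p: "(\<Sum>i<n. t \<omega> i) \<in> S \<omega>" for n
        by (induction n) (auto intro: convex_cone_contains_0[OF cone] convex_cone_add[OF cone])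
      show "g \<omega> \<in> S \<omega>"
        unfolding g_def by (rule closed_sequentially[OF cl p summable_LIMSEQ[OF sm]])
      fix \<eta> y assume \<eta>: "\<eta> \<in> dual_cone (S \<omega>)" "\<eta> \<bullet> g \<omega> = 0" and y: "y \<in> S \<omega>"
      have "(\<lambda>n. \<eta> \<bullet> t \<omega> n) sums (\<eta> \<bullet> g \<omega>)"
        unfolding g_def by (rule bounded_linear.sums[OF bounded_linear_inner_right summable_sums[OF sm]])
      then have s0: "(\<lambda>n. \<eta> \<bullet> t \<omega> n) sums 0" by (simp add: \<eta>(2))
      have nn: "0 \<le> \<eta> \<bullet> t \<omega> n" for n
        using dual_coneD[OF \<eta>(1) fS[OF w, of n]] by (simp add: t_def inner_commute)
      have "\<eta> \<bullet> t \<omega> n = 0" for n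
        using suminf_eq_zero_iff[OF sums_summable[OF s0] nn] sums_unique[OF s0] by simp
      then have "f n \<omega> \<bullet> \<eta> = 0" for n by (simp add: t_def inner_commute)
      then have "- \<eta> \<in> dual_cone (range (\<lambda>n. f n \<omega>))" by (auto simp: dual_cone_def)
      then have "- \<eta> \<in> dual_cone (S \<omega>)" by (simp add: fd[OF w])
      from dual_coneD[OF this y] dual_coneD[OF \<eta>(1) y] show "\<eta> \<bullet> y = 0" by (simp add: inner_commute)
    qed
  qed
qed

section \<open>Conditional expectations of random vectors\<close>

definition cond_exp_vec :: "'w measure \<Rightarrow> 'w measure \<Rightarrow> ('w \<Rightarrow> real ^ 'd) \<Rightarrow> 'w \<Rightarrow> real ^ 'd" where
  "cond_exp_vec M H f \<omega> = (\<chi> i. real_cond_exp M H (\<lambda>\<omega>. f \<omega> $ i) \<omega>)"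

lemma borel_measurable_vec_lambda:
  assumes "\<And>i. f i \<in> borel_measurable M"
  shows "(\<lambda>\<omega>. (\<chi> i. f i \<omega>) :: real ^ 'd) \<in> borel_measurable M"
proof -
  have "(\<lambda>\<omega>. (\<Sum>i\<in>UNIV. f i \<omega> *\<^sub>R axis i 1) :: real ^ 'd) \<in> borel_measurable M"
    using assms by measurable
  moreover have "(\<chi> i. f i \<omega>) = (\<Sum>i\<in>UNIV. f i \<omega> *\<^sub>R axis i 1)" for \<omega>
    by (simp add: vec_eq_iff axis_def if_distrib cong: if_cong)
  ultimately show ?thesis by simp
qed

lemma borel_measurable_cond_exp_vec[measurable]: "cond_exp_vec M H f \<in> borel_measurable H"
  unfolding cond_exp_vec_def[abs_def] by (intro borel_measurable_vec_lambda borel_measurable_cond_exp)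

lemma borel_measurable_vec_nth'[measurable (raw)]:
  fixes f :: "'w \<Rightarrow> real ^ 'd"
  assumes "f \<in> borel_measurable M" shows "(\<lambda>\<omega>. f \<omega> $ i) \<in> borel_measurable M"
  using borel_measurable_inner[OF assms borel_measurable_const[of "axis i 1"]]
  by (simp add: inner_axis)

lemma cond_exp_vec_inner:
  fixes f :: "'w \<Rightarrow> real ^ 'd"
  assumes M: "prob_space M" and H: "subalgebra M H"
    and f: "f \<in> borel_measurable M" "\<And>\<omega>. norm (f \<omega>) \<le> 1"
    and e: "e \<in> borel_measurable H" "\<And>\<omega>. norm (e \<omega>) \<le> 1"
  shows "AE \<omega> in M. real_cond_exp M H (\<lambda>\<omega>. e \<omega> \<bullet> f \<omega>) \<omega> = e \<omega> \<bullet> cond_exp_vec M H f \<omega>"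
proof -
  interpret prob_space M by fact
  interpret finite_measure_subalgebra M H by unfold_locales (rule H)
  have [measurable]: "f \<in> borel_measurable M" "e \<in> borel_measurable M" "e \<in> borel_measurable H"
    using f e measurable_from_subalg[OF H] by auto
  have bd: "\<bar>f \<omega> $ i\<bar> \<le> 1" "\<bar>e \<omega> $ i\<bar> \<le> 1" for \<omega> i
    using component_le_norm_cart f(2) e(2) order_trans by blast+
  have int: "integrable M (\<lambda>\<omega>. e \<omega> $ i * f \<omega> $ i)" for i
  proof (rule integrable_const_bound)
    show "AE \<omega> in M. norm (e \<omega> $ i * f \<omega> $ i) \<le> 1"
      by (intro AE_I2) (simp add: abs_mult mult_le_one bd)
  qed measurable
  have "AE \<omega> in M. \<forall>i. real_cond_exp M H (\<lambda>\<omega>. e \<omega> $ i * f \<omega> $ i) \<omega> = e \<omega> $ i * real_cond_exp M H (\<lambda>\<omega>. f \<omega> $ i) \<omega>"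
    unfolding AE_all_countable by (intro allI real_cond_exp_mult int) measurable
  moreover have "AE \<omega> in M. real_cond_exp M H (\<lambda>\<omega>. \<Sum>i\<in>UNIV. e \<omega> $ i * f \<omega> $ i) \<omega> =
      (\<Sum>i\<in>UNIV. real_cond_exp M H (\<lambda>\<omega>. e \<omega> $ i * f \<omega> $ i) \<omega>)"
    by (rule real_cond_exp_sum[OF int])
  ultimately show ?thesis
    by eventually_elim (simp add: inner_vec_def cond_exp_vec_def)
qed

text \<open>By bipolarity \<open>Y\<close> is cut out by countably many half-spaces with bounded
  \<open>H\<close>-measurable normals \<open>e n\<close>, and conditional expectation preserves each
  of these inequalities.\<close>

lemma cond_exp_vec_in_cone:
  fixes f :: "'w \<Rightarrow> real ^ 'd"
  assumes M: "prob_space M" and H: "subalgebra M H"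
    and f: "f \<in> borel_measurable M" "\<And>\<omega>. norm (f \<omega>) \<le> 1"
    and Y: "effros_measurable H Y" "\<And>\<omega>. closed (Y \<omega>)" "\<And>\<omega>. convex_cone (Y \<omega>)"
    and fY: "AE \<omega> in M. f \<omega> \<in> Y \<omega>"
  shows "AE \<omega> in M. cond_exp_vec M H f \<omega> \<in> Y \<omega>"
proof -
  interpret prob_space M by fact
  interpret finite_measure_subalgebra M H by unfold_locales (rule H)
  have "effros_measurable H (\<lambda>\<omega>. dual_cone (Y \<omega>))"
    using Y(1) convex_cone_nonempty[OF Y(3)] by (intro effros_measurable_dual_cone) auto
  then obtain e :: "nat \<Rightarrow> 'w \<Rightarrow> real ^ 'd" where e: "\<And>n. e n \<in> borel_measurable H" "\<And>n \<omega>. norm (e n \<omega>) \<le> 1"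
    "\<And>n \<omega>. \<omega> \<in> space H \<Longrightarrow> e n \<omega> \<in> dual_cone (Y \<omega>)"
    "\<And>\<omega>. \<omega> \<in> space H \<Longrightarrow> dual_cone (range (\<lambda>n. e n \<omega>)) = dual_cone (dual_cone (Y \<omega>))"
    using castaing_cone[OF _ closed_dual_cone convex_cone_dual_cone] by blast
  have eM: "e n \<in> borel_measurable M" for n by (rule measurable_from_subalg[OF H e(1)])
  have spH: "space H = space M" using H by (simp add: subalgebra_def)
  have "AE \<omega> in M. \<forall>n. 0 \<le> e n \<omega> \<bullet> cond_exp_vec M H f \<omega>"
    unfolding AE_all_countable
  proof
    fix n
    have "AE \<omega> in M. 0 \<le> real_cond_exp M H (\<lambda>\<omega>. e n \<omega> \<bullet> f \<omega>) \<omega>"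
    proof (rule real_cond_exp_pos)
      show "AE \<omega> in M. 0 \<le> e n \<omega> \<bullet> f \<omega>"
        using fY AE_space by eventually_elim (use e(3) dual_coneD in \<open>fastforce simp: spH inner_commute\<close>)
      show "(\<lambda>\<omega>. e n \<omega> \<bullet> f \<omega>) \<in> borel_measurable M" using eM f(1) by simp
    qed
    then show "AE \<omega> in M. 0 \<le> e n \<omega> \<bullet> cond_exp_vec M H f \<omega>"
      using cond_exp_vec_inner[OF M H f e(1,2), of n] by eventually_elim simp
  qed
  then show ?thesis
    using AE_space
  proof eventually_elim
    case (elim \<omega>)
    then have "cond_exp_vec M H f \<omega> \<in> dual_cone (range (\<lambda>n. e n \<omega>))" by (auto simp: dual_cone_def)
    then show ?case using e(4)[of \<omega>] elim(2) dual_cone_dual_cone[OF Y(3,2)] by (simp add: spH)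
  qed
qed

text \<open>On each of the countably many events \<open>I = k\<close>, which lie in
  \<open>H\<close>, both sides agree with the conditional expectation of \<open>h k\<close>. An
  index chosen with the information of \<open>H\<close> can thus be treated as fixed.\<close>

lemma real_cond_exp_countable_choice:
  fixes h :: "nat \<Rightarrow> 'w \<Rightarrow> real"
  assumes M: "prob_space M" and H: "subalgebra M H"
    and h: "\<And>k. h k \<in> borel_measurable M" "\<And>k \<omega>. \<bar>h k \<omega>\<bar> \<le> 1"
    and I: "I \<in> H \<rightarrow>\<^sub>M count_space UNIV"
  shows "AE \<omega> in M. real_cond_exp M H (\<lambda>\<omega>. h (I \<omega>) \<omega>) \<omega> = real_cond_exp M H (h (I \<omega>)) \<omega>"
proof -
  interpret prob_space M by fact
  interpret finite_measure_subalgebra M H by unfold_locales (rule H)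
  have IM: "I \<in> M \<rightarrow>\<^sub>M count_space UNIV" by (rule measurable_from_subalg[OF H I])
  note [measurable] = h(1)
  have hI[measurable]: "(\<lambda>\<omega>. h (I \<omega>) \<omega>) \<in> borel_measurable M"
    using IM by (rule measurable_compose_countable[rotated]) (rule h)
  define d where "d k \<omega> = indicat_real {\<omega>. I \<omega> = k} \<omega>" for k \<omega>
  have dH[measurable]: "d k \<in> borel_measurable H" for k
    using I unfolding d_def[abs_def] indicator_def by measurable
  have dM[measurable]: "d k \<in> borel_measurable M" for k by (rule measurable_from_subalg[OF H dH])
  have "AE \<omega> in M. \<forall>k. d k \<omega> * real_cond_exp M H (\<lambda>\<omega>. h (I \<omega>) \<omega>) \<omega> = d k \<omega> * real_cond_exp M H (h k) \<omega>"
    unfolding AE_all_countable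
  proof
    fix k
    have int: "integrable M (\<lambda>\<omega>. d k \<omega> * u \<omega>)" if [measurable]: "u \<in> borel_measurable M" and "\<And>\<omega>. \<bar>u \<omega>\<bar> \<le> 1" for u
    proof (rule integrable_const_bound)
      show "AE \<omega> in M. norm (d k \<omega> * u \<omega>) \<le> 1"
        using that(2) by (intro AE_I2) (simp add: d_def indicator_def)
    qed measurable
    have e1: "AE \<omega> in M. real_cond_exp M H (\<lambda>\<omega>. d k \<omega> * h (I \<omega>) \<omega>) \<omega> = d k \<omega> * real_cond_exp M H (\<lambda>\<omega>. h (I \<omega>) \<omega>) \<omega>"
      by (intro real_cond_exp_mult dH hI) (rule int, rule hI, rule h)
    have e2: "AE \<omega> in M. real_cond_exp M H (\<lambda>\<omega>. d k \<omega> * h k \<omega>) \<omega> = d k \<omega> * real_cond_exp M H (h k) \<omega>"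
      by (intro real_cond_exp_mult dH h(1)) (rule int, rule h, rule h)
    have e3: "(\<lambda>\<omega>. d k \<omega> * h (I \<omega>) \<omega>) = (\<lambda>\<omega>. d k \<omega> * h k \<omega>)"
      by (auto simp: d_def indicator_def)
    show "AE \<omega> in M. d k \<omega> * real_cond_exp M H (\<lambda>\<omega>. h (I \<omega>) \<omega>) \<omega> = d k \<omega> * real_cond_exp M H (h k) \<omega>"
      using e1 e2 unfolding e3 by eventually_elim auto
  qed
  then show ?thesis
  proof eventually_elim
    case (elim \<omega>)
    from elim[rule_format, of "I \<omega>"] show ?case by (simp add: d_def)
  qed
qed

text \<open>For nonnegative functions the factor \<open>f\<close> moves through the conditional
  expectation without prior integrability, so both products have the same integral and finiteness
  carries over. This admits unbounded coefficients \<open>f\<close>.\<close>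

lemma integrable_mult_if_cond_exp:
  fixes f g :: "'w \<Rightarrow> real"
  assumes M: "prob_space M" and H: "subalgebra M H"
    and f: "f \<in> borel_measurable H" "\<And>\<omega>. 0 \<le> f \<omega>"
    and g: "integrable M g" "AE \<omega> in M. 0 \<le> g \<omega>"
    and int: "integrable M (\<lambda>\<omega>. f \<omega> * real_cond_exp M H g \<omega>)"
  shows "integrable M (\<lambda>\<omega>. f \<omega> * g \<omega>)"
proof -
  interpret prob_space M by fact
  interpret finite_measure_subalgebra M H by unfold_locales (rule H)
  have [measurable]: "g \<in> borel_measurable M" using g(1) by simp
  have [measurable]: "f \<in> borel_measurable M" by (rule measurable_from_subalg[OF H f(1)])
  let ?p = "real_cond_exp M H g"
  have p0: "AE \<omega> in M. 0 \<le> ?p \<omega>" by (rule real_cond_exp_pos[OF g(2)]) simp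
  have p: "AE \<omega> in M. ennreal (?p \<omega>) = nn_cond_exp M H (\<lambda>\<omega>. ennreal (g \<omega>)) \<omega>"
  proof (rule nn_cond_exp_charact)
    fix A assume A: "A \<in> sets H"
    then have [measurable]: "A \<in> sets M" using H by (auto simp: subalgebra_def)
    have iA: "(\<integral>\<^sup>+\<omega>. ennreal (indicator A \<omega> * u \<omega>) \<partial>M) = ennreal (\<integral>\<omega>. indicator A \<omega> * u \<omega> \<partial>M)"
      if "integrable M u" "AE \<omega> in M. 0 \<le> u \<omega>" for u
    proof (rule nn_integral_eq_integral)
      show "integrable M (\<lambda>\<omega>. indicator A \<omega> * u \<omega>)"
        using integrable_mult_indicator[of A M u] that(1) by simp
      show "AE \<omega> in M. 0 \<le> indicator A \<omega> * u \<omega>" using that(2) by eventually_elim simp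
    qed
    have "(\<integral>\<^sup>+\<omega>\<in>A. ennreal (g \<omega>) \<partial>M) = (\<integral>\<^sup>+\<omega>. ennreal (indicator A \<omega> * g \<omega>) \<partial>M)"
      by (intro nn_integral_cong) (auto simp: indicator_def)
    also have "\<dots> = ennreal (\<integral>\<omega>\<in>A. g \<omega> \<partial>M)"
      unfolding set_lebesgue_integral_def real_scaleR_def
      by (rule iA[OF g])
    also have "(\<integral>\<omega>\<in>A. g \<omega> \<partial>M) = (\<integral>\<omega>\<in>A. ?p \<omega> \<partial>M)" by (rule real_cond_exp_intA[OF g(1) A])
    also have "ennreal \<dots> = (\<integral>\<^sup>+\<omega>. ennreal (indicator A \<omega> * ?p \<omega>) \<partial>M)"
      unfolding set_lebesgue_integral_def real_scaleR_def
      by (rule iA[OF real_cond_exp_int(1)[OF g(1)] p0, symmetric])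
    also have "\<dots> = (\<integral>\<^sup>+\<omega>\<in>A. ennreal (?p \<omega>) \<partial>M)"
      by (intro nn_integral_cong) (auto simp: indicator_def)
    finally show "(\<integral>\<^sup>+\<omega>\<in>A. ennreal (g \<omega>) \<partial>M) = (\<integral>\<^sup>+\<omega>\<in>A. ennreal (?p \<omega>) \<partial>M)" .
  qed measurable
  have "(\<integral>\<^sup>+\<omega>. norm (f \<omega> * g \<omega>) \<partial>M) = (\<integral>\<^sup>+\<omega>. ennreal (f \<omega>) * ennreal (g \<omega>) \<partial>M)"
    using g(2) by (intro nn_integral_cong_AE) (auto simp: f(2) ennreal_mult'' abs_mult elim: AE_mp)
  also have "\<dots> = (\<integral>\<^sup>+\<omega>. ennreal (f \<omega>) * nn_cond_exp M H (\<lambda>\<omega>. ennreal (g \<omega>)) \<omega> \<partial>M)"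
  proof (rule nn_cond_exp_intg[symmetric])
    show "(\<lambda>\<omega>. ennreal (f \<omega>)) \<in> borel_measurable H"
      using measurable_compose[OF f(1) measurable_ennreal] .
  qed measurable
  also have "\<dots> = (\<integral>\<^sup>+\<omega>. norm (f \<omega> * ?p \<omega>) \<partial>M)"
  proof (rule nn_integral_cong_AE)
    show "AE \<omega> in M. ennreal (f \<omega>) * nn_cond_exp M H (\<lambda>\<omega>. ennreal (g \<omega>)) \<omega> = ennreal (norm (f \<omega> * ?p \<omega>))"
      using p p0
    proof eventually_elim
      case (elim \<omega>)
      then show ?case using f(2)[of \<omega>] by (simp add: elim(1)[symmetric] ennreal_mult abs_mult)
    qed
  qed
  also have "\<dots> < \<infinity>" using int by (simp add: integrable_iff_bounded)
  finally show ?thesis by (intro integrableI_bounded) auto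
qed

text \<open>The generators are \<open>\<xi>\<^sub>n\<close> truncated to the events \<open>{\<xi>\<^sub>n \<in> B}\<close>, with \<open>(\<xi>\<^sub>n)\<close> a Castaing representation
  and \<open>B\<close> from a countable base: a functional that is nonnegative on all their conditional
  expectations is almost surely nonnegative on every \<open>\<xi>\<^sub>n\<close>.\<close>

lemma cond_exp_generators:
  fixes W Y :: "'w \<Rightarrow> (real ^ 'd) set"
  assumes M: "prob_space M" and G: "subalgebra M G" and H: "subalgebra M H"
    and W: "effros_measurable G W" "\<And>\<omega>. closed (W \<omega>)" "\<And>\<omega>. convex_cone (W \<omega>)"
    and Y: "effros_measurable H Y" "\<And>\<omega>. closed (Y \<omega>)" "\<And>\<omega>. convex_cone (Y \<omega>)"
    and WY: "AE \<omega> in M. W \<omega> \<subseteq> Y \<omega>"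
    and min: "\<And>S. effros_measurable H S \<Longrightarrow> (\<And>\<omega>. closed (S \<omega>)) \<Longrightarrow> (\<And>\<omega>. convex_cone (S \<omega>)) \<Longrightarrow>
      AE \<omega> in M. W \<omega> \<subseteq> S \<omega> \<Longrightarrow> AE \<omega> in M. Y \<omega> \<subseteq> S \<omega>"
  obtains \<zeta> :: "nat \<Rightarrow> 'w \<Rightarrow> real ^ 'd"
  where "\<And>k. \<zeta> k \<in> borel_measurable G" "\<And>k \<omega>. norm (\<zeta> k \<omega>) \<le> 1"
    "\<And>k \<omega>. \<omega> \<in> space M \<Longrightarrow> \<zeta> k \<omega> \<in> W \<omega>"
    "AE \<omega> in M. rel_interior (Y \<omega>) \<subseteq> convex_cone hull (range (\<lambda>k. cond_exp_vec M H (\<zeta> k) \<omega>))"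
proof -
  interpret prob_space M by fact
  interpret finite_measure_subalgebra M H by unfold_locales (rule H)
  have sp: "space G = space M" "space H = space M" using G H by (auto simp: subalgebra_def)
  obtain \<xi> :: "nat \<Rightarrow> 'w \<Rightarrow> real ^ 'd" where \<xi>[measurable]: "\<And>n. \<xi> n \<in> borel_measurable G"
    and \<xi>1: "\<And>n \<omega>. norm (\<xi> n \<omega>) \<le> 1" and \<xi>W: "\<And>n \<omega>. \<omega> \<in> space M \<Longrightarrow> \<xi> n \<omega> \<in> W \<omega>"
    and \<xi>d: "\<And>\<omega>. \<omega> \<in> space M \<Longrightarrow> dual_cone (range (\<lambda>n. \<xi> n \<omega>)) = dual_cone (W \<omega>)"
    using castaing_cone[OF W] unfolding sp by blast
  obtain \<B> :: "(real ^ 'd) set set" where \<B>: "countable \<B>" "\<And>B. B \<in> \<B> \<Longrightarrow> open B"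
    "\<And>S. open S \<Longrightarrow> \<exists>U. U \<subseteq> \<B> \<and> S = \<Union>U"
    using univ_second_countable by blast
  have base: "\<exists>B\<in>\<B>. x \<in> B \<and> B \<subseteq> S" if S: "open S" "x \<in> S" for x and S :: "(real ^ 'd) set"
  proof -
    from \<B>(3)[OF S(1)] obtain U where U: "U \<subseteq> \<B>" "S = \<Union>U" by blast
    then obtain B where "B \<in> U" "x \<in> B" using S(2) by blast
    then have "B \<in> \<B>" "x \<in> B" "B \<subseteq> S" using U by auto
    then show ?thesis by blast
  qed
  have \<B>ne: "\<B> \<noteq> {}" using base[of UNIV 0] by auto
  define J where "J = (UNIV :: nat set) \<times> \<B>"
  have J: "countable J" "J \<noteq> {}" using \<B>(1) \<B>ne by (auto simp: J_def)
  define \<zeta> where "\<zeta> k \<omega> = (case from_nat_into J k of (n, B) \<Rightarrow> indicat_real B (\<xi> n \<omega>) *\<^sub>R \<xi> n \<omega>)" for k \<omega>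
  have \<zeta>_eq: "\<zeta> (to_nat_on J (n, B)) \<omega> = indicat_real B (\<xi> n \<omega>) *\<^sub>R \<xi> n \<omega>" if "B \<in> \<B>" for n B \<omega>
  proof -
    have "(n, B) \<in> J" using that by (simp add: J_def)
    then show ?thesis using J(1) by (simp add: \<zeta>_def)
  qed
  have \<zeta>m: "\<zeta> k \<in> borel_measurable G" for k
  proof -
    obtain n B where nB: "from_nat_into J k = (n, B)" by (cases "from_nat_into J k")
    then have "(n, B) \<in> J" using from_nat_into[OF J(2), of k] by simp
    then have [measurable]: "B \<in> sets borel" using \<B>(2) by (auto simp: J_def)
    have "\<zeta> k = (\<lambda>\<omega>. indicat_real B (\<xi> n \<omega>) *\<^sub>R \<xi> n \<omega>)" by (simp add: \<zeta>_def nB fun_eq_iff)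
    then show ?thesis by simp
  qed
  have \<zeta>M: "\<zeta> k \<in> borel_measurable M" for k by (rule measurable_from_subalg[OF G \<zeta>m])
  have \<xi>M[measurable]: "\<xi> k \<in> borel_measurable M" for k by (rule measurable_from_subalg[OF G \<xi>])
  have \<zeta>1: "norm (\<zeta> k \<omega>) \<le> 1" for k \<omega>
    using \<xi>1 by (cases "from_nat_into J k") (auto simp: \<zeta>_def indicator_def)
  have \<zeta>W: "\<zeta> k \<omega> \<in> W \<omega>" if "\<omega> \<in> space M" for k \<omega>
    using \<xi>W[OF that] convex_cone_contains_0[OF W(3)]
    by (cases "from_nat_into J k") (auto simp: \<zeta>_def indicator_def)
  define c where "c k = cond_exp_vec M H (\<zeta> k)" for k
  have c_m[measurable]: "c k \<in> borel_measurable H" for k unfolding c_def by measurable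
  define C where "C \<omega> = range (\<lambda>k. c k \<omega>)" for \<omega>
  have "effros_measurable H C"
    unfolding effros_measurable_def
  proof (intro allI impI)
    fix V :: "(real ^ 'd) set" assume "open V"
    then have [measurable]: "V \<in> sets borel" by (rule borel_open)
    have "{\<omega>\<in>space H. C \<omega> \<inter> V \<noteq> {}} = {\<omega>\<in>space H. \<exists>k. c k \<omega> \<in> V}" by (auto simp: C_def)
    also have "\<dots> \<in> sets H" by measurable
    finally show "{\<omega>\<in>space H. C \<omega> \<inter> V \<noteq> {}} \<in> sets H" .
  qed
  then have Dm: "effros_measurable H (\<lambda>\<omega>. dual_cone (C \<omega>))"
    by (rule effros_measurable_dual_cone) (simp add: C_def)
  define S where "S \<omega> = dual_cone (dual_cone (C \<omega>))" for \<omega>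
  have Sm: "effros_measurable H S"
    unfolding S_def[abs_def]
    by (rule effros_measurable_dual_cone[OF Dm]) (rule convex_cone_nonempty[OF convex_cone_dual_cone])
  have cY: "AE \<omega> in M. \<forall>k. c k \<omega> \<in> Y \<omega>"
    unfolding AE_all_countable c_def
  proof
    fix k
    have "AE \<omega> in M. \<zeta> k \<omega> \<in> Y \<omega>" using WY AE_space by eventually_elim (use \<zeta>W in auto)
    then show "AE \<omega> in M. cond_exp_vec M H (\<zeta> k) \<omega> \<in> Y \<omega>"
      by (rule cond_exp_vec_in_cone[OF M H \<zeta>M \<zeta>1 Y])
  qed
  obtain e :: "nat \<Rightarrow> 'w \<Rightarrow> real ^ 'd" where e[measurable]: "\<And>n. e n \<in> borel_measurable H"
    and e1: "\<And>n \<omega>. norm (e n \<omega>) \<le> 1" and eC: "\<And>n \<omega>. \<omega> \<in> space M \<Longrightarrow> e n \<omega> \<in> dual_cone (C \<omega>)"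
    and ed: "\<And>\<omega>. \<omega> \<in> space M \<Longrightarrow> dual_cone (range (\<lambda>n. e n \<omega>)) = S \<omega>"
    using castaing_cone[OF Dm closed_dual_cone convex_cone_dual_cone] unfolding sp S_def by blast
  have eM[measurable]: "e n \<in> borel_measurable M" for n by (rule measurable_from_subalg[OF H e])
  have pos: "AE \<omega> in M. \<forall>m n. 0 \<le> e m \<omega> \<bullet> \<xi> n \<omega>"
    unfolding AE_all_countable
  proof (intro allI)
    fix m n
    \<comment> \<open>Products of such pairs of basic sets cover the open set of pairs of vectors
      with negative inner product, so countably many null events exhaust the event that
      \<open>e m\<close> is negative at \<open>\<xi> n\<close>.\<close>
    define P where "P = {(B', B). B' \<in> \<B> \<and> B \<in> \<B> \<and> (\<forall>v\<in>B'. \<forall>x\<in>B. v \<bullet> x < 0)}"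
    have "P \<subseteq> \<B> \<times> \<B>" by (auto simp: P_def)
    then have cP: "countable P" by (rule countable_subset) (intro countable_SIGMA \<B>(1))
    have "AE \<omega> in M. \<forall>p\<in>P. \<not> (e m \<omega> \<in> fst p \<and> \<xi> n \<omega> \<in> snd p)"
      unfolding AE_ball_countable[OF cP]
    proof
      fix p assume p: "p \<in> P"
      obtain B' B where pB: "p = (B', B)" by (cases p)
      have B: "B' \<in> \<B>" "B \<in> \<B>" "\<And>v x. v \<in> B' \<Longrightarrow> x \<in> B \<Longrightarrow> v \<bullet> x < 0"
        using p by (auto simp: P_def pB)
      have [measurable]: "B' \<in> sets borel" "B \<in> sets borel" using B(1,2) \<B>(2) by auto
      define k where "k = to_nat_on J (n, B)"
      define u where "u \<omega> = indicat_real B' (e m \<omega>) *\<^sub>R e m \<omega>" for \<omega>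
      have u[measurable]: "u \<in> borel_measurable H" "u \<in> borel_measurable M" unfolding u_def[abs_def] by measurable
      have u1: "norm (u \<omega>) \<le> 1" for \<omega> using e1 by (auto simp: u_def indicator_def)
      have fle: "u \<omega> \<bullet> \<zeta> k \<omega> \<le> 0" for \<omega>
        unfolding k_def \<zeta>_eq[OF B(2)] u_def using B(3)[of "e m \<omega>" "\<xi> n \<omega>"]
        by (auto simp: indicator_def)
      have [measurable]: "\<zeta> k \<in> borel_measurable M" by (rule \<zeta>M)
      have int: "integrable M (\<lambda>\<omega>. u \<omega> \<bullet> \<zeta> k \<omega>)"
      proof (rule integrable_const_bound)
        have "\<bar>u \<omega> \<bullet> \<zeta> k \<omega>\<bar> \<le> 1" for \<omega>
        proof -
          have "\<bar>u \<omega> \<bullet> \<zeta> k \<omega>\<bar> \<le> norm (u \<omega>) * norm (\<zeta> k \<omega>)" by (rule Cauchy_Schwarz_ineq2)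
          also have "\<dots> \<le> 1" using u1 \<zeta>1 by (intro mult_le_one) auto
          finally show ?thesis .
        qed
        then show "AE \<omega> in M. norm (u \<omega> \<bullet> \<zeta> k \<omega>) \<le> 1" by simp
      qed measurable
      have "(\<integral>\<omega>. u \<omega> \<bullet> \<zeta> k \<omega> \<partial>M) = (\<integral>\<omega>. real_cond_exp M H (\<lambda>\<omega>. u \<omega> \<bullet> \<zeta> k \<omega>) \<omega> \<partial>M)"
        by (rule real_cond_exp_int(2)[OF int, symmetric])
      also have "\<dots> \<ge> 0"
      proof (rule integral_nonneg_AE)
        show "AE \<omega> in M. 0 \<le> real_cond_exp M H (\<lambda>\<omega>. u \<omega> \<bullet> \<zeta> k \<omega>) \<omega>"
          using cond_exp_vec_inner[OF M H \<zeta>M \<zeta>1 u(1) u1, of k] AE_space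
        proof eventually_elim
          case (elim \<omega>)
          have "0 \<le> c k \<omega> \<bullet> e m \<omega>" by (rule dual_coneD[OF eC[OF elim(2)]]) (simp add: C_def)
          then show ?case unfolding elim(1) by (simp add: u_def indicator_def c_def inner_commute)
        qed
      qed
      finally have ge: "0 \<le> (\<integral>\<omega>. u \<omega> \<bullet> \<zeta> k \<omega> \<partial>M)" .
      \<comment> \<open>The product of \<open>u\<close> and \<open>\<zeta> k\<close> is nonpositive
        by the choice of \<open>P\<close>, while conditioning on \<open>H\<close> makes its integral
        nonnegative, since \<open>e m\<close> lies in the dual of the conditional expectations.
        Hence it vanishes almost surely.\<close>
      have "(\<integral>\<omega>. - (u \<omega> \<bullet> \<zeta> k \<omega>) \<partial>M) = 0"
      proof (rule antisym)
        show "(\<integral>\<omega>. - (u \<omega> \<bullet> \<zeta> k \<omega>) \<partial>M) \<le> 0" using ge by simp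
        show "0 \<le> (\<integral>\<omega>. - (u \<omega> \<bullet> \<zeta> k \<omega>) \<partial>M)" using fle by (intro integral_nonneg_AE) auto
      qed
      then have "AE \<omega> in M. - (u \<omega> \<bullet> \<zeta> k \<omega>) = 0"
        using integral_nonneg_eq_0_iff_AE[of M "\<lambda>\<omega>. - (u \<omega> \<bullet> \<zeta> k \<omega>)"] int fle by auto
      then show "AE \<omega> in M. \<not> (e m \<omega> \<in> fst p \<and> \<xi> n \<omega> \<in> snd p)"
      proof eventually_elim
        case (elim \<omega>)
        show ?case
        proof
          assume a: "e m \<omega> \<in> fst p \<and> \<xi> n \<omega> \<in> snd p"
          then have "u \<omega> \<bullet> \<zeta> k \<omega> = e m \<omega> \<bullet> \<xi> n \<omega>" by (simp add: u_def k_def \<zeta>_eq[OF B(2)] pB)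
          moreover have "e m \<omega> \<bullet> \<xi> n \<omega> < 0" using a B(3) by (simp add: pB)
          ultimately show False using elim by simp
        qed
      qed
    qed
    then show "AE \<omega> in M. 0 \<le> e m \<omega> \<bullet> \<xi> n \<omega>"
    proof eventually_elim
      case (elim \<omega>)
      show ?case
      proof (rule ccontr)
        assume "\<not> 0 \<le> e m \<omega> \<bullet> \<xi> n \<omega>"
        then have mem: "(e m \<omega>, \<xi> n \<omega>) \<in> {p. fst p \<bullet> snd p < 0}" by simp
        have op: "open {p::(real^'d) \<times> (real^'d). fst p \<bullet> snd p < 0}"
          by (intro open_Collect_less continuous_intros)
        obtain A' A where A: "open A'" "open A" "(e m \<omega>, \<xi> n \<omega>) \<in> A' \<times> A" "A' \<times> A \<subseteq> {p. fst p \<bullet> snd p < 0}"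
          by (rule open_prod_elim[OF op mem])
        then have mem': "e m \<omega> \<in> A'" "\<xi> n \<omega> \<in> A" by simp_all
        obtain B' where B': "B' \<in> \<B>" "e m \<omega> \<in> B'" "B' \<subseteq> A'" using base[OF A(1) mem'(1)] by blast
        obtain B where B: "B \<in> \<B>" "\<xi> n \<omega> \<in> B" "B \<subseteq> A" using base[OF A(2) mem'(2)] by blast
        have "v \<bullet> x < 0" if "v \<in> B'" "x \<in> B" for v x
        proof -
          have "(v, x) \<in> A' \<times> A" using that B' B by blast
          then show ?thesis using A(4) by auto
        qed
        then have "(B', B) \<in> P" using B' B by (simp add: P_def)
        from bspec[OF elim this] show False using B' B by simp
      qed
    qed
  qed
  have "AE \<omega> in M. W \<omega> \<subseteq> S \<omega>"
    using pos AE_space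
  proof eventually_elim
    case (elim \<omega>)
    have "range (\<lambda>n. \<xi> n \<omega>) \<subseteq> S \<omega>"
      unfolding ed[OF elim(2), symmetric] using elim(1) by (auto simp: dual_cone_def)
    then have "dual_cone (S \<omega>) \<subseteq> dual_cone (W \<omega>)"
      using dual_cone_antimono \<xi>d[OF elim(2)] by metis
    then have "dual_cone (dual_cone (W \<omega>)) \<subseteq> dual_cone (dual_cone (S \<omega>))" by (rule dual_cone_antimono)
    then show ?case
      unfolding dual_cone_dual_cone[OF W(3,2)]
      by (simp add: S_def dual_cone_dual_cone[OF convex_cone_dual_cone closed_dual_cone])
  qed
  then have "AE \<omega> in M. Y \<omega> \<subseteq> S \<omega>"
    by (intro min[OF Sm]) (simp_all add: S_def closed_dual_cone convex_cone_dual_cone)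
  then have ri: "AE \<omega> in M. rel_interior (Y \<omega>) \<subseteq> convex_cone hull (range (\<lambda>k. c k \<omega>))"
    using cY
  proof eventually_elim
    case (elim \<omega>)
    let ?C = "convex_cone hull (range (\<lambda>k. c k \<omega>))"
    have "closure ?C \<subseteq> Y \<omega>"
      using elim(2) Y by (intro closure_minimal hull_minimal) auto
    moreover have "Y \<omega> \<subseteq> closure ?C"
      using elim(1) unfolding S_def C_def dual_cone_dual_cone_eq_closure .
    ultimately have "Y \<omega> = closure ?C" by blast
    \<comment> \<open>A convex set and its closure have the same relative interior. This turns
      density of the generated cone in \<open>Y\<close> into membership, hence into finite
      combinations.\<close>
    then have "rel_interior (Y \<omega>) = rel_interior ?C"
      by (simp add: convex_rel_interior_closure[OF convex_convex_cone_hull])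
    then show ?case using rel_interior_subset by blast
  qed
  show ?thesis
  proof (rule that)
    show "\<zeta> k \<in> borel_measurable G" for k by (rule \<zeta>m)
    show "norm (\<zeta> k \<omega>) \<le> 1" for k \<omega> by (rule \<zeta>1)
    show "\<omega> \<in> space M \<Longrightarrow> \<zeta> k \<omega> \<in> W \<omega>" for k \<omega> by (rule \<zeta>W)
    show "AE \<omega> in M. rel_interior (Y \<omega>) \<subseteq> convex_cone hull (range (\<lambda>k. cond_exp_vec M H (\<zeta> k) \<omega>))"
      using ri unfolding c_def .
  qed
qed

text \<open>The pairs of a number \<open>n\<close> and an index tuple are countably many, and for
  each of them the admissible coefficients form a measurable closed set. The least feasible pair is
  measurable, and coefficients for it are then selected. The type \<open>'d option\<close> supplies
  the slots for Caratheodory's theorem, one more than the dimension.\<close>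

lemma measurable_conic_combination:
  fixes c :: "nat \<Rightarrow> 'w \<Rightarrow> real ^ 'd" and z b :: "'w \<Rightarrow> real ^ 'd"
  assumes c[measurable]: "\<And>k. c k \<in> borel_measurable H" and z[measurable]: "z \<in> borel_measurable H"
    and b[measurable]: "b \<in> borel_measurable H"
    and sp: "space H = space M"
    and ex: "AE \<omega> in M. \<exists>n::nat. z \<omega> - (1 / real (Suc n)) *\<^sub>R b \<omega> \<in> convex_cone hull (range (\<lambda>k. c k \<omega>))"
  obtains I :: "'d option \<Rightarrow> 'w \<Rightarrow> nat" and l :: "'d option \<Rightarrow> 'w \<Rightarrow> real" and s :: "'w \<Rightarrow> real"
  where "\<And>j. I j \<in> H \<rightarrow>\<^sub>M count_space UNIV" "\<And>j. l j \<in> borel_measurable H" "s \<in> borel_measurable H"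
    "\<And>j \<omega>. 0 \<le> l j \<omega>" "\<And>\<omega>. 0 < s \<omega>" "\<And>\<omega>. s \<omega> \<le> 1"
    "AE \<omega> in M. z \<omega> = (\<Sum>j\<in>UNIV. l j \<omega> *\<^sub>R c (I j \<omega>) \<omega>) + s \<omega> *\<^sub>R b \<omega>"
proof -
  define q :: "nat \<Rightarrow> nat \<times> ('d option \<Rightarrow> nat)" where "q = from_nat"
  \<comment> \<open>Negative coefficients and the defect in the equation are penalised, so the zeros
    are exactly the admissible coefficient vectors.\<close>
  define f where "f m \<omega> v = (\<Sum>j\<in>UNIV. max 0 (- (v $ j))) +
      norm ((\<Sum>j\<in>UNIV. (v $ j) *\<^sub>R c (snd (q m) j) \<omega>) + (1 / real (Suc (fst (q m)))) *\<^sub>R b \<omega> - z \<omega>)"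
    for m \<omega> and v :: "real ^ 'd option"
  have f0: "f m \<omega> v = 0 \<longleftrightarrow> (\<forall>j. 0 \<le> v $ j) \<and>
      z \<omega> = (\<Sum>j\<in>UNIV. (v $ j) *\<^sub>R c (snd (q m) j) \<omega>) + (1 / real (Suc (fst (q m)))) *\<^sub>R b \<omega>" for m \<omega> v
  proof -
    have "f m \<omega> v = 0 \<longleftrightarrow> (\<Sum>j\<in>UNIV. max 0 (- (v $ j))) = 0 \<and>
      norm ((\<Sum>j\<in>UNIV. (v $ j) *\<^sub>R c (snd (q m) j) \<omega>) + (1 / real (Suc (fst (q m)))) *\<^sub>R b \<omega> - z \<omega>) = 0"
      unfolding f_def by (intro add_nonneg_eq_0_iff sum_nonneg) auto
    also have "(\<Sum>j\<in>UNIV. max 0 (- (v $ j))) = 0 \<longleftrightarrow> (\<forall>j. max 0 (- (v $ j)) = 0)"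
      by (subst sum_nonneg_eq_0_iff) auto
    also have "\<dots> \<longleftrightarrow> (\<forall>j. 0 \<le> v $ j)" by (intro all_cong1) linarith
    finally show ?thesis by auto
  qed
  have fm: "(\<lambda>\<omega>. f m \<omega> v) \<in> borel_measurable H" for m v unfolding f_def by measurable
  have fc: "continuous_on UNIV (f m \<omega>)" for m \<omega> unfolding f_def[abs_def] by (intro continuous_intros)
  have hit: "Measurable.pred H (\<lambda>\<omega>. {v. f m \<omega> v = 0} \<noteq> {})" for m
    using effros_measurableD[OF effros_measurable_zero_set[OF fm fc] open_UNIV] by (simp add: pred_def)
  define N where "N \<omega> = (LEAST m. {v. f m \<omega> v = 0} \<noteq> {})" for \<omega>
  have N[measurable]: "N \<in> H \<rightarrow>\<^sub>M count_space UNIV"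
    unfolding N_def[abs_def] by (intro measurable_Least hit)
  define E where "E \<omega> \<longleftrightarrow> (\<exists>m. {v. f m \<omega> v = 0} \<noteq> {})" for \<omega>
  have E[measurable]: "Measurable.pred H E" unfolding E_def[abs_def] using hit by measurable
  define h where "h \<omega> v = (if E \<omega> then f (N \<omega>) \<omega> v else 0)" for \<omega> v
  have EN: "\<exists>v. f (N \<omega>) \<omega> v = 0" if "E \<omega>" for \<omega>
    using LeastI_ex[OF that[unfolded E_def]] unfolding N_def by blast
  have hm: "(\<lambda>\<omega>. h \<omega> v) \<in> borel_measurable H" for v
  proof -
    have [measurable]: "(\<lambda>\<omega>. f (N \<omega>) \<omega> v) \<in> borel_measurable H"
      using N by (rule measurable_compose_countable[rotated]) (rule fm)
    show ?thesis unfolding h_def by measurable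
  qed
  have hc: "continuous_on UNIV (h \<omega>)" for \<omega> unfolding h_def[abs_def] using fc by (cases "E \<omega>") auto
  have hne: "{v. h \<omega> v = 0} \<noteq> {}" for \<omega> using EN[of \<omega>] by (auto simp: h_def)
  have hcl: "closed {v. h \<omega> v = 0}" for \<omega>
    using continuous_closed_vimage[of "{0}" "h \<omega>"] hc by (simp add: vimage_def continuous_on_eq_continuous_at)
  obtain v where v[measurable]: "v \<in> borel_measurable H" and vh: "\<And>\<omega>. \<omega> \<in> space H \<Longrightarrow> h \<omega> (v \<omega>) = 0"
    using measurable_selection[OF effros_measurable_zero_set[OF hm hc] hcl hne] by auto
  \<comment> \<open>Outside \<open>E\<close> the selected \<open>v\<close> is arbitrary; the
    truncation makes the coefficients nonnegative there too.\<close>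
  define l where "l j \<omega> = max 0 (v \<omega> $ j)" for j \<omega>
  define I where "I j \<omega> = snd (q (N \<omega>)) j" for j \<omega>
  define s where "s \<omega> = 1 / real (Suc (fst (q (N \<omega>))))" for \<omega>
  have AE: "AE \<omega> in M. z \<omega> = (\<Sum>j\<in>UNIV. l j \<omega> *\<^sub>R c (I j \<omega>) \<omega>) + s \<omega> *\<^sub>R b \<omega>"
    using ex AE_space
  proof eventually_elim
    case (elim \<omega>)
    then obtain n where n: "z \<omega> - (1 / real (Suc n)) *\<^sub>R b \<omega> \<in> convex_cone hull (range (\<lambda>k. c k \<omega>))" by blast
    have dim: "DIM(real ^ 'd) < CARD('d option)" by simp
    obtain i :: "'d option \<Rightarrow> nat" and w :: "real ^ 'd option" where w: "\<And>j. 0 \<le> w $ j"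
        "z \<omega> - (1 / real (Suc n)) *\<^sub>R b \<omega> = (\<Sum>j\<in>UNIV. (w $ j) *\<^sub>R c (i j) \<omega>)"
      by (rule conic_caratheodory[OF n dim]) (rule that)
    have "f (to_nat (n, i)) \<omega> w = 0"
      unfolding f0 q_def using w by (simp add: algebra_simps)
    then have "E \<omega>" unfolding E_def by blast
    then have "f (N \<omega>) \<omega> (v \<omega>) = 0" using vh[of \<omega>] elim(2) sp by (simp add: h_def)
    then show ?case unfolding f0 by (simp add: l_def I_def s_def max_absorb2)
  qed
  show ?thesis
  proof (rule that[OF _ _ _ _ _ _ AE])
    show "I j \<in> H \<rightarrow>\<^sub>M count_space UNIV" for j
      unfolding I_def[abs_def] by (rule measurable_compose[OF N]) simp
    show "l j \<in> borel_measurable H" for j unfolding l_def[abs_def] by measurable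
    show "s \<in> borel_measurable H" unfolding s_def[abs_def] by (rule measurable_compose[OF N]) simp
  qed (auto simp: l_def s_def divide_le_eq)
qed

text \<open>The point \<open>z\<close> is a conic combination of conditional expectations of
  selections of \<open>W\<close> plus a small positive multiple of the conditional expectation
  \<open>b\<close> of a relatively interior selection \<open>g\<close>. Replacing the conditional
  expectations by the selections themselves gives \<open>\<xi>\<close>, and the summand with
  \<open>g\<close> puts it into the relative interior.\<close>

lemma martingale_selection_step:
  fixes W Y :: "'w \<Rightarrow> (real ^ 'd) set"
  assumes M: "prob_space M" and G: "subalgebra M G" and H: "subalgebra M H" and GH: "subalgebra G H"
    and W: "effros_measurable G W" "\<And>\<omega>. closed (W \<omega>)" "\<And>\<omega>. convex_cone (W \<omega>)"
    and Wpos: "\<And>\<omega>. \<omega> \<in> space M \<Longrightarrow> W \<omega> \<subseteq> nonneg_orthant"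
    and Y: "effros_measurable H Y" "\<And>\<omega>. closed (Y \<omega>)" "\<And>\<omega>. convex_cone (Y \<omega>)"
    and WY: "AE \<omega> in M. W \<omega> \<subseteq> Y \<omega>"
    and min: "\<And>S. effros_measurable H S \<Longrightarrow> (\<And>\<omega>. closed (S \<omega>)) \<Longrightarrow> (\<And>\<omega>. convex_cone (S \<omega>)) \<Longrightarrow>
      AE \<omega> in M. W \<omega> \<subseteq> S \<omega> \<Longrightarrow> AE \<omega> in M. Y \<omega> \<subseteq> S \<omega>"
    and z: "z \<in> borel_measurable H" "integrable M z" "AE \<omega> in M. z \<omega> \<in> rel_interior (Y \<omega>)"
  shows "\<exists>\<xi>. \<xi> \<in> borel_measurable G \<and> integrable M \<xi> \<and> (AE \<omega> in M. \<xi> \<omega> \<in> rel_interior (W \<omega>)) \<and>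
    (\<forall>i. AE \<omega> in M. real_cond_exp M H (\<lambda>\<omega>. \<xi> \<omega> $ i) \<omega> = z \<omega> $ i)"
proof -
  interpret prob_space M by fact
  interpret finite_measure_subalgebra M H by unfold_locales (rule H)
  have sp: "space G = space M" "space H = space M" using G H by (auto simp: subalgebra_def)
  obtain \<zeta> :: "nat \<Rightarrow> 'w \<Rightarrow> real ^ 'd"
    where \<zeta>: "\<And>k. \<zeta> k \<in> borel_measurable G" "\<And>k \<omega>. norm (\<zeta> k \<omega>) \<le> 1"
      "\<And>k \<omega>. \<omega> \<in> space M \<Longrightarrow> \<zeta> k \<omega> \<in> W \<omega>"
      "AE \<omega> in M. rel_interior (Y \<omega>) \<subseteq> convex_cone hull (range (\<lambda>k. cond_exp_vec M H (\<zeta> k) \<omega>))"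
    by (rule cond_exp_generators[OF M G H W Y WY min]) blast+
  have \<zeta>M[measurable]: "\<zeta> k \<in> borel_measurable M" for k by (rule measurable_from_subalg[OF G \<zeta>(1)])
  obtain g where g: "g \<in> borel_measurable G" "\<And>\<omega>. norm (g \<omega>) \<le> 1"
    "\<And>\<omega>. \<omega> \<in> space G \<Longrightarrow> g \<omega> \<in> rel_interior (W \<omega>)"
    using measurable_selection_rel_interior[OF W] by blast
  have gM[measurable]: "g \<in> borel_measurable M" by (rule measurable_from_subalg[OF G g(1)])
  have gW: "g \<omega> \<in> W \<omega>" if "\<omega> \<in> space M" for \<omega>
    using g(3)[of \<omega>] that rel_interior_subset sp by blast
  define c where "c k = cond_exp_vec M H (\<zeta> k)" for k
  define b where "b = cond_exp_vec M H g"
  have "AE \<omega> in M. g \<omega> \<in> Y \<omega>" using WY AE_space by eventually_elim (use gW in auto)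
  then have bY: "AE \<omega> in M. b \<omega> \<in> Y \<omega>"
    unfolding b_def by (rule cond_exp_vec_in_cone[OF M H gM g(2) Y])
  \<comment> \<open>As \<open>z\<close> is relatively interior to \<open>Y\<close>, it stays so
    after subtracting a small multiple of \<open>b\<close>. Factors \<open>1 / Suc n\<close> keep
    the choice countable.\<close>
  have ex: "AE \<omega> in M. \<exists>n::nat. z \<omega> - (1 / real (Suc n)) *\<^sub>R b \<omega> \<in> convex_cone hull (range (\<lambda>k. c k \<omega>))"
    using bY z(3) \<zeta>(4)
  proof eventually_elim
    case (elim \<omega>)
    obtain \<delta> where \<delta>: "0 < \<delta>" "\<And>s. 0 \<le> s \<Longrightarrow> s < \<delta> \<Longrightarrow> z \<omega> - s *\<^sub>R b \<omega> \<in> rel_interior (Y \<omega>)"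
      by (rule rel_interior_convex_cone_diff[OF Y(3) elim(2,1)]) blast
    obtain n where "1 / real (Suc n) < \<delta>" using nat_approx_posE[OF \<delta>(1)] by blast
    then have "z \<omega> - (1 / real (Suc n)) *\<^sub>R b \<omega> \<in> rel_interior (Y \<omega>)" by (intro \<delta>(2)) auto
    then show ?case using elim(3) unfolding c_def by blast
  qed
  have cm: "c k \<in> borel_measurable H" for k unfolding c_def by measurable
  have bm: "b \<in> borel_measurable H" unfolding b_def by measurable
  obtain I :: "'d option \<Rightarrow> 'w \<Rightarrow> nat" and l :: "'d option \<Rightarrow> 'w \<Rightarrow> real" and s :: "'w \<Rightarrow> real"
    where I: "\<And>j. I j \<in> H \<rightarrow>\<^sub>M count_space UNIV" and l: "\<And>j. l j \<in> borel_measurable H"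
      and s: "s \<in> borel_measurable H" and l0: "\<And>j \<omega>. 0 \<le> l j \<omega>" and s01: "\<And>\<omega>. 0 < s \<omega>" "\<And>\<omega>. s \<omega> \<le> 1"
      and z_eq: "AE \<omega> in M. z \<omega> = (\<Sum>j\<in>UNIV. l j \<omega> *\<^sub>R c (I j \<omega>) \<omega>) + s \<omega> *\<^sub>R b \<omega>"
    by (rule measurable_conic_combination[OF cm z(1) bm sp(2) ex]) blast
  have IG: "I j \<in> G \<rightarrow>\<^sub>M count_space UNIV" for j by (rule measurable_from_subalg[OF GH I])
  define \<theta> where "\<theta> j \<omega> = \<zeta> (I j \<omega>) \<omega>" for j \<omega>
  have \<theta>G: "\<theta> j \<in> borel_measurable G" for j
    unfolding \<theta>_def[abs_def] using IG by (rule measurable_compose_countable[rotated]) (rule \<zeta>)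
  have \<theta>M[measurable]: "\<theta> j \<in> borel_measurable M" for j by (rule measurable_from_subalg[OF G \<theta>G])
  have [measurable]: "l j \<in> borel_measurable M" "s \<in> borel_measurable M" for j
    using l s measurable_from_subalg[OF H] by auto
  have \<theta>1: "norm (\<theta> j \<omega>) \<le> 1" for j \<omega> by (simp add: \<theta>_def \<zeta>)
  have \<theta>W: "\<theta> j \<omega> \<in> W \<omega>" if "\<omega> \<in> space M" for j \<omega> using that by (simp add: \<theta>_def \<zeta>)
  define \<xi> where "\<xi> \<omega> = (\<Sum>j\<in>UNIV. l j \<omega> *\<^sub>R \<theta> j \<omega>) + s \<omega> *\<^sub>R g \<omega>" for \<omega>
  have \<xi>G: "\<xi> \<in> borel_measurable G"
  proof -
    note [measurable] = measurable_from_subalg[OF GH l] measurable_from_subalg[OF GH s] \<theta>G g(1)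
    show ?thesis unfolding \<xi>_def[abs_def] by measurable
  qed
  have \<xi>ri: "\<xi> \<omega> \<in> rel_interior (W \<omega>)" if w: "\<omega> \<in> space M" for \<omega>
  proof -
    have "(\<Sum>j\<in>J. l j \<omega> *\<^sub>R \<theta> j \<omega>) \<in> W \<omega>" if "finite J" for J
      using that by induction (auto intro!: convex_cone_contains_0[OF W(3)] convex_cone_add[OF W(3)] convex_cone_scaleR[OF W(3)] l0 \<theta>W[OF w])
    then have "(\<Sum>j\<in>UNIV. l j \<omega> *\<^sub>R \<theta> j \<omega>) \<in> W \<omega>" by simp
    moreover have "s \<omega> *\<^sub>R g \<omega> \<in> rel_interior (W \<omega>)"
      using rel_interior_convex_cone_scaleR[OF W(3) g(3) s01(1)] w sp by simp
    ultimately show ?thesis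
      unfolding \<xi>_def add.commute[of "sum _ _"] by (intro rel_interior_convex_cone_add[OF W(3)])
  qed
  have comp: "\<bar>x $ i\<bar> \<le> 1" if "norm x \<le> 1" for x :: "real ^ 'd" and i
    using component_le_norm_cart[of x i] that by linarith
  have Wi: "0 \<le> x $ i" if "\<omega> \<in> space M" "x \<in> W \<omega>" for x i \<omega>
    using Wpos[OF that(1)] that(2) by (auto simp: nonneg_orthant_def)
  have \<theta>c: "AE \<omega> in M. real_cond_exp M H (\<lambda>\<omega>. \<theta> j \<omega> $ i) \<omega> = c (I j \<omega>) \<omega> $ i" for j i
    using real_cond_exp_countable_choice[OF M H, of "\<lambda>k \<omega>. \<zeta> k \<omega> $ i" "I j"] I comp \<zeta>(2)
    by (simp add: \<theta>_def c_def cond_exp_vec_def)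
  have int\<theta>: "integrable M (\<lambda>\<omega>. \<theta> j \<omega> $ i)" for j i
    by (rule integrable_const_bound[of _ 1]) (auto simp: comp \<theta>1)
  have intsg: "integrable M (\<lambda>\<omega>. s \<omega> * g \<omega> $ i)" for i
  proof (rule integrable_const_bound)
    show "AE \<omega> in M. norm (s \<omega> * g \<omega> $ i) \<le> 1"
      using s01 comp g(2) by (intro AE_I2) (simp add: abs_mult mult_le_one less_imp_le)
  qed measurable
  have intz: "integrable M (\<lambda>\<omega>. z \<omega> $ i)" for i
    using integrable_inner_left[OF z(2), of "axis i 1"] by (simp add: inner_axis)
  have c0: "AE \<omega> in M. \<forall>j. 0 \<le> c (I j \<omega>) \<omega> $ i" for i
    unfolding AE_all_countable
  proof
    fix j
    have "AE \<omega> in M. 0 \<le> real_cond_exp M H (\<lambda>\<omega>. \<theta> j \<omega> $ i) \<omega>"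
      using Wi[OF _ \<theta>W] by (intro real_cond_exp_pos) auto
    then show "AE \<omega> in M. 0 \<le> c (I j \<omega>) \<omega> $ i" using \<theta>c[of j i] by eventually_elim simp
  qed
  have b0: "AE \<omega> in M. 0 \<le> b \<omega> $ i" for i
    unfolding b_def cond_exp_vec_def using Wi[OF _ gW] real_cond_exp_pos[of "\<lambda>\<omega>. g \<omega> $ i"] by simp
  \<comment> \<open>All terms in the representation of \<open>z\<close> have nonnegative components
    because \<open>W\<close> lies in the orthant, so each of them is bounded by the component of
    \<open>z\<close>.\<close>
  have intlc: "integrable M (\<lambda>\<omega>. l j \<omega> * real_cond_exp M H (\<lambda>\<omega>. \<theta> j \<omega> $ i) \<omega>)" for i j
  proof (rule Bochner_Integration.integrable_bound[OF intz[of i]])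
    show "AE \<omega> in M. norm (l j \<omega> * real_cond_exp M H (\<lambda>\<omega>. \<theta> j \<omega> $ i) \<omega>) \<le> norm (z \<omega> $ i)"
      using \<theta>c[of j i] c0[of i] b0[of i] z_eq
    proof eventually_elim
      case (elim \<omega>)
      have nn: "0 \<le> l j' \<omega> * c (I j' \<omega>) \<omega> $ i" for j' using l0 elim(2) by simp
      have "l j \<omega> * c (I j \<omega>) \<omega> $ i \<le> (\<Sum>j'\<in>UNIV. l j' \<omega> * c (I j' \<omega>) \<omega> $ i)"
        using nn by (intro member_le_sum) auto
      also have "\<dots> \<le> (\<Sum>j'\<in>UNIV. l j' \<omega> * c (I j' \<omega>) \<omega> $ i) + s \<omega> * b \<omega> $ i"
        using s01(1)[of \<omega>] elim(3) by simp
      also have "\<dots> = z \<omega> $ i" by (simp add: elim(4))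
      finally show ?case using nn[of j] elim(1) by simp
    qed
  qed measurable
  have intl\<theta>: "integrable M (\<lambda>\<omega>. l j \<omega> * \<theta> j \<omega> $ i)" for i j
    using Wi[OF _ \<theta>W] by (intro integrable_mult_if_cond_exp[OF M H l l0 int\<theta> _ intlc]) auto
  have \<xi>i: "\<xi> \<omega> $ i = (\<Sum>j\<in>UNIV. l j \<omega> * \<theta> j \<omega> $ i) + s \<omega> * g \<omega> $ i" for \<omega> i
    by (simp add: \<xi>_def)
  have int\<xi>i: "integrable M (\<lambda>\<omega>. \<xi> \<omega> $ i)" for i
    unfolding \<xi>i by (intro Bochner_Integration.integrable_add Bochner_Integration.integrable_sum intl\<theta> intsg)
  have int\<xi>: "integrable M \<xi>"
  proof -
    have "integrable M (\<lambda>\<omega>. \<Sum>i\<in>UNIV. (\<xi> \<omega> $ i) *\<^sub>R axis i (1::real))"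
      using int\<xi>i by (intro Bochner_Integration.integrable_sum integrable_scaleR_left) auto
    moreover have "(\<Sum>i\<in>UNIV. (x $ i) *\<^sub>R axis i (1::real)) = x" for x :: "real ^ 'd"
      by (simp add: vec_eq_iff axis_def if_distrib cong: if_cong)
    ultimately show ?thesis by simp
  qed
  have "AE \<omega> in M. real_cond_exp M H (\<lambda>\<omega>. \<xi> \<omega> $ i) \<omega> = z \<omega> $ i" for i
  proof -
    have "AE \<omega> in M. real_cond_exp M H (\<lambda>\<omega>. \<xi> \<omega> $ i) \<omega> =
        real_cond_exp M H (\<lambda>\<omega>. \<Sum>j\<in>UNIV. l j \<omega> * \<theta> j \<omega> $ i) \<omega> + real_cond_exp M H (\<lambda>\<omega>. s \<omega> * g \<omega> $ i) \<omega>"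
      unfolding \<xi>i by (intro real_cond_exp_add Bochner_Integration.integrable_sum intl\<theta> intsg)
    moreover have "AE \<omega> in M. real_cond_exp M H (\<lambda>\<omega>. \<Sum>j\<in>UNIV. l j \<omega> * \<theta> j \<omega> $ i) \<omega> =
        (\<Sum>j\<in>UNIV. real_cond_exp M H (\<lambda>\<omega>. l j \<omega> * \<theta> j \<omega> $ i) \<omega>)"
      by (rule real_cond_exp_sum[OF intl\<theta>])
    moreover have "AE \<omega> in M. \<forall>j. real_cond_exp M H (\<lambda>\<omega>. l j \<omega> * \<theta> j \<omega> $ i) \<omega> = l j \<omega> * real_cond_exp M H (\<lambda>\<omega>. \<theta> j \<omega> $ i) \<omega>"
      unfolding AE_all_countable by (intro allI real_cond_exp_mult intl\<theta> l) measurable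
    moreover have "AE \<omega> in M. \<forall>j. real_cond_exp M H (\<lambda>\<omega>. \<theta> j \<omega> $ i) \<omega> = c (I j \<omega>) \<omega> $ i"
      unfolding AE_all_countable using \<theta>c by blast
    moreover have "AE \<omega> in M. real_cond_exp M H (\<lambda>\<omega>. s \<omega> * g \<omega> $ i) \<omega> = s \<omega> * real_cond_exp M H (\<lambda>\<omega>. g \<omega> $ i) \<omega>"
      by (intro real_cond_exp_mult intsg s) measurable
    ultimately show ?thesis
      using z_eq
    proof eventually_elim
      case (elim \<omega>)
      have "z \<omega> $ i = (\<Sum>j\<in>UNIV. l j \<omega> * c (I j \<omega>) \<omega> $ i) + s \<omega> * b \<omega> $ i" by (subst elim(6)) simp
      then show ?case using elim(1-5) by (simp add: b_def cond_exp_vec_def)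
    qed
  qed
  then show ?thesis using \<xi>G int\<xi> \<xi>ri by (intro exI[of _ \<xi>]) auto
qed

section \<open>Solvency cones\<close>

lemma mem_uminus_image_iff: "x \<in> uminus ` S \<longleftrightarrow> - x \<in> S" for x :: "'a::group_add"
  by (metis image_iff minus_minus)

text \<open>Written with ranges over finite types, so that finiteness, and with it closedness of the
  generated cone, is immediate.\<close>

definition solvency_generators :: "real ^ 'd ^ 'd \<Rightarrow> (real ^ 'd) set" where
  "solvency_generators \<pi> = range (\<lambda>i. axis i 1) \<union> range (\<lambda>(i, j). (\<pi> $ i $ j) *\<^sub>R axis i 1 - axis j 1)"

lemma solvency_cone_eq: "solvency_cone \<pi> = convex_cone hull solvency_generators \<pi>"
proof -
  have "{axis i 1 | i. True} \<union> {(\<pi> $ i $ j) *\<^sub>R axis i 1 - axis j 1 | i j. True} = solvency_generators \<pi>"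
    by (auto simp: solvency_generators_def)
  then show ?thesis by (simp add: solvency_cone_def)
qed

lemma convex_cone_solvency_cone: "convex_cone (solvency_cone \<pi>)"
  unfolding solvency_cone_eq by (rule convex_cone_convex_cone_hull)

lemma closed_solvency_cone: "closed (solvency_cone \<pi>)"
  unfolding solvency_cone_eq by (rule closed_convex_cone_hull) (simp add: solvency_generators_def)

lemma dual_dual_solvency_cone: "dual_cone (dual_cone (solvency_cone \<pi>)) = solvency_cone \<pi>"
  by (rule dual_cone_dual_cone[OF convex_cone_solvency_cone closed_solvency_cone])

lemma axis_in_solvency_cone: "axis i 1 \<in> solvency_cone \<pi>"
  unfolding solvency_cone_eq by (rule hull_inc) (simp add: solvency_generators_def)

lemma exchange_in_solvency_cone: "(\<pi> $ i $ j) *\<^sub>R axis i 1 - axis j 1 \<in> solvency_cone \<pi>"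
  unfolding solvency_cone_eq
  by (rule hull_inc) (auto simp: solvency_generators_def intro!: image_eqI[of _ _ "(i, j)"])

lemma solvency_cone_subsetI:
  assumes "convex_cone Q" "\<And>i. axis i 1 \<in> Q" "\<And>i j. (\<pi> $ i $ j) *\<^sub>R axis i 1 - axis j 1 \<in> Q"
  shows "solvency_cone \<pi> \<subseteq> Q"
  unfolding solvency_cone_eq
  by (rule hull_minimal) (use assms in \<open>auto simp: solvency_generators_def\<close>)

section \<open>Dual vectors as consistent price systems\<close>

lemma axis_inner: "axis i 1 \<bullet> y = y $ i" for y :: "real ^ 'd"
  by (simp add: inner_axis inner_commute)

lemma dual_solvency_cone_iff:
  "y \<in> dual_cone (solvency_cone \<pi>) \<longleftrightarrow> (\<forall>i. 0 \<le> y $ i) \<and> (\<forall>i j. y $ j \<le> \<pi> $ i $ j * y $ i)"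
proof -
  have "y \<in> dual_cone (solvency_cone \<pi>) \<longleftrightarrow> y \<in> dual_cone (solvency_generators \<pi>)"
    by (simp add: solvency_cone_eq dual_cone_hull)
  also have "\<dots> \<longleftrightarrow> (\<forall>i. 0 \<le> y $ i) \<and> (\<forall>i j. y $ j \<le> \<pi> $ i $ j * y $ i)"
    by (auto simp: dual_cone_def solvency_generators_def ball_Un inner_diff_left axis_inner)
  finally show ?thesis .
qed

lemma dual_solvency_cone_nonneg: "dual_cone (solvency_cone \<pi>) \<subseteq> nonneg_orthant"
  by (auto simp: dual_solvency_cone_iff nonneg_orthant_def)

lemma borel_measurable_matrix_nth:
  fixes f :: "'w \<Rightarrow> real ^ 'd ^ 'e"
  assumes "f \<in> borel_measurable M" shows "(\<lambda>\<omega>. f \<omega> $ i $ j) \<in> borel_measurable M"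
proof -
  have "(\<lambda>x :: real ^ 'd ^ 'e. x $ i $ j) \<in> borel_measurable borel"
    by (intro borel_measurable_continuous_onI continuous_intros)
  from measurable_compose[OF assms this] show ?thesis .
qed

lemma effros_measurable_dual_solvency_cone:
  fixes \<pi> :: "'w \<Rightarrow> real ^ 'd ^ 'd"
  assumes "\<pi> \<in> borel_measurable H"
  shows "effros_measurable H (\<lambda>\<omega>. dual_cone (solvency_cone (\<pi> \<omega>)))"
proof -
  have [measurable]: "(\<lambda>\<omega>. \<pi> \<omega> $ i $ j) \<in> borel_measurable H" for i j
    by (rule borel_measurable_matrix_nth[OF assms])
  have "effros_measurable H (\<lambda>\<omega>. solvency_generators (\<pi> \<omega>))"
    unfolding effros_measurable_def
  proof (intro allI impI)
    fix V :: "(real ^ 'd) set" assume "open V"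
    then have [measurable]: "V \<in> sets borel" by (rule borel_open)
    have "{\<omega>\<in>space H. solvency_generators (\<pi> \<omega>) \<inter> V \<noteq> {}} =
      {\<omega>\<in>space H. (\<exists>i. axis i 1 \<in> V) \<or> (\<exists>i j. (\<pi> \<omega> $ i $ j) *\<^sub>R axis i 1 - axis j 1 \<in> V)}"
      by (auto simp: solvency_generators_def)
    also have "\<dots> \<in> sets H" by measurable
    finally show "{\<omega>\<in>space H. solvency_generators (\<pi> \<omega>) \<inter> V \<noteq> {}} \<in> sets H" .
  qed
  then have "effros_measurable H (\<lambda>\<omega>. dual_cone (solvency_generators (\<pi> \<omega>)))"
    by (rule effros_measurable_dual_cone) (auto simp: solvency_generators_def)
  then show ?thesis by (simp add: solvency_cone_eq dual_cone_hull)
qed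

lemma effros_measurable_solvency_cone:
  fixes \<pi> :: "'w \<Rightarrow> real ^ 'd ^ 'd"
  assumes "\<pi> \<in> borel_measurable H"
  shows "effros_measurable H (\<lambda>\<omega>. solvency_cone (\<pi> \<omega>))"
proof -
  have "effros_measurable H (\<lambda>\<omega>. dual_cone (dual_cone (solvency_cone (\<pi> \<omega>))))"
    by (rule effros_measurable_dual_cone[OF effros_measurable_dual_solvency_cone[OF assms]])
      (rule convex_cone_nonempty[OF convex_cone_dual_cone])
  then show ?thesis by (simp add: dual_dual_solvency_cone)
qed

lemma bid_ask_matrix_spread:
  assumes "bid_ask_matrix \<pi>"
  shows "1 / \<pi> $ j $ i \<le> \<pi> $ i $ j"
proof -
  have "\<pi> $ i $ i \<le> \<pi> $ i $ j * \<pi> $ j $ i" "\<pi> $ i $ i = 1" "0 < \<pi> $ j $ i"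
    using assms unfolding bid_ask_matrix_def by blast+
  then show ?thesis by (simp add: divide_le_eq)
qed

lemma rel_interior_atLeastAtMost_iff:
  fixes a b r :: real
  assumes "a \<le> b"
  shows "r \<in> rel_interior {a..b} \<longleftrightarrow> (a < r \<and> r < b) \<or> (a = b \<and> r = a)"
proof (cases "a = b")
  case False
  then show ?thesis using assms by (simp add: rel_interior_real_box)
qed auto

text \<open>The rows of \<open>\<pi>\<close> lie in the dual cone by submultiplicativity and serve
  as test vectors: row \<open>i\<close> is positive at \<open>i\<close>, and the exchange of
  \<open>i\<close> for \<open>j\<close> has the value
  \<open>\<pi> $ i $ j * \<pi> $ j $ i - 1\<close> at row \<open>j\<close>. A solvent position that
  vanishes at the relatively interior \<open>y\<close> also vanishes at the rows, so equality in a
  price bound forces a degenerate spread.\<close>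

lemma rel_interior_dual_solvency_cone:
  assumes \<pi>: "bid_ask_matrix \<pi>" and y: "y \<in> rel_interior (dual_cone (solvency_cone \<pi>))"
  shows "0 < y $ i" and "y $ j / y $ i \<in> rel_interior {1 / \<pi> $ j $ i .. \<pi> $ i $ j}"
proof -
  have y': "y \<in> dual_cone (solvency_cone \<pi>)"
    and ri: "\<And>\<eta> v. \<eta> \<in> solvency_cone \<pi> \<Longrightarrow> \<eta> \<bullet> y = 0 \<Longrightarrow> v \<in> dual_cone (solvency_cone \<pi>) \<Longrightarrow> \<eta> \<bullet> v = 0"
    using y unfolding rel_interior_convex_cone_iff[OF convex_cone_dual_cone] dual_dual_solvency_cone by auto
  have p: "0 < \<pi> $ i $ j" "\<pi> $ i $ i = 1" for i j using \<pi> by (auto simp: bid_ask_matrix_def)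
  have row: "\<pi> $ k \<in> dual_cone (solvency_cone \<pi>)" for k
    unfolding dual_solvency_cone_iff
  proof (intro conjI allI)
    show "0 \<le> \<pi> $ k $ i" for i using p(1) by (simp add: less_imp_le)
    show "\<pi> $ k $ j \<le> \<pi> $ i $ j * \<pi> $ k $ i" for i j
      using \<pi> unfolding bid_ask_matrix_def by (metis mult.commute)
  qed
  have y0: "0 < y $ i" for i
  proof -
    have "y $ i \<noteq> 0" using ri[OF axis_in_solvency_cone[of i] _ row[of i]] p by (auto simp: axis_inner)
    then show ?thesis using y' by (simp add: dual_solvency_cone_iff order_less_le)
  qed
  then show "0 < y $ i" .
  have le: "y $ j \<le> \<pi> $ i $ j * y $ i" for i j using y' by (simp add: dual_solvency_cone_iff)
  have eq: "\<pi> $ i $ j * \<pi> $ j $ i = 1" if "y $ j = \<pi> $ i $ j * y $ i" for i j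
    using ri[OF exchange_in_solvency_cone[of \<pi> i j] _ row[of j]] that p(2)[of j]
    by (simp add: inner_diff_left axis_inner)
  have sp: "1 / \<pi> $ j $ i \<le> \<pi> $ i $ j" by (rule bid_ask_matrix_spread[OF \<pi>])
  show "y $ j / y $ i \<in> rel_interior {1 / \<pi> $ j $ i .. \<pi> $ i $ j}"
  proof (cases "\<pi> $ i $ j * \<pi> $ j $ i = 1")
    case True
    then have d: "\<pi> $ i $ j = 1 / \<pi> $ j $ i" using p(1)[of j i] by (simp add: field_simps)
    have "y $ j \<le> \<pi> $ i $ j * y $ i" by (rule le)
    moreover have "\<pi> $ i $ j * y $ i \<le> y $ j"
      using le[of i j] p(1)[of j i] unfolding d by (simp add: divide_le_eq mult.commute)
    ultimately have "y $ j / y $ i = \<pi> $ i $ j" using y0[of i] by (simp add: field_simps)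
    then show ?thesis unfolding rel_interior_atLeastAtMost_iff[OF sp] using d by auto
  next
    case False
    then have "y $ j < \<pi> $ i $ j * y $ i" "y $ i < \<pi> $ j $ i * y $ j"
      using le[of j i] le[of i j] eq[of j i] eq[of i j] by (auto simp: order_less_le mult.commute)
    then show ?thesis unfolding rel_interior_atLeastAtMost_iff[OF sp]
      using y0[of i] p(1)[of j i] by (auto simp: field_simps)
  qed
qed

text \<open>An exchange generator for \<open>\<pi>\<close> is the one for \<open>\<rho>\<close> plus
  a nonnegative multiple of a basis vector, the surplus paid at the worse price.\<close>

lemma solvency_cone_mono:
  assumes \<rho>: "bid_ask_matrix \<rho>"
    and sub: "\<And>i j. {1 / \<rho> $ j $ i .. \<rho> $ i $ j} \<subseteq> rel_interior {1 / \<pi> $ j $ i .. \<pi> $ i $ j}"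
  shows "solvency_cone \<pi> \<subseteq> solvency_cone \<rho>"
proof (rule solvency_cone_subsetI[OF convex_cone_solvency_cone axis_in_solvency_cone])
  fix i j
  have "\<rho> $ i $ j \<in> {1 / \<rho> $ j $ i .. \<rho> $ i $ j}" using bid_ask_matrix_spread[OF \<rho>] by simp
  then have "\<rho> $ i $ j \<in> {1 / \<pi> $ j $ i .. \<pi> $ i $ j}" using sub rel_interior_subset by blast
  then have "((\<rho> $ i $ j) *\<^sub>R axis i 1 - axis j 1) + (\<pi> $ i $ j - \<rho> $ i $ j) *\<^sub>R axis i 1 \<in> solvency_cone \<rho>"
    by (intro convex_cone_add[OF convex_cone_solvency_cone] exchange_in_solvency_cone
        convex_cone_scaleR[OF convex_cone_solvency_cone] axis_in_solvency_cone) simp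
  then show "(\<pi> $ i $ j) *\<^sub>R axis i 1 - axis j 1 \<in> solvency_cone \<rho>" by (simp add: algebra_simps)
qed

text \<open>The property collected in \<open>Q\<close>, to be strictly valued by \<open>y\<close> or
  reversible, is stable under the cone operations, so only generators need checking. An exchange is
  reversible if its spread is degenerate; otherwise \<open>y\<close>, being consistent with the
  tighter spreads, prices it strictly inside the original spread.\<close>

lemma solvency_cone_strictly_positive:
  assumes \<pi>: "bid_ask_matrix \<pi>" and \<rho>: "bid_ask_matrix \<rho>"
    and sub: "\<And>i j. {1 / \<rho> $ j $ i .. \<rho> $ i $ j} \<subseteq> rel_interior {1 / \<pi> $ j $ i .. \<pi> $ i $ j}"
    and y: "y \<in> dual_cone (solvency_cone \<rho>)" "y \<noteq> 0"
    and x: "x \<in> solvency_cone \<pi>" "- x \<notin> solvency_cone \<pi>"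
  shows "0 < x \<bullet> y"
proof -
  let ?K = "solvency_cone \<pi>"
  have p: "0 < \<pi> $ i $ j" "0 < \<rho> $ i $ j" for i j using \<pi> \<rho> by (auto simp: bid_ask_matrix_def)
  have le: "y $ j \<le> \<rho> $ i $ j * y $ i" and yn: "0 \<le> y $ i" for i j
    using y(1) by (auto simp: dual_solvency_cone_iff)
  obtain k where "y $ k \<noteq> 0" using y(2) by (auto simp: vec_eq_iff)
  then have yk: "0 < y $ k" using yn[of k] by simp
  have y0: "0 < y $ i" for i
  proof -
    have "0 < \<rho> $ i $ k * y $ i" using le[of k i] yk by linarith
    then show ?thesis using p(2)[of i k] by (simp add: zero_less_mult_iff)
  qed
  have y\<pi>: "y \<in> dual_cone ?K"
    using y(1) dual_cone_antimono[OF solvency_cone_mono[OF \<rho> sub]] by blast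
  define Q where "Q = {x \<in> ?K. 0 < x \<bullet> y} \<union> {x \<in> ?K. - x \<in> ?K}"
  note cK = convex_cone_solvency_cone[of \<pi>]
  have "convex_cone Q"
    unfolding convex_cone_iff
  proof (intro conjI ballI allI impI)
    show "0 \<in> Q" using convex_cone_contains_0[OF cK] by (simp add: Q_def)
    show "u + v \<in> Q" if u: "u \<in> Q" and v: "v \<in> Q" for u v
    proof -
      have uvK: "u \<in> ?K" "v \<in> ?K" using u v by (auto simp: Q_def)
      then have uv: "u + v \<in> ?K" by (rule convex_cone_add[OF cK])
      show ?thesis
      proof (cases "- u \<in> ?K \<and> - v \<in> ?K")
        case True
        then have "- u + - v \<in> ?K" by (intro convex_cone_add[OF cK]) auto
        then show ?thesis using uv by (simp add: Q_def)
      next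
        case False
        then have "0 < u \<bullet> y \<or> 0 < v \<bullet> y" using u v by (auto simp: Q_def)
        then have "0 < (u + v) \<bullet> y"
          using dual_coneD[OF y\<pi> uvK(1)] dual_coneD[OF y\<pi> uvK(2)] by (auto simp: inner_add_left)
        then show ?thesis using uv by (simp add: Q_def)
      qed
    qed
    show "c *\<^sub>R u \<in> Q" if u: "u \<in> Q" and c: "0 \<le> c" for u c
    proof -
      have cu: "c *\<^sub>R u \<in> ?K" using u c by (intro convex_cone_scaleR[OF cK]) (auto simp: Q_def)
      show ?thesis
      proof (cases "- u \<in> ?K")
        case True
        then have "c *\<^sub>R (- u) \<in> ?K" using c by (intro convex_cone_scaleR[OF cK])
        then show ?thesis using cu by (simp add: Q_def)
      next
        case False
        then have "0 < u \<bullet> y" using u by (auto simp: Q_def)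
        then show ?thesis
          using cu c convex_cone_contains_0[OF cK] by (cases "c = 0") (auto simp: Q_def)
      qed
    qed
  qed
  moreover have "axis i 1 \<in> Q" for i
    using axis_in_solvency_cone[of i \<pi>] y0 by (simp add: Q_def axis_inner)
  moreover have "(\<pi> $ i $ j) *\<^sub>R axis i 1 - axis j 1 \<in> Q" for i j
  proof -
    let ?g = "(\<pi> $ i $ j) *\<^sub>R axis i 1 - axis j 1 :: real ^ 'a"
    have gK: "?g \<in> ?K" by (rule exchange_in_solvency_cone)
    have "1 / \<rho> $ j $ i \<le> y $ j / y $ i" "y $ j / y $ i \<le> \<rho> $ i $ j"
      using le[of i j] le[of j i] y0 p by (auto simp: field_simps)
    then have "y $ j / y $ i \<in> rel_interior {1 / \<pi> $ j $ i .. \<pi> $ i $ j}" using sub[of j i] by auto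
    then consider "y $ j / y $ i < \<pi> $ i $ j" | "1 / \<pi> $ j $ i = \<pi> $ i $ j"
      unfolding rel_interior_atLeastAtMost_iff[OF bid_ask_matrix_spread[OF \<pi>]] by blast
    then show ?thesis
    proof cases
      case 1
      then have "0 < ?g \<bullet> y" using y0[of i] by (simp add: inner_diff_left axis_inner field_simps)
      then show ?thesis using gK by (simp add: Q_def)
    next
      case 2
      then have "\<pi> $ i $ j * \<pi> $ j $ i = 1" using p(1)[of j i] by (simp add: field_simps)
      then have "(\<pi> $ i $ j) *\<^sub>R ((\<pi> $ j $ i) *\<^sub>R axis j 1 - axis i 1) = - ?g"
        by (simp add: scaleR_diff_right)
      moreover have "(\<pi> $ i $ j) *\<^sub>R ((\<pi> $ j $ i) *\<^sub>R axis j 1 - axis i 1) \<in> ?K"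
        using p(1)[of i j] by (intro convex_cone_scaleR[OF cK] exchange_in_solvency_cone) simp
      ultimately have "- ?g \<in> ?K" by simp
      then show ?thesis using gK unfolding Q_def by blast
    qed
  qed
  ultimately have "?K \<subseteq> Q" by (rule solvency_cone_subsetI)
  then show ?thesis using x by (auto simp: Q_def)
qed

text \<open>Strict positivity at nonzero dual vectors becomes uniform on the compact set of those of
  norm 1. Hence a small multiple of \<open>e\<close> can be subtracted without leaving the
  bidual.\<close>

lemma solvency_cone_interior_point:
  fixes e :: "real ^ 'd"
  assumes "bid_ask_matrix \<pi>" "bid_ask_matrix \<rho>"
    "\<And>i j. {1 / \<rho> $ j $ i .. \<rho> $ i $ j} \<subseteq> rel_interior {1 / \<pi> $ j $ i .. \<pi> $ i $ j}"
    and x: "x \<in> solvency_cone \<pi>" "- x \<notin> solvency_cone \<pi>" and e: "norm e \<le> 1"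
  shows "\<exists>n::nat. x - (1 / real (Suc n)) *\<^sub>R e \<in> solvency_cone \<rho>"
proof -
  let ?D = "dual_cone (solvency_cone \<rho>)"
  have pos: "0 < x \<bullet> y" if "y \<in> ?D" "y \<noteq> 0" for y
    by (rule solvency_cone_strictly_positive[OF assms(1-3) that x])
  have "\<exists>\<delta>>0. \<forall>y\<in>?D \<inter> sphere 0 1. \<delta> \<le> x \<bullet> y"
  proof (cases "?D \<inter> sphere 0 1 = {}")
    case True
    then show ?thesis by (intro exI[of _ 1]) auto
  next
    case False
    have "compact (?D \<inter> sphere 0 1)" by (rule closed_Int_compact[OF closed_dual_cone compact_sphere])
    moreover have "continuous_on (?D \<inter> sphere 0 1) (\<lambda>y. x \<bullet> y)" by (intro continuous_intros)
    ultimately obtain y where y: "y \<in> ?D \<inter> sphere 0 1" "\<forall>v\<in>?D \<inter> sphere 0 1. x \<bullet> y \<le> x \<bullet> v"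
      using continuous_attains_inf[OF _ False] by metis
    then have "0 < x \<bullet> y" by (intro pos) auto
    then show ?thesis using y(2) by blast
  qed
  then obtain \<delta> where \<delta>: "0 < \<delta>" "\<forall>y\<in>?D \<inter> sphere 0 1. \<delta> \<le> x \<bullet> y" by blast
  obtain n where n: "1 / real (Suc n) < \<delta>" using nat_approx_posE[OF \<delta>(1)] by blast
  let ?v = "x - (1 / real (Suc n)) *\<^sub>R e"
  have "?v \<in> dual_cone ?D"
  proof (rule dual_coneI)
    fix y assume y: "y \<in> ?D"
    show "0 \<le> y \<bullet> ?v"
    proof (cases "y = 0")
      case False
      define u where "u = (1 / norm y) *\<^sub>R y"
      have u: "u \<in> ?D" unfolding u_def using y by (intro convex_cone_scaleR[OF convex_cone_dual_cone]) auto
      have nu: "norm u = 1" using False by (simp add: u_def)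
      have "e \<bullet> u \<le> norm e * norm u" by (rule norm_cauchy_schwarz)
      then have "e \<bullet> u \<le> 1" using e nu by simp
      then have "(1 / real (Suc n)) * (e \<bullet> u) \<le> (1 / real (Suc n)) * 1" by (intro mult_left_mono) auto
      moreover have "\<delta> \<le> x \<bullet> u" using \<delta>(2) u nu by simp
      ultimately have "0 \<le> ?v \<bullet> u" using n by (simp add: inner_diff_left)
      moreover have "y = norm y *\<^sub>R u" using False by (simp add: u_def)
      then have "?v \<bullet> y = norm y * (?v \<bullet> u)" by (metis inner_scaleR_right)
      ultimately show ?thesis by (simp add: inner_commute[of y])
    qed simp
  qed
  then show ?thesis unfolding dual_dual_solvency_cone by blast
qed

section \<open>From a strictly consistent martingale to robust no-arbitrage\<close>

lemma complete_filtrationD: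
  assumes "complete_filtration M F T"
  shows "complete_measure M" "\<And>t. t \<le> T \<Longrightarrow> subalgebra M (F t)" "\<And>t. t \<le> T \<Longrightarrow> null_sets M \<subseteq> sets (F t)"
    "\<And>s t. s \<le> t \<Longrightarrow> t \<le> T \<Longrightarrow> subalgebra (F t) (F s)"
proof -
  have 1: "\<And>t. t \<le> T \<Longrightarrow> subalgebra M (F t)" using assms by (auto simp: complete_filtration_def)
  show "complete_measure M" "\<And>t. t \<le> T \<Longrightarrow> subalgebra M (F t)" "\<And>t. t \<le> T \<Longrightarrow> null_sets M \<subseteq> sets (F t)"
    using assms by (auto simp: complete_filtration_def)
  show "subalgebra (F t) (F s)" if "s \<le> t" "t \<le> T" for s t
    using 1[of s] 1[of t] that assms by (auto simp: complete_filtration_def subalgebra_def)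
qed

text \<open>Truncating to \<open>{|v| \<le> n}\<close> makes the martingale property applicable to an unbounded
  position \<open>v\<close>.\<close>

lemma martingale_increment:
  fixes Zs Zt v :: "'w \<Rightarrow> real ^ 'd"
  assumes M: "prob_space M" and H: "subalgebra M H"
    and int: "integrable M Zs" and mg: "\<And>i. AE \<omega> in M. real_cond_exp M H (\<lambda>\<omega>. Zs \<omega> $ i) \<omega> = Zt \<omega> $ i"
    and v: "v \<in> borel_measurable H" and nn: "AE \<omega> in M. 0 \<le> Zs \<omega> \<bullet> v \<omega>"
  shows "AE \<omega> in M. 0 \<le> Zt \<omega> \<bullet> v \<omega>"
    and "AE \<omega> in M. Zt \<omega> \<bullet> v \<omega> = 0 \<Longrightarrow> AE \<omega> in M. Zs \<omega> \<bullet> v \<omega> = 0"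
proof -
  interpret prob_space M by fact
  interpret finite_measure_subalgebra M H by unfold_locales (rule H)
  have [measurable]: "Zs \<in> borel_measurable M" using int by simp
  have vM[measurable]: "v \<in> borel_measurable M" by (rule measurable_from_subalg[OF H v])
  define e where "e n \<omega> = (if norm (v \<omega>) \<le> real n then v \<omega> else 0)" for n :: nat and \<omega>
  have eH[measurable]: "e n \<in> borel_measurable H" for n unfolding e_def[abs_def] using v by measurable
  have eM[measurable]: "e n \<in> borel_measurable M" for n unfolding e_def[abs_def] by measurable
  have en: "\<bar>e n \<omega> $ i\<bar> \<le> real n" for n \<omega> i
    using component_le_norm_cart[of "v \<omega>" i] by (auto simp: e_def)
  have intZ: "integrable M (\<lambda>\<omega>. Zs \<omega> $ i)" for i
    using integrable_inner_left[OF int, of "axis i 1"] by (simp add: inner_axis)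
  have inte: "integrable M (\<lambda>\<omega>. e n \<omega> $ i * Zs \<omega> $ i)" for n i
  proof (rule Bochner_Integration.integrable_bound)
    show "integrable M (\<lambda>\<omega>. real n * Zs \<omega> $ i)" using intZ by simp
    show "AE \<omega> in M. norm (e n \<omega> $ i * Zs \<omega> $ i) \<le> norm (real n * Zs \<omega> $ i)"
      using en by (intro AE_I2) (simp add: abs_mult mult_right_mono)
  qed measurable
  have ip: "a \<bullet> b = (\<Sum>i\<in>UNIV. b $ i * a $ i)" for a b :: "real ^ 'd"
    by (simp add: inner_vec_def mult.commute)
  have ce: "AE \<omega> in M. real_cond_exp M H (\<lambda>\<omega>. Zs \<omega> \<bullet> e n \<omega>) \<omega> = Zt \<omega> \<bullet> e n \<omega>" for n
  proof -
    have "AE \<omega> in M. \<forall>i. real_cond_exp M H (\<lambda>\<omega>. e n \<omega> $ i * Zs \<omega> $ i) \<omega> = e n \<omega> $ i * real_cond_exp M H (\<lambda>\<omega>. Zs \<omega> $ i) \<omega>"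
      unfolding AE_all_countable by (intro allI real_cond_exp_mult inte) measurable
    moreover have "AE \<omega> in M. \<forall>i. real_cond_exp M H (\<lambda>\<omega>. Zs \<omega> $ i) \<omega> = Zt \<omega> $ i"
      unfolding AE_all_countable using mg by blast
    moreover have "AE \<omega> in M. real_cond_exp M H (\<lambda>\<omega>. \<Sum>i\<in>UNIV. e n \<omega> $ i * Zs \<omega> $ i) \<omega> =
        (\<Sum>i\<in>UNIV. real_cond_exp M H (\<lambda>\<omega>. e n \<omega> $ i * Zs \<omega> $ i) \<omega>)"
      by (rule real_cond_exp_sum[OF inte])
    ultimately show ?thesis unfolding ip by eventually_elim simp
  qed
  have nne: "AE \<omega> in M. 0 \<le> Zs \<omega> \<bullet> e n \<omega>" for n
    using nn by eventually_elim (simp add: e_def)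
  have intn: "integrable M (\<lambda>\<omega>. Zs \<omega> \<bullet> e n \<omega>)" for n
    unfolding ip by (intro Bochner_Integration.integrable_sum inte)
  have ex: "\<exists>n. e n \<omega> = v \<omega>" for \<omega>
    using real_arch_simple[of "norm (v \<omega>)"] by (auto simp: e_def)
  have "AE \<omega> in M. \<forall>n. 0 \<le> Zt \<omega> \<bullet> e n \<omega>"
    unfolding AE_all_countable
  proof
    fix n
    have "AE \<omega> in M. 0 \<le> real_cond_exp M H (\<lambda>\<omega>. Zs \<omega> \<bullet> e n \<omega>) \<omega>"
      by (rule real_cond_exp_pos[OF nne]) measurable
    then show "AE \<omega> in M. 0 \<le> Zt \<omega> \<bullet> e n \<omega>" using ce[of n] by eventually_elim simp
  qed
  then show "AE \<omega> in M. 0 \<le> Zt \<omega> \<bullet> v \<omega>"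
    by eventually_elim (use ex in metis)
  assume z: "AE \<omega> in M. Zt \<omega> \<bullet> v \<omega> = 0"
  have "AE \<omega> in M. \<forall>n. Zs \<omega> \<bullet> e n \<omega> = 0"
    unfolding AE_all_countable
  proof
    fix n
    have "(\<integral>\<omega>. Zs \<omega> \<bullet> e n \<omega> \<partial>M) = (\<integral>\<omega>. real_cond_exp M H (\<lambda>\<omega>. Zs \<omega> \<bullet> e n \<omega>) \<omega> \<partial>M)"
      by (rule real_cond_exp_int(2)[OF intn, symmetric])
    also have "\<dots> = (\<integral>\<omega>. 0 \<partial>M)"
    proof (rule integral_cong_AE)
      show "AE \<omega> in M. real_cond_exp M H (\<lambda>\<omega>. Zs \<omega> \<bullet> e n \<omega>) \<omega> = 0"
        using ce[of n] z by eventually_elim (auto simp: e_def)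
    qed measurable
    finally show "AE \<omega> in M. Zs \<omega> \<bullet> e n \<omega> = 0"
      using integral_nonneg_eq_0_iff_AE[OF intn nne] by simp
  qed
  then show "AE \<omega> in M. Zs \<omega> \<bullet> v \<omega> = 0"
    by eventually_elim (use ex in metis)
qed

lemma martingale_transform_vanishes:
  fixes Z x :: "nat \<Rightarrow> 'w \<Rightarrow> real ^ 'd"
  assumes M: "prob_space M" and F: "complete_filtration M F T" and Z: "martingale M F T Z"
    and x: "\<And>t. t \<le> T \<Longrightarrow> x t \<in> borel_measurable (F t)"
    and neg: "\<And>t. t \<le> T \<Longrightarrow> AE \<omega> in M. Z t \<omega> \<bullet> x t \<omega> \<le> 0"
    and fin: "AE \<omega> in M. 0 \<le> Z T \<omega> \<bullet> (\<Sum>t\<le>T. x t \<omega>)"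
  shows "AE \<omega> in M. Z T \<omega> \<bullet> (\<Sum>t\<le>T. x t \<omega>) = 0"
proof -
  note sub = complete_filtrationD(2)[OF F] and nest = complete_filtrationD(4)[OF F]
  define S where "S t \<omega> = (\<Sum>j\<le>t. x j \<omega>)" for t \<omega>
  have SS: "S (Suc t) \<omega> = S t \<omega> + x (Suc t) \<omega>" for t \<omega> by (simp add: S_def)
  have Sm: "S t \<in> borel_measurable (F t)" if "t \<le> T" for t
    unfolding S_def[abs_def]
  proof (rule borel_measurable_sum)
    fix j assume "j \<in> {..t}"
    then show "x j \<in> borel_measurable (F t)"
      using that by (intro measurable_from_subalg[OF nest x]) auto
  qed
  have Zi: "integrable M (Z t)" if "t \<le> T" for t using Z that by (auto simp: martingale_def)
  have mg: "AE \<omega> in M. real_cond_exp M (F t) (\<lambda>\<omega>. Z (Suc t) \<omega> $ i) \<omega> = Z t \<omega> $ i" if "Suc t \<le> T" for t i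
    using Z that unfolding martingale_def by (metis le_Suc_eq order_refl)
  \<comment> \<open>The latest trade has nonpositive value under \<open>Z (Suc t)\<close>, so
    removing it does not lower the value of the position.\<close>
  have prev: "AE \<omega> in M. 0 \<le> Z (Suc t) \<omega> \<bullet> S t \<omega>"
    if "Suc t \<le> T" "AE \<omega> in M. 0 \<le> Z (Suc t) \<omega> \<bullet> S (Suc t) \<omega>" for t
    using that(2) neg[OF that(1)] by eventually_elim (simp add: SS inner_add_right)
  have pos: "AE \<omega> in M. 0 \<le> Z t \<omega> \<bullet> S t \<omega>" if "t \<le> T" for t
    using that
  proof (induction rule: inc_induct)
    case base
    then show ?case using fin by (simp add: S_def)
  next
    case (step n)
    have n: "Suc n \<le> T" "n \<le> T" using step by auto
    show ?case
      by (rule martingale_increment(1)[OF M sub[OF n(2)] Zi[OF n(1)] mg[OF n(1)] Sm[OF n(2)] prev[OF n(1) step.IH]])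
  qed
  \<comment> \<open>At time 0 the position is the trade \<open>x 0\<close> itself, of nonpositive
    value. Later, the martingale property makes the value before the trade 0 and the trade cannot
    raise it, so nonnegativity leaves only 0.\<close>
  have zero: "AE \<omega> in M. Z t \<omega> \<bullet> S t \<omega> = 0" if "t \<le> T" for t
    using that
  proof (induction t)
    case 0
    show ?case using pos[OF 0] neg[OF 0] by eventually_elim (simp add: S_def)
  next
    case (Suc t)
    have n: "Suc t \<le> T" "t \<le> T" using Suc by auto
    have "AE \<omega> in M. Z (Suc t) \<omega> \<bullet> S t \<omega> = 0"
      by (rule martingale_increment(2)[OF M sub[OF n(2)] Zi[OF n(1)] mg[OF n(1)] Sm[OF n(2)]
            prev[OF n(1) pos[OF n(1)]] Suc.IH[OF n(2)]])
    then show ?case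
      using pos[OF n(1)] neg[OF n(1)] by eventually_elim (simp add: SS inner_add_right)
  qed
  show ?thesis using zero[OF order_refl] by (simp add: S_def)
qed

lemma frictionless_bid_ask:
  fixes y :: "real ^ 'd"
  assumes y: "\<And>i. 0 < y $ i"
  shows "bid_ask_matrix (\<chi> i j. y $ j / y $ i)" and "y \<in> dual_cone (solvency_cone (\<chi> i j. y $ j / y $ i))"
  using y less_imp_neq[OF y] by (auto simp: bid_ask_matrix_def dual_solvency_cone_iff less_imp_le)

lemma consistent_martingale_imp_robust_no_arbitrage:
  fixes \<pi> :: "nat \<Rightarrow> 'w \<Rightarrow> real ^ 'd ^ 'd"
  assumes M: "prob_space M" and F: "complete_filtration M F T" and \<pi>: "bid_ask_process M F T \<pi>"
    and Z: "martingale M F T Z"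
    and ZK: "\<forall>t\<le>T. Z t \<in> L0 M (F t) (\<lambda>\<omega>. rel_interior (dual_cone (solvency_cone (\<pi> t \<omega>))))"
  shows "robust_no_arbitrage M F T \<pi>"
proof -
  let ?R = "\<lambda>t \<omega>. rel_interior (dual_cone (solvency_cone (\<pi> t \<omega>)))"
  note sub = complete_filtrationD(2)[OF F] and nest = complete_filtrationD(4)[OF F]
    and null = complete_filtrationD(3)[OF F]
  \<comment> \<open>Robust no-arbitrage asks for a bid-ask matrix at every \<omega>, whereas
    \<open>Z\<close> is strictly consistent only almost surely. The change on a null set stays
    measurable by completeness.\<close>
  define Z' where "Z' t \<omega> = (if Z t \<omega> \<in> ?R t \<omega> then Z t \<omega> else (SOME y. y \<in> ?R t \<omega>))" for t \<omega>
  have Z'R: "Z' t \<omega> \<in> ?R t \<omega>" for t \<omega>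
  proof -
    have "?R t \<omega> \<noteq> {}"
      using rel_interior_eq_empty convex_cone_dual_cone[of "solvency_cone (\<pi> t \<omega>)"] by (auto simp: convex_cone_def)
    then have "(SOME y. y \<in> ?R t \<omega>) \<in> ?R t \<omega>" by (rule some_in_eq[THEN iffD2])
    then show ?thesis by (simp add: Z'_def)
  qed
  have Z'Z: "AE \<omega> in M. Z' t \<omega> = Z t \<omega>" if "t \<le> T" for t
  proof -
    have "AE \<omega> in M. Z t \<omega> \<in> ?R t \<omega>" using ZK that by (auto simp: L0_def)
    then show ?thesis by eventually_elim (simp add: Z'_def)
  qed
  have Z'm: "Z' t \<in> borel_measurable (F t)" if "t \<le> T" for t
    by (rule borel_measurable_complete_AE_cong[OF complete_filtrationD(1)[OF F] sub[OF that] null[OF that] _ Z'Z[OF that]])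
      (use ZK that in \<open>auto simp: L0_def\<close>)
  have ba: "bid_ask_matrix (\<pi> t \<omega>)" if "t \<le> T" "\<omega> \<in> space M" for t \<omega>
    using \<pi> that by (auto simp: bid_ask_process_def)
  have Z'pos: "0 < Z' t \<omega> $ i" if "t \<le> T" "\<omega> \<in> space M" for t \<omega> i
    by (rule rel_interior_dual_solvency_cone(1)[OF ba[OF that] Z'R])
  define \<rho> where "\<rho> t \<omega> = (\<chi> i j. Z' t \<omega> $ j / Z' t \<omega> $ i)" for t \<omega>
  have \<rho>m: "\<rho> t \<in> borel_measurable (F t)" if "t \<le> T" for t
  proof -
    have [measurable]: "Z' t \<in> borel_measurable (F t)" by (rule Z'm[OF that])
    show ?thesis
      unfolding borel_measurable_euclidean_space[of "\<rho> t"]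
    proof
      fix b :: "real ^ 'd ^ 'd" assume "b \<in> Basis"
      then obtain i j where b: "b = axis i (axis j 1)" by (auto simp: Basis_vec_def)
      have "\<rho> t \<omega> \<bullet> b = Z' t \<omega> $ j / Z' t \<omega> $ i" for \<omega>
        unfolding b inner_axis \<rho>_def by simp
      moreover have "(\<lambda>\<omega>. Z' t \<omega> $ j / Z' t \<omega> $ i) \<in> borel_measurable (F t)" by measurable
      ultimately show "(\<lambda>\<omega>. \<rho> t \<omega> \<bullet> b) \<in> borel_measurable (F t)" by simp
    qed
  qed
  have \<rho>ba: "bid_ask_matrix (\<rho> t \<omega>)" and Z'\<rho>: "Z' t \<omega> \<in> dual_cone (solvency_cone (\<rho> t \<omega>))"
    if "t \<le> T" "\<omega> \<in> space M" for t \<omega>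
    unfolding \<rho>_def by (rule frictionless_bid_ask; rule Z'pos[OF that])+
  have "{1 / \<rho> t \<omega> $ j $ i .. \<rho> t \<omega> $ i $ j} \<subseteq> rel_interior {1 / \<pi> t \<omega> $ j $ i .. \<pi> t \<omega> $ i $ j}"
    if "t \<le> T" "\<omega> \<in> space M" for t \<omega> i j
    using rel_interior_dual_solvency_cone(2)[OF ba[OF that] Z'R, of j i] by (simp add: \<rho>_def)
  moreover have "bid_ask_process M F T \<rho>"
    using \<rho>m \<rho>ba by (auto simp: bid_ask_process_def)
  moreover have "attainable M F \<rho> T \<inter> L0 M (F T) (\<lambda>_. nonneg_orthant) = L0 M (F T) (\<lambda>_. {0})"
  proof (intro equalityI subsetI)
    fix \<xi> assume "\<xi> \<in> attainable M F \<rho> T \<inter> L0 M (F T) (\<lambda>_. nonneg_orthant)"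
    then obtain x where \<xi>: "\<xi> = (\<lambda>\<omega>. \<Sum>j\<le>T. x j \<omega>)" "\<xi> \<in> borel_measurable (F T)" "AE \<omega> in M. \<xi> \<omega> \<in> nonneg_orthant"
      and x: "\<And>j. j \<le> T \<Longrightarrow> x j \<in> borel_measurable (F j)"
        "\<And>j. j \<le> T \<Longrightarrow> AE \<omega> in M. x j \<omega> \<in> uminus ` solvency_cone (\<rho> j \<omega>)"
      by (auto simp: attainable_def L0_def)
    have zpos: "AE \<omega> in M. \<forall>i. 0 < Z T \<omega> $ i"
      using Z'Z[OF order_refl] AE_space by eventually_elim (use Z'pos[OF order_refl] in metis)
    have "AE \<omega> in M. Z T \<omega> \<bullet> (\<Sum>t\<le>T. x t \<omega>) = 0"
    proof (rule martingale_transform_vanishes[OF M F Z x(1)])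
      show "AE \<omega> in M. Z t \<omega> \<bullet> x t \<omega> \<le> 0" if "t \<le> T" for t
        using Z'Z[OF that] x(2)[OF that] AE_space
      proof eventually_elim
        case (elim \<omega>)
        then have "- x t \<omega> \<in> solvency_cone (\<rho> t \<omega>)" by (simp add: mem_uminus_image_iff)
        from dual_coneD[OF Z'\<rho>[OF that elim(3)] this] show ?case using elim(1) by (simp add: inner_commute)
      qed
      show "AE \<omega> in M. 0 \<le> Z T \<omega> \<bullet> (\<Sum>t\<le>T. x t \<omega>)"
        using zpos \<xi>(3) unfolding \<xi>(1)
        by eventually_elim (simp add: inner_vec_def nonneg_orthant_def sum_nonneg less_imp_le)
    qed
    then have "AE \<omega> in M. \<xi> \<omega> = 0"
      using zpos \<xi>(3)
    proof eventually_elim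
      case (elim \<omega>)
      have "(\<Sum>i\<in>UNIV. Z T \<omega> $ i * \<xi> \<omega> $ i) = 0" using elim(1) by (simp add: \<xi>(1) inner_vec_def)
      moreover have "0 \<le> Z T \<omega> $ i * \<xi> \<omega> $ i" for i
        using elim(2,3) by (simp add: nonneg_orthant_def less_imp_le)
      ultimately have "\<forall>i. Z T \<omega> $ i * \<xi> \<omega> $ i = 0" by (simp add: sum_nonneg_eq_0_iff)
      then show ?case using elim(2) by (simp add: vec_eq_iff less_imp_neq[THEN not_sym])
    qed
    then show "\<xi> \<in> L0 M (F T) (\<lambda>_. {0})" using \<xi>(2) by (simp add: L0_def)
  next
    fix \<xi> assume "\<xi> \<in> L0 M (F T) (\<lambda>_. {0::real ^ 'd})"
    then have \<xi>: "\<xi> \<in> borel_measurable (F T)" "AE \<omega> in M. \<xi> \<omega> = 0" by (auto simp: L0_def)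
    \<comment> \<open>Functions that vanish almost surely are not identified with 0, so this
      inclusion needs a strategy that produces \<open>\<xi>\<close> itself; it is traded at the last
      date.\<close>
    define x where "x j = (if j = T then \<xi> else (\<lambda>_. 0))" for j
    have 0: "0 \<in> solvency_cone (\<rho> j \<omega>)" for j \<omega> by (rule convex_cone_contains_0[OF convex_cone_solvency_cone])
    have "x j \<in> L0 M (F j) (\<lambda>\<omega>. uminus ` solvency_cone (\<rho> j \<omega>))" for j
    proof (cases "j = T")
      case True
      have "AE \<omega> in M. \<xi> \<omega> \<in> uminus ` solvency_cone (\<rho> T \<omega>)"
        using \<xi>(2) by eventually_elim (simp add: mem_uminus_image_iff 0)
      then show ?thesis using True \<xi>(1) by (simp add: x_def L0_def)
    next
      case False
      then show ?thesis by (simp add: x_def L0_def mem_uminus_image_iff 0)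
    qed
    moreover have "(\<lambda>\<omega>. \<Sum>j\<le>T. x j \<omega>) = \<xi>"
      by (simp add: fun_eq_iff x_def if_distribR cong: if_cong)
    ultimately have "\<xi> \<in> attainable M F \<rho> T" unfolding attainable_def by (auto intro!: exI[of _ x])
    moreover have "AE \<omega> in M. \<xi> \<omega> \<in> nonneg_orthant"
      using \<xi>(2) by eventually_elim (simp add: nonneg_orthant_def)
    ultimately show "\<xi> \<in> attainable M F \<rho> T \<inter> L0 M (F T) (\<lambda>_. nonneg_orthant)"
      using \<xi>(1) by (simp add: L0_def)
  qed
  ultimately show ?thesis unfolding robust_no_arbitrage_def by blast
qed

section \<open>From robust no-arbitrage to reversibility\<close>

text \<open>On the event \<open>A n\<close> the trade at date \<open>s\<close> is feasible at the
  tighter spreads with \<open>1 / Suc n\<close> units of an asset left over. Releasing these units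
  turns a zero-sum strategy into a nonnegative claim, which robust no-arbitrage forces to be 0, so
  \<open>A n\<close> is null. A trade that is not reversible would put \<omega> into some
  \<open>A n\<close>.\<close>

lemma robust_no_arbitrage_imp_reversible:
  fixes \<pi> :: "nat \<Rightarrow> 'w \<Rightarrow> real ^ 'd ^ 'd"
  assumes M: "prob_space M" and F: "complete_filtration M F T" and \<pi>: "bid_ask_process M F T \<pi>"
    and NA: "robust_no_arbitrage M F T \<pi>"
    and x: "\<forall>t\<le>T. x t \<in> L0 M (F t) (\<lambda>\<omega>. uminus ` solvency_cone (\<pi> t \<omega>))"
    and sum0: "AE \<omega> in M. (\<Sum>t\<le>T. x t \<omega>) = 0" and s: "s \<le> T"
  shows "x s \<in> L0 M (F s) (\<lambda>\<omega>. solvency_cone (\<pi> s \<omega>) \<inter> uminus ` solvency_cone (\<pi> s \<omega>))"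
proof -
  obtain \<rho> where \<rho>: "bid_ask_process M F T \<rho>"
    and sub: "\<And>t \<omega> i j. t \<le> T \<Longrightarrow> \<omega> \<in> space M \<Longrightarrow>
      {1 / \<rho> t \<omega> $ j $ i .. \<rho> t \<omega> $ i $ j} \<subseteq> rel_interior {1 / \<pi> t \<omega> $ j $ i .. \<pi> t \<omega> $ i $ j}"
    and na: "attainable M F \<rho> T \<inter> L0 M (F T) (\<lambda>_. nonneg_orthant) = L0 M (F T) (\<lambda>_. {0})"
    using NA unfolding robust_no_arbitrage_def by blast
  have ba: "bid_ask_matrix (\<pi> t \<omega>)" "bid_ask_matrix (\<rho> t \<omega>)" if "t \<le> T" "\<omega> \<in> space M" for t \<omega>
    using \<pi> \<rho> that by (auto simp: bid_ask_process_def)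
  have xm: "x t \<in> borel_measurable (F t)" and xK: "AE \<omega> in M. - x t \<omega> \<in> solvency_cone (\<pi> t \<omega>)" if "t \<le> T" for t
    using x that by (auto simp: L0_def mem_uminus_image_iff)
  \<comment> \<open>One arbitrary asset serves as the unit of consumption.\<close>
  define e :: "real ^ 'd" where "e = axis undefined 1"
  have e1: "norm e \<le> 1" by (simp add: e_def norm_axis_1)
  define A where "A n = {\<omega>\<in>space (F s). - x s \<omega> - (1 / real (Suc n)) *\<^sub>R e \<in> solvency_cone (\<rho> s \<omega>)}" for n :: nat
  have spF: "space (F s) = space M" using complete_filtrationD(2)[OF F s] by (simp add: subalgebra_def)
  have A: "A n \<in> sets (F s)" for n
    unfolding A_def
  proof (rule sets_Collect_in_multifun)
    show "effros_measurable (F s) (\<lambda>\<omega>. solvency_cone (\<rho> s \<omega>))"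
      using \<rho> s by (intro effros_measurable_solvency_cone) (simp add: bid_ask_process_def)
    show "(\<lambda>\<omega>. - x s \<omega> - (1 / real (Suc n)) *\<^sub>R e) \<in> borel_measurable (F s)"
      using xm[OF s] by measurable
  qed (auto simp: closed_solvency_cone convex_cone_nonempty[OF convex_cone_solvency_cone])
  have "AE \<omega> in M. \<omega> \<notin> A n" for n
  proof -
    define x' where "x' t \<omega> = (if t = s then x s \<omega> + (indicator (A n) \<omega> / real (Suc n)) *\<^sub>R e else x t \<omega>)" for t \<omega>
    have x'L: "x' t \<in> L0 M (F t) (\<lambda>\<omega>. uminus ` solvency_cone (\<rho> t \<omega>))" if t: "t \<le> T" for t
    proof -
      have "x' t \<in> borel_measurable (F t)"
      proof (cases "t = s")
        case True
        have [measurable]: "x s \<in> borel_measurable (F s)" "A n \<in> sets (F s)" using xm[OF s] A by auto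
        show ?thesis unfolding True x'_def[abs_def] by simp
      next
        case False
        then show ?thesis using xm[OF t] by (simp add: x'_def[abs_def])
      qed
      moreover have "AE \<omega> in M. - x' t \<omega> \<in> solvency_cone (\<rho> t \<omega>)"
        using xK[OF t] AE_space
      proof eventually_elim
        case (elim \<omega>)
        have "- x t \<omega> \<in> solvency_cone (\<rho> t \<omega>)"
          using solvency_cone_mono[OF ba(2)[OF t elim(2)] sub[OF t elim(2)]] elim(1) by blast
        then show ?case by (auto simp: x'_def A_def indicator_def algebra_simps)
      qed
      ultimately show ?thesis by (simp add: L0_def mem_uminus_image_iff)
    qed
    define \<xi> where "\<xi> \<omega> = (\<Sum>t\<le>T. x' t \<omega>)" for \<omega>
    have "\<xi> \<in> attainable M F \<rho> T"
      unfolding attainable_def \<xi>_def[abs_def] using x'L by blast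
    moreover have \<xi>: "AE \<omega> in M. \<xi> \<omega> = (indicator (A n) \<omega> / real (Suc n)) *\<^sub>R e"
      using sum0
    proof eventually_elim
      case (elim \<omega>)
      have "x' t \<omega> = x t \<omega> + (if t = s then (indicator (A n) \<omega> / real (Suc n)) *\<^sub>R e else 0)" for t
        by (simp add: x'_def)
      then show ?case using s elim by (simp add: \<xi>_def sum.distrib)
    qed
    moreover have "\<xi> \<in> borel_measurable (F T)"
      unfolding \<xi>_def[abs_def]
    proof (rule borel_measurable_sum)
      fix t assume "t \<in> {..T}"
      then have t: "t \<le> T" by simp
      have "x' t \<in> borel_measurable (F t)" using x'L[OF t] by (simp add: L0_def)
      then show "x' t \<in> borel_measurable (F T)"
        by (rule measurable_from_subalg[OF complete_filtrationD(4)[OF F t order_refl]])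
    qed
    moreover have "AE \<omega> in M. \<xi> \<omega> \<in> nonneg_orthant"
      using \<xi> by eventually_elim (simp add: nonneg_orthant_def e_def axis_def)
    ultimately have "\<xi> \<in> L0 M (F T) (\<lambda>_. {0})" unfolding na[symmetric] by (simp add: L0_def)
    then have "AE \<omega> in M. \<xi> \<omega> = 0" by (simp add: L0_def)
    then show ?thesis
      using \<xi> by eventually_elim (auto simp: indicator_def e_def axis_eq_0_iff)
  qed
  then have "AE \<omega> in M. \<forall>n. \<omega> \<notin> A n" by (simp add: AE_all_countable)
  then have "AE \<omega> in M. x s \<omega> \<in> solvency_cone (\<pi> s \<omega>)"
    using xK[OF s] AE_space
  proof eventually_elim
    case (elim \<omega>)
    show ?case
    proof (rule ccontr)
      assume "x s \<omega> \<notin> solvency_cone (\<pi> s \<omega>)"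
      then have "- (- x s \<omega>) \<notin> solvency_cone (\<pi> s \<omega>)" by simp
      from solvency_cone_interior_point[OF ba[OF s elim(3)] sub[OF s elim(3)] elim(2) this e1]
      obtain n where "- x s \<omega> - (1 / real (Suc n)) *\<^sub>R e \<in> solvency_cone (\<rho> s \<omega>)" ..
      then have "\<omega> \<in> A n" unfolding A_def using elim(3) spF by blast
      then show False using elim(1) by blast
    qed
  qed
  then have "AE \<omega> in M. x s \<omega> \<in> solvency_cone (\<pi> s \<omega>) \<inter> uminus ` solvency_cone (\<pi> s \<omega>)"
    using xK[OF s] by eventually_elim (simp add: mem_uminus_image_iff)
  then show ?thesis using xm[OF s] by (simp add: L0_def)
qed

section \<open>The backward recursion\<close>

lemma closure_rel_interior_Int:
  fixes A B :: "'a::euclidean_space set"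
  assumes "convex A" "convex B" "closed A" "closed B" "rel_interior A \<inter> rel_interior B \<noteq> {}"
  shows "closure (rel_interior A \<inter> rel_interior B) = A \<inter> B"
proof -
  have "closure (rel_interior A \<inter> rel_interior B) = closure (A \<inter> B)"
    using convex_Inter_rel_interior_same_closure[of "{A, B}"] assms by auto
  then show ?thesis using assms(3,4) by (simp add: closure_closed closed_Int)
qed

lemma measurable_selection_AE:
  fixes S :: "'w \<Rightarrow> 'a::polish_space set"
  assumes S: "effros_measurable H S" and cl: "\<And>\<omega>. closed (S \<omega>)" and ne: "AE \<omega> in M. S \<omega> \<noteq> {}"
    and sp: "space H = space M"
  shows "\<exists>f\<in>borel_measurable H. AE \<omega> in M. f \<omega> \<in> S \<omega>"
proof -
  define S' where "S' \<omega> = (if S \<omega> = {} then UNIV else S \<omega>)" for \<omega>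
  have "effros_measurable H S'"
    unfolding effros_measurable_def
  proof (intro allI impI)
    fix V :: "'a set" assume V: "open V"
    have "{\<omega>\<in>space H. S' \<omega> \<inter> V \<noteq> {}} = {\<omega>\<in>space H. S \<omega> \<inter> V \<noteq> {}} \<union>
        (if V \<noteq> {} then space H - {\<omega>\<in>space H. S \<omega> \<inter> UNIV \<noteq> {}} else {})"
      by (auto simp: S'_def)
    also have "\<dots> \<in> sets H" using effros_measurableD[OF S V] effros_measurableD[OF S open_UNIV] by auto
    finally show "{\<omega>\<in>space H. S' \<omega> \<inter> V \<noteq> {}} \<in> sets H" .
  qed
  moreover have "closed (S' \<omega>)" "S' \<omega> \<noteq> {}" for \<omega> by (simp_all add: S'_def cl)
  ultimately have "\<exists>f. f \<in> borel_measurable H \<and> (\<forall>\<omega>\<in>space H. f \<omega> \<in> S' \<omega>)"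
    by (rule measurable_selection) blast
  then obtain f where f: "f \<in> borel_measurable H" "\<forall>\<omega>\<in>space H. f \<omega> \<in> S' \<omega>" by blast
  have "AE \<omega> in M. f \<omega> \<in> S \<omega>"
    using ne AE_space
  proof eventually_elim
    case (elim \<omega>)
    then have "f \<omega> \<in> S' \<omega>" using f(2) sp by simp
    then show ?case using elim(1) by (simp add: S'_def)
  qed
  then show ?thesis using f(1) by blast
qed

lemma W_seq_last: "W_seq M F T \<pi> T \<omega> = dual_cone (solvency_cone (\<pi> T \<omega>))"
  by (simp add: W_seq.simps)

lemma W_seq_step:
  "t < T \<Longrightarrow> W_seq M F T \<pi> t \<omega> = closure (rel_interior (dual_cone (solvency_cone (\<pi> t \<omega>))) \<inter>
     rel_interior (closure (convex hull (cond_upper_support M (F t) (W_seq M F T \<pi> (Suc t)) \<omega>))))"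
  by (subst W_seq.simps) (simp add: Let_def)

lemma closed_W_seq: "t \<le> T \<Longrightarrow> closed (W_seq M F T \<pi> t \<omega>)"
  by (cases "t = T") (simp_all add: W_seq_last W_seq_step closed_dual_cone)

locale bid_ask_market =
  fixes M :: "'w measure" and F :: "nat \<Rightarrow> 'w measure" and T :: nat
    and \<pi> :: "nat \<Rightarrow> 'w \<Rightarrow> real ^ 'd ^ 'd"
  assumes prob: "prob_space M" and filt: "complete_filtration M F T" and bid_ask: "bid_ask_process M F T \<pi>"
begin

abbreviation "K t \<omega> \<equiv> solvency_cone (\<pi> t \<omega>)"
abbreviation "W \<equiv> W_seq M F T \<pi>"

lemmas sub = complete_filtrationD(2)[OF filt]
  and null = complete_filtrationD(3)[OF filt]
  and nest = complete_filtrationD(4)[OF filt]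
  and complete = complete_filtrationD(1)[OF filt]

lemma space_F: "t \<le> T \<Longrightarrow> space (F t) = space M"
  using sub by (simp add: subalgebra_def)

lemma effros_measurable_K: "t \<le> T \<Longrightarrow> effros_measurable (F t) (K t)"
  using bid_ask by (intro effros_measurable_solvency_cone) (simp add: bid_ask_process_def)

lemma effros_measurable_dual_K: "t \<le> T \<Longrightarrow> effros_measurable (F t) (\<lambda>\<omega>. dual_cone (K t \<omega>))"
  using bid_ask by (intro effros_measurable_dual_solvency_cone) (simp add: bid_ask_process_def)

text \<open>The invariant of the backward recursion. The cone property is only almost sure, since
  \<open>W t\<close> may be empty on a null set and depends there on the version of the conditional
  distribution.\<close>

definition regular :: "nat \<Rightarrow> bool" where
  "regular t \<longleftrightarrow> effros_measurable (F t) (W t) \<and> (AE \<omega> in M. convex_cone (W t \<omega>)) \<and>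
     (AE \<omega> in M. W t \<omega> \<subseteq> dual_cone (K t \<omega>))"

text \<open>A version of the hull in the recursion with closed convex conic values at every
  \<omega>. The last clause is its minimality among such measurable maps; together with the
  inclusion before it, this replaces the conditional support in all later arguments.\<close>

definition is_hull :: "nat \<Rightarrow> ('w \<Rightarrow> (real ^ 'd) set) \<Rightarrow> bool" where
  "is_hull t Y \<longleftrightarrow> effros_measurable (F t) Y \<and> (\<forall>\<omega>. closed (Y \<omega>)) \<and> (\<forall>\<omega>. convex_cone (Y \<omega>)) \<and>
     (AE \<omega> in M. W t \<omega> = closure (rel_interior (dual_cone (K t \<omega>)) \<inter> rel_interior (Y \<omega>))) \<and>
     (AE \<omega> in M. W (Suc t) \<omega> \<subseteq> Y \<omega>) \<and>
     (\<forall>G. effros_measurable (F t) G \<longrightarrow> (\<forall>\<omega>. closed (G \<omega>)) \<longrightarrow> (\<forall>\<omega>. convex_cone (G \<omega>)) \<longrightarrow>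
       (AE \<omega> in M. W (Suc t) \<omega> \<subseteq> G \<omega>) \<longrightarrow> (AE \<omega> in M. Y \<omega> \<subseteq> G \<omega>))"

lemma is_hullD:
  assumes "is_hull t Y"
  shows "effros_measurable (F t) Y" "\<And>\<omega>. closed (Y \<omega>)" "\<And>\<omega>. convex_cone (Y \<omega>)"
    "AE \<omega> in M. W t \<omega> = closure (rel_interior (dual_cone (K t \<omega>)) \<inter> rel_interior (Y \<omega>))"
    "AE \<omega> in M. W (Suc t) \<omega> \<subseteq> Y \<omega>"
    "\<And>G. effros_measurable (F t) G \<Longrightarrow> (\<And>\<omega>. closed (G \<omega>)) \<Longrightarrow> (\<And>\<omega>. convex_cone (G \<omega>)) \<Longrightarrow>
       AE \<omega> in M. W (Suc t) \<omega> \<subseteq> G \<omega> \<Longrightarrow> AE \<omega> in M. Y \<omega> \<subseteq> G \<omega>"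
  using assms unfolding is_hull_def by blast+

lemma hull_exists:
  assumes t: "t < T" and reg: "regular (Suc t)"
  shows "\<exists>Y. is_hull t Y"
proof -
  have t': "t \<le> T" "Suc t \<le> T" using t by auto
  have X: "effros_measurable M (W (Suc t))"
    using reg by (intro effros_measurable_subalgebra[OF sub[OF t'(2)]]) (simp add: regular_def)
  have cl: "\<forall>\<omega>\<in>space M. closed (W (Suc t) \<omega>)" by (intro ballI closed_W_seq t'(2))
  have cone: "AE \<omega> in M. convex_cone (W (Suc t) \<omega>)" using reg by (simp add: regular_def)
  show ?thesis
  proof (rule cond_cone_hull[OF prob sub[OF t'(1)] X cl cone])
    fix Y assume Y: "effros_measurable (F t) Y" "\<And>\<omega>. closed (Y \<omega>)" "\<And>\<omega>. convex_cone (Y \<omega>)"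
      and eq: "AE \<omega> in M. closure (convex hull cond_upper_support M (F t) (W (Suc t)) \<omega>) = Y \<omega>"
      and le: "AE \<omega> in M. W (Suc t) \<omega> \<subseteq> Y \<omega>"
      and min: "\<And>G. effros_measurable (F t) G \<Longrightarrow> (\<And>\<omega>. closed (G \<omega>)) \<Longrightarrow> (\<And>\<omega>. convex_cone (G \<omega>)) \<Longrightarrow>
        AE \<omega> in M. W (Suc t) \<omega> \<subseteq> G \<omega> \<Longrightarrow> AE \<omega> in M. Y \<omega> \<subseteq> G \<omega>"
    have "AE \<omega> in M. W t \<omega> = closure (rel_interior (dual_cone (K t \<omega>)) \<inter> rel_interior (Y \<omega>))"
      using eq by eventually_elim (simp add: W_seq_step[OF t])
    then have "is_hull t Y"
      unfolding is_hull_def using Y le min by blast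
    then show ?thesis by blast
  qed
qed

text \<open>A nonempty closure means that the relative interiors meet, and then the closure of their
  intersection is the intersection of the two closed cones.\<close>

lemma is_hull_Int:
  assumes Y: "is_hull t Y" and ne: "AE \<omega> in M. W t \<omega> \<noteq> {}"
  shows "AE \<omega> in M. rel_interior (dual_cone (K t \<omega>)) \<inter> rel_interior (Y \<omega>) \<noteq> {} \<and>
      W t \<omega> = dual_cone (K t \<omega>) \<inter> Y \<omega>"
  using is_hullD(4)[OF Y] ne
proof eventually_elim
  case (elim \<omega>)
  then have m: "rel_interior (dual_cone (K t \<omega>)) \<inter> rel_interior (Y \<omega>) \<noteq> {}" by auto
  have "convex (dual_cone (K t \<omega>))" "convex (Y \<omega>)"
    using convex_cone_dual_cone is_hullD(3)[OF Y] by (auto simp: convex_cone_def)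
  then show ?case
    using closure_rel_interior_Int[OF _ _ closed_dual_cone is_hullD(2)[OF Y] m] m elim by simp
qed

lemma effros_measurable_dual_K_Int:
  assumes "t \<le> T" "is_hull t Y"
  shows "effros_measurable (F t) (\<lambda>\<omega>. dual_cone (K t \<omega>) \<inter> Y \<omega>)"
  by (rule effros_measurable_Int[OF effros_measurable_dual_K[OF assms(1)] _ _ is_hullD(1)[OF assms(2)]])
    (rule closed_dual_cone is_hullD(2)[OF assms(2)] convex_cone_nonempty[OF convex_cone_dual_cone]
      convex_cone_nonempty[OF is_hullD(3)[OF assms(2)]])+

text \<open>Backward induction: nonemptiness makes \<open>W n\<close> almost surely an intersection
  of measurable cones, and completeness carries the measurability over to \<open>W n\<close>
  itself.\<close>

lemma regular_if_nonempty:
  assumes "t \<le> T" "\<And>s. t \<le> s \<Longrightarrow> s \<le> T \<Longrightarrow> AE \<omega> in M. W s \<omega> \<noteq> {}"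
  shows "regular t"
  using assms
proof (induction rule: inc_induct)
  case base
  have "effros_measurable (F T) (W T)"
  proof -
    have "W T = (\<lambda>\<omega>. dual_cone (K T \<omega>))" by (simp add: fun_eq_iff W_seq_last)
    then show ?thesis using effros_measurable_dual_K[OF order_refl] by (simp only:)
  qed
  then show ?case by (simp add: regular_def W_seq_last convex_cone_dual_cone)
next
  case (step n)
  have "regular (Suc n)" by (rule step.IH) (use step.prems in auto)
  then obtain Y where Y: "is_hull n Y" using hull_exists[OF step.hyps(2)] by blast
  have n: "n \<le> T" using step.hyps by simp
  have "AE \<omega> in M. W n \<omega> \<noteq> {}" using step.prems[of n] n by simp
  then have eq: "AE \<omega> in M. W n \<omega> = dual_cone (K n \<omega>) \<inter> Y \<omega>"
    using is_hull_Int[OF Y] by (auto elim: AE_mp)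
  have "effros_measurable (F n) (\<lambda>\<omega>. dual_cone (K n \<omega>) \<inter> Y \<omega>)"
    by (rule effros_measurable_dual_K_Int[OF n Y])
  then have "effros_measurable (F n) (W n)"
    using eq by (rule effros_measurable_complete_AE_cong[OF complete sub[OF n] null[OF n]])
  moreover have cc: "convex_cone (dual_cone (K n \<omega>) \<inter> Y \<omega>)" for \<omega>
    using convex_cone_dual_cone[of "K n \<omega>"] is_hullD(3)[OF Y, of \<omega>] by (simp add: convex_cone_iff)
  have "AE \<omega> in M. convex_cone (W n \<omega>)" using eq by eventually_elim (simp add: cc)
  moreover have "AE \<omega> in M. W n \<omega> \<subseteq> dual_cone (K n \<omega>)" using eq by eventually_elim simp
  ultimately show ?case by (simp add: regular_def)
qed

text \<open>The hyperplane orthogonal to \<open>\<eta>\<close> is an \<open>F t\<close>-measurable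
  closed convex cone, so minimality of the hull applies to it. This pulls a property of
  \<open>W (Suc t)\<close> back to time \<open>t\<close>.\<close>

lemma hull_orthogonal:
  assumes t: "t \<le> T" and Y: "is_hull t Y" and \<eta>: "\<eta> \<in> borel_measurable (F t)"
    and W: "AE \<omega> in M. \<forall>w\<in>W (Suc t) \<omega>. \<eta> \<omega> \<bullet> w = 0"
  shows "AE \<omega> in M. \<forall>y\<in>Y \<omega>. \<eta> \<omega> \<bullet> y = 0"
proof -
  have "AE \<omega> in M. Y \<omega> \<subseteq> {y. \<eta> \<omega> \<bullet> y = 0}"
  proof (rule is_hullD(6)[OF Y])
    show "effros_measurable (F t) (\<lambda>\<omega>. {y. \<eta> \<omega> \<bullet> y = 0})"
    proof (rule effros_measurable_zero_set)
      show "(\<lambda>\<omega>. \<eta> \<omega> \<bullet> y) \<in> borel_measurable (F t)" for y using \<eta> by simp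
      show "continuous_on UNIV (\<lambda>y. \<eta> \<omega> \<bullet> y)" for \<omega> by (intro continuous_intros)
    qed
    show "closed {y. \<eta> \<omega> \<bullet> y = 0}" for \<omega> by (rule closed_hyperplane)
    show "convex_cone {y. \<eta> \<omega> \<bullet> y = 0}" for \<omega> by (simp add: convex_cone_iff inner_simps)
    show "AE \<omega> in M. W (Suc t) \<omega> \<subseteq> {y. \<eta> \<omega> \<bullet> y = 0}" using W by eventually_elim auto
  qed
  then show ?thesis by eventually_elim auto
qed

lemma AE_in_dual_cone_antimono:
  assumes "AE \<omega> in M. \<eta> \<omega> \<in> dual_cone (Y \<omega>)" "AE \<omega> in M. X \<omega> \<subseteq> Y \<omega>"
  shows "AE \<omega> in M. \<eta> \<omega> \<in> dual_cone (X \<omega>)"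
  using assms by eventually_elim (use dual_cone_antimono in blast)

text \<open>The dual cone of \<open>W\<^sub>s = K\<^sub>s\<^sup>* \<inter> Y\<^sub>s\<close> is \<open>K\<^sub>s + Y\<^sub>s\<^sup>*\<close>, so \<open>\<eta>\<close> can be split into trades one date at a time.\<close>

lemma dual_hull_decompose:
  assumes "t < T" "\<And>s. t < s \<Longrightarrow> s \<le> T \<Longrightarrow> AE \<omega> in M. W s \<omega> \<noteq> {}" "is_hull t Y"
    "\<eta> \<in> borel_measurable (F t)" "AE \<omega> in M. \<eta> \<omega> \<in> dual_cone (Y \<omega>)"
  shows "\<exists>k. (\<forall>s. t < s \<and> s \<le> T \<longrightarrow> k s \<in> borel_measurable (F s) \<and> (AE \<omega> in M. k s \<omega> \<in> K s \<omega>)) \<and>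
    (AE \<omega> in M. \<eta> \<omega> = (\<Sum>s\<in>{t<..T}. k s \<omega>)) \<and>
    ((\<forall>s. t < s \<and> s \<le> T \<longrightarrow> (AE \<omega> in M. - k s \<omega> \<in> K s \<omega>)) \<longrightarrow> (AE \<omega> in M. \<forall>y\<in>Y \<omega>. \<eta> \<omega> \<bullet> y = 0))"
  using assms
\<comment> \<open>The implication about reversible trades is proved in the same induction because it
  concerns the particular trades constructed there.\<close>
proof (induction "T - t" arbitrary: t Y \<eta> rule: less_induct)
  case less
  define s where "s = Suc t"
  have s: "t < s" "s \<le> T" "t \<le> T" using less.prems(1) by (auto simp: s_def)
  have \<eta>s: "\<eta> \<in> borel_measurable (F s)"
    using measurable_from_subalg[OF nest less.prems(4)] s by simp
  have \<eta>W: "AE \<omega> in M. \<eta> \<omega> \<in> dual_cone (W s \<omega>)"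
    unfolding s_def by (rule AE_in_dual_cone_antimono[OF less.prems(5) is_hullD(5)[OF less.prems(3)]])
  have orth: "\<eta> \<bullet> a = 0" if "\<eta> \<in> solvency_cone p" "- \<eta> \<in> solvency_cone p" "a \<in> dual_cone (solvency_cone p)"
    for \<eta> a :: "real ^ 'd" and p
    using dual_coneD[OF that(3,1)] dual_coneD[OF that(3,2)] by simp
  show ?case
  proof (cases "s = T")
    case True
    \<comment> \<open>At the last date \<open>W T\<close> is the dual of \<open>K T\<close>, so by
      bipolarity \<open>\<eta>\<close> itself serves as the single trade.\<close>
    have \<eta>K: "AE \<omega> in M. \<eta> \<omega> \<in> K s \<omega>"
      using \<eta>W by eventually_elim (simp add: True W_seq_last dual_dual_solvency_cone)
    have iv: "{t<..T} = {s}" using True s by (auto simp: s_def)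
    have impl: "AE \<omega> in M. \<forall>y\<in>Y \<omega>. \<eta> \<omega> \<bullet> y = 0" if "AE \<omega> in M. - \<eta> \<omega> \<in> K s \<omega>"
    proof (rule hull_orthogonal[OF s(3) less.prems(3,4)])
      show "AE \<omega> in M. \<forall>w\<in>W (Suc t) \<omega>. \<eta> \<omega> \<bullet> w = 0"
        using that \<eta>K unfolding s_def[symmetric]
        by eventually_elim (use orth in \<open>auto simp: True W_seq_last\<close>)
    qed
    show ?thesis
    proof (intro exI[of _ "\<lambda>_. \<eta>"] conjI allI impI)
      fix r assume "t < r \<and> r \<le> T"
      then have r: "r = s" using True by (simp add: s_def)
      show "\<eta> \<in> borel_measurable (F r)" "AE \<omega> in M. \<eta> \<omega> \<in> K r \<omega>" unfolding r by (fact \<eta>s \<eta>K)+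
    next
      show "AE \<omega> in M. \<eta> \<omega> = (\<Sum>s\<in>{t<..T}. \<eta> \<omega>)" by (simp add: iv)
    next
      assume "\<forall>r. t < r \<and> r \<le> T \<longrightarrow> (AE \<omega> in M. - \<eta> \<omega> \<in> K r \<omega>)"
      then have "AE \<omega> in M. - \<eta> \<omega> \<in> K s \<omega>" using s by simp
      then show "AE \<omega> in M. \<forall>y\<in>Y \<omega>. \<eta> \<omega> \<bullet> y = 0" by (rule impl)
    qed
  next
    case False
    then have sT: "s < T" using s by simp
    have "regular (Suc s)" using sT s less.prems(2) by (intro regular_if_nonempty) auto
    then obtain Ys where Ys: "is_hull s Ys" using hull_exists[OF sT] by blast
    have Wne: "AE \<omega> in M. W s \<omega> \<noteq> {}" using less.prems(2) s by simp
    note Ws = is_hull_Int[OF Ys Wne]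
    have dYs: "effros_measurable (F s) (\<lambda>\<omega>. dual_cone (Ys \<omega>))"
      by (rule effros_measurable_dual_cone[OF is_hullD(1)[OF Ys]]) (rule convex_cone_nonempty[OF is_hullD(3)[OF Ys]])
    \<comment> \<open>The admissible trades at date \<open>s\<close>: the remainder must lie in the
      dual of the next hull, to be split further by induction.\<close>
    define D where "D \<omega> = {k \<in> K s \<omega>. \<eta> \<omega> + (- 1) *\<^sub>R k \<in> dual_cone (Ys \<omega>)}" for \<omega>
    have D: "effros_measurable (F s) D"
      unfolding D_def[abs_def] using effros_measurable_K[OF s(2)] dYs \<eta>s
      by (intro effros_measurable_Int_shift)
        (auto simp: closed_solvency_cone closed_dual_cone convex_cone_nonempty[OF convex_cone_solvency_cone]
          convex_cone_nonempty[OF convex_cone_dual_cone])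
    have Dcl: "closed (D \<omega>)" for \<omega>
    proof -
      have "D \<omega> = K s \<omega> \<inter> (\<lambda>k. \<eta> \<omega> + (- 1) *\<^sub>R k) -` dual_cone (Ys \<omega>)" by (auto simp: D_def)
      moreover have "closed ((\<lambda>k. \<eta> \<omega> + (- 1) *\<^sub>R k) -` dual_cone (Ys \<omega>))"
        by (intro closed_vimage closed_dual_cone continuous_intros)
      ultimately show ?thesis by (simp add: closed_Int closed_solvency_cone)
    qed
    have Dne: "AE \<omega> in M. D \<omega> \<noteq> {}"
      using Ws \<eta>W
    proof eventually_elim
      case (elim \<omega>)
      then have "\<exists>k\<in>dual_cone (dual_cone (K s \<omega>)). \<eta> \<omega> - k \<in> dual_cone (Ys \<omega>)"
        by (intro dual_cone_Int_decompose[OF convex_cone_dual_cone is_hullD(3)[OF Ys]]) auto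
      then show ?case by (auto simp: D_def dual_dual_solvency_cone)
    qed
    obtain k0 where k0: "k0 \<in> borel_measurable (F s)" "AE \<omega> in M. k0 \<omega> \<in> D \<omega>"
      using measurable_selection_AE[OF D Dcl Dne space_F[OF s(2)]] by blast
    define \<eta>' where "\<eta>' \<omega> = \<eta> \<omega> - k0 \<omega>" for \<omega>
    have \<eta>'m: "\<eta>' \<in> borel_measurable (F s)" unfolding \<eta>'_def[abs_def] using \<eta>s k0(1) by simp
    have \<eta>'Y: "AE \<omega> in M. \<eta>' \<omega> \<in> dual_cone (Ys \<omega>)" using k0(2) by eventually_elim (simp add: D_def \<eta>'_def)
    have k0K: "AE \<omega> in M. k0 \<omega> \<in> K s \<omega>" using k0(2) by eventually_elim (simp add: D_def)
    have d: "T - s < T - t" using s sT by simp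
    have ne': "AE \<omega> in M. W r \<omega> \<noteq> {}" if "s < r" "r \<le> T" for r
      using less.prems(2)[of r] s that by simp
    have "\<exists>k. (\<forall>r. s < r \<and> r \<le> T \<longrightarrow> k r \<in> borel_measurable (F r) \<and> (AE \<omega> in M. k r \<omega> \<in> K r \<omega>)) \<and>
        (AE \<omega> in M. \<eta>' \<omega> = (\<Sum>r\<in>{s<..T}. k r \<omega>)) \<and>
        ((\<forall>r. s < r \<and> r \<le> T \<longrightarrow> (AE \<omega> in M. - k r \<omega> \<in> K r \<omega>)) \<longrightarrow> (AE \<omega> in M. \<forall>y\<in>Ys \<omega>. \<eta>' \<omega> \<bullet> y = 0))"
      by (rule less.hyps[OF d sT _ Ys \<eta>'m \<eta>'Y]) (rule ne')
    then obtain k where k: "\<forall>r. s < r \<and> r \<le> T \<longrightarrow> k r \<in> borel_measurable (F r) \<and> (AE \<omega> in M. k r \<omega> \<in> K r \<omega>)"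
        "AE \<omega> in M. \<eta>' \<omega> = (\<Sum>r\<in>{s<..T}. k r \<omega>)"
        "(\<forall>r. s < r \<and> r \<le> T \<longrightarrow> (AE \<omega> in M. - k r \<omega> \<in> K r \<omega>)) \<longrightarrow> (AE \<omega> in M. \<forall>y\<in>Ys \<omega>. \<eta>' \<omega> \<bullet> y = 0)"
      by (elim exE conjE)
    define k' where "k' = k(s := k0)"
    have iv: "{t<..T} = insert s {s<..T}" using s by (auto simp: s_def)
    have sum: "(\<Sum>r\<in>{t<..T}. k' r \<omega>) = k0 \<omega> + (\<Sum>r\<in>{s<..T}. k r \<omega>)" for \<omega>
    proof -
      have "(\<Sum>r\<in>{s<..T}. k' r \<omega>) = (\<Sum>r\<in>{s<..T}. k r \<omega>)" by (rule sum.cong) (auto simp: k'_def)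
      then show ?thesis unfolding iv by (simp add: k'_def)
    qed
    have cases_r: "r = s \<or> s < r" if "t < r" for r using that by (auto simp: s_def)
    show ?thesis
    proof (intro exI[of _ k'] conjI impI allI)
      fix r assume r: "t < r \<and> r \<le> T"
      show "k' r \<in> borel_measurable (F r)" "AE \<omega> in M. k' r \<omega> \<in> K r \<omega>"
        using cases_r[of r] r k(1) k0(1) k0K by (auto simp: k'_def)
    next
      show "AE \<omega> in M. \<eta> \<omega> = (\<Sum>s\<in>{t<..T}. k' s \<omega>)"
        using k(2) unfolding sum by eventually_elim (simp add: \<eta>'_def algebra_simps)
    next
      assume rev: "\<forall>r. t < r \<and> r \<le> T \<longrightarrow> (AE \<omega> in M. - k' r \<omega> \<in> K r \<omega>)"
      have "AE \<omega> in M. - k r \<omega> \<in> K r \<omega>" if "s < r" "r \<le> T" for r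
        using rev[rule_format, of r] that s by (simp add: k'_def)
      then have \<eta>'0: "AE \<omega> in M. \<forall>y\<in>Ys \<omega>. \<eta>' \<omega> \<bullet> y = 0" using k(3) by blast
      have k00: "AE \<omega> in M. - k0 \<omega> \<in> K s \<omega>" using rev[rule_format, of s] s by (simp add: k'_def)
      \<comment> \<open>Both parts of \<open>\<eta>\<close> are orthogonal to \<open>W s\<close>:
        the reversible trade \<open>k0\<close> because \<open>W s\<close> lies in the dual of
        \<open>K s\<close>, the remainder because \<open>W s\<close> lies in \<open>Ys\<close>.
        Minimality of \<open>Y\<close> extends this to \<open>Y\<close>.\<close>
      show "AE \<omega> in M. \<forall>y\<in>Y \<omega>. \<eta> \<omega> \<bullet> y = 0"
      proof (rule hull_orthogonal[OF s(3) less.prems(3,4)])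
        show "AE \<omega> in M. \<forall>w\<in>W (Suc t) \<omega>. \<eta> \<omega> \<bullet> w = 0"
          unfolding s_def[symmetric] using \<eta>'0 k00 k0K Ws
        proof eventually_elim
          case (elim \<omega>)
          show ?case
          proof
            fix w assume "w \<in> W s \<omega>"
            then have w: "w \<in> dual_cone (K s \<omega>)" "w \<in> Ys \<omega>" using elim(4) by auto
            have "k0 \<omega> \<bullet> w = 0" by (rule orth[OF elim(3,2) w(1)])
            moreover have "\<eta>' \<omega> \<bullet> w = 0" using elim(1) w(2) by blast
            ultimately show "\<eta> \<omega> \<bullet> w = 0" by (simp add: \<eta>'_def inner_diff_left)
          qed
        qed
      qed
    qed
  qed
qed

text \<open>The cone of all candidates for separation is generated by measurable \<open>e n\<close>.
  Each \<open>e n\<close>, followed by its splitting into later trades, is a zero-sum strategy; by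
  \<open>rev\<close> it is reversible, so \<open>e n\<close> vanishes on both cones. Then so does
  the whole candidate cone, and no proper separation remains.\<close>

lemma reversible_imp_W_nonempty:
  assumes rev: "\<And>x s. (\<forall>t\<le>T. x t \<in> L0 M (F t) (\<lambda>\<omega>. uminus ` K t \<omega>)) \<Longrightarrow> AE \<omega> in M. (\<Sum>t\<le>T. x t \<omega>) = 0 \<Longrightarrow>
      s \<le> T \<Longrightarrow> x s \<in> L0 M (F s) (\<lambda>\<omega>. K s \<omega> \<inter> uminus ` K s \<omega>)"
    and t: "t \<le> T"
  shows "AE \<omega> in M. W t \<omega> \<noteq> {}"
  using t
proof (induction "T - t" arbitrary: t rule: less_induct)
  case less
  show ?case
  proof (cases "t = T")
    case True
    then show ?thesis by (simp add: W_seq_last convex_cone_nonempty[OF convex_cone_dual_cone])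
  next
    case False
    then have tT: "t < T" using less.prems by simp
    have ne: "AE \<omega> in M. W s \<omega> \<noteq> {}" if "t < s" "s \<le> T" for s
      using that by (intro less.hyps) auto
    have "regular (Suc t)" using tT ne by (intro regular_if_nonempty) auto
    then obtain Y where Y: "is_hull t Y" using hull_exists[OF tT] by blast
    have dY: "effros_measurable (F t) (\<lambda>\<omega>. dual_cone (Y \<omega>))"
      by (rule effros_measurable_dual_cone[OF is_hullD(1)[OF Y]]) (rule convex_cone_nonempty[OF is_hullD(3)[OF Y]])
    \<comment> \<open>An element of \<open>L\<close> is an admissible trade at \<open>t\<close> that
      is nonnegative on the hull; the separating functional tested at the end is its
      negative.\<close>
    define L where "L \<omega> = {x \<in> dual_cone (Y \<omega>). 0 + (- 1) *\<^sub>R x \<in> K t \<omega>}" for \<omega>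
    have Lm: "effros_measurable (F t) L"
      unfolding L_def[abs_def] using effros_measurable_K[OF less.prems] dY
      by (intro effros_measurable_Int_shift)
        (auto simp: closed_solvency_cone closed_dual_cone convex_cone_nonempty[OF convex_cone_solvency_cone]
          convex_cone_nonempty[OF convex_cone_dual_cone])
    have Lcl: "closed (L \<omega>)" for \<omega>
    proof -
      have "L \<omega> = dual_cone (Y \<omega>) \<inter> (\<lambda>x. 0 + (- 1) *\<^sub>R x) -` K t \<omega>" by (auto simp: L_def)
      moreover have "closed ((\<lambda>x. 0 + (- 1) *\<^sub>R x) -` K t \<omega>)"
        by (intro closed_vimage closed_solvency_cone continuous_intros)
      ultimately show ?thesis by (simp add: closed_Int closed_dual_cone)
    qed
    have Lcone: "convex_cone (L \<omega>)" for \<omega>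
      unfolding convex_cone_iff
    proof (intro conjI ballI allI impI)
      show "0 \<in> L \<omega>" by (simp add: L_def convex_cone_contains_0 convex_cone_dual_cone convex_cone_solvency_cone)
      show "x + y \<in> L \<omega>" if "x \<in> L \<omega>" "y \<in> L \<omega>" for x y
        using that convex_cone_add[OF convex_cone_solvency_cone, of "- x" _ "- y"]
        by (auto simp: L_def intro: convex_cone_add[OF convex_cone_dual_cone])
      show "c *\<^sub>R x \<in> L \<omega>" if "x \<in> L \<omega>" "0 \<le> c" for x c
        using that convex_cone_scaleR[OF convex_cone_solvency_cone, of c "- x"]
        by (auto simp: L_def intro: convex_cone_scaleR[OF convex_cone_dual_cone])
    qed
    have "\<exists>e. (\<forall>n::nat. e n \<in> borel_measurable (F t)) \<and> (\<forall>n. \<forall>\<omega>\<in>space M. e n \<omega> \<in> L \<omega>) \<and>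
        (\<forall>\<omega>\<in>space M. dual_cone (range (\<lambda>n. e n \<omega>)) = dual_cone (L \<omega>))"
    proof (rule castaing_cone[OF Lm Lcl Lcone])
      fix f :: "nat \<Rightarrow> 'w \<Rightarrow> real ^ 'd"
      assume "\<And>n. f n \<in> borel_measurable (F t)" "\<And>n \<omega>. \<omega> \<in> space (F t) \<Longrightarrow> f n \<omega> \<in> L \<omega>"
        "\<And>\<omega>. \<omega> \<in> space (F t) \<Longrightarrow> dual_cone (range (\<lambda>n. f n \<omega>)) = dual_cone (L \<omega>)"
      then show ?thesis unfolding space_F[OF less.prems] by (intro exI[of _ f]) simp
    qed
    then obtain e where e: "\<And>n::nat. e n \<in> borel_measurable (F t)"
        "\<And>n \<omega>. \<omega> \<in> space M \<Longrightarrow> e n \<omega> \<in> L \<omega>"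
        "\<And>\<omega>. \<omega> \<in> space M \<Longrightarrow> dual_cone (range (\<lambda>n. e n \<omega>)) = dual_cone (L \<omega>)"
      by blast
    have "AE \<omega> in M. \<forall>n. e n \<omega> \<in> K t \<omega> \<and> (\<forall>y\<in>Y \<omega>. e n \<omega> \<bullet> y = 0)"
      unfolding AE_all_countable
    proof
      fix n
      have eY: "AE \<omega> in M. e n \<omega> \<in> dual_cone (Y \<omega>)" and eK: "AE \<omega> in M. - e n \<omega> \<in> K t \<omega>"
        using AE_space by (eventually_elim, use e(2) in \<open>force simp: L_def\<close>)+
      obtain k where k: "\<And>s. t < s \<Longrightarrow> s \<le> T \<Longrightarrow> k s \<in> borel_measurable (F s)"
          "\<And>s. t < s \<Longrightarrow> s \<le> T \<Longrightarrow> AE \<omega> in M. k s \<omega> \<in> K s \<omega>"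
          "AE \<omega> in M. e n \<omega> = (\<Sum>s\<in>{t<..T}. k s \<omega>)"
          "(\<forall>s. t < s \<and> s \<le> T \<longrightarrow> (AE \<omega> in M. - k s \<omega> \<in> K s \<omega>)) \<longrightarrow> (AE \<omega> in M. \<forall>y\<in>Y \<omega>. e n \<omega> \<bullet> y = 0)"
      proof -
        have "\<exists>k. (\<forall>s. t < s \<and> s \<le> T \<longrightarrow> k s \<in> borel_measurable (F s) \<and> (AE \<omega> in M. k s \<omega> \<in> K s \<omega>)) \<and>
            (AE \<omega> in M. e n \<omega> = (\<Sum>s\<in>{t<..T}. k s \<omega>)) \<and>
            ((\<forall>s. t < s \<and> s \<le> T \<longrightarrow> (AE \<omega> in M. - k s \<omega> \<in> K s \<omega>)) \<longrightarrow> (AE \<omega> in M. \<forall>y\<in>Y \<omega>. e n \<omega> \<bullet> y = 0))"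
          by (rule dual_hull_decompose[OF tT _ Y e(1) eY]) (rule ne)
        then show thesis by (elim exE conjE, intro that) auto
      qed
      \<comment> \<open>The trade \<open>e n\<close> at \<open>t\<close> is compensated by the later
        trades \<open>- k s\<close>, and nothing is traded before \<open>t\<close>.\<close>
      define x where "x s = (if s = t then e n else if t < s then (\<lambda>\<omega>. - k s \<omega>) else (\<lambda>_. 0))" for s
      have x: "\<forall>s\<le>T. x s \<in> L0 M (F s) (\<lambda>\<omega>. uminus ` K s \<omega>)"
      proof (intro allI impI)
        fix s assume s: "s \<le> T"
        consider "s = t" | "t < s" | "s < t" by linarith
        then show "x s \<in> L0 M (F s) (\<lambda>\<omega>. uminus ` K s \<omega>)"
        proof cases
          case 1
          then show ?thesis using e(1) eK by (simp add: x_def L0_def mem_uminus_image_iff)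
        next
          case 2
          then show ?thesis using k(1,2)[OF 2 s] by (simp add: x_def L0_def mem_uminus_image_iff)
        next
          case 3
          then show ?thesis
            by (simp add: x_def L0_def mem_uminus_image_iff convex_cone_contains_0[OF convex_cone_solvency_cone])
        qed
      qed
      have "AE \<omega> in M. (\<Sum>s\<le>T. x s \<omega>) = 0"
        using k(3)
      proof eventually_elim
        case (elim \<omega>)
        have "{..T} = {..<t} \<union> ({t} \<union> {t<..T})" using tT by auto
        then have "(\<Sum>s\<le>T. x s \<omega>) = (\<Sum>s\<in>{..<t}. x s \<omega>) + (\<Sum>s\<in>{t} \<union> {t<..T}. x s \<omega>)"
          by (simp only:) (rule sum.union_disjoint, auto)
        also have "(\<Sum>s\<in>{t} \<union> {t<..T}. x s \<omega>) = x t \<omega> + (\<Sum>s\<in>{t<..T}. x s \<omega>)"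
          by (subst sum.union_disjoint) auto
        also have "(\<Sum>s\<in>{..<t}. x s \<omega>) = 0" by (rule sum.neutral) (auto simp: x_def)
        also have "(\<Sum>s\<in>{t<..T}. x s \<omega>) = (\<Sum>s\<in>{t<..T}. - k s \<omega>)" by (rule sum.cong) (auto simp: x_def)
        finally show ?case using elim by (simp add: x_def sum_negf)
      qed
      note r = rev[OF x this]
      have "AE \<omega> in M. - k s \<omega> \<in> K s \<omega>" if "t < s" "s \<le> T" for s
        using r[OF that(2)] that by (simp add: x_def L0_def)
      then have "AE \<omega> in M. \<forall>y\<in>Y \<omega>. e n \<omega> \<bullet> y = 0" using k(4) by blast
      moreover have "AE \<omega> in M. e n \<omega> \<in> K t \<omega>" using r[OF less.prems] by (simp add: x_def L0_def)
      ultimately show "AE \<omega> in M. e n \<omega> \<in> K t \<omega> \<and> (\<forall>y\<in>Y \<omega>. e n \<omega> \<bullet> y = 0)" by eventually_elim simp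
    qed
    then show ?thesis
      using is_hullD(4)[OF Y] AE_space
    proof eventually_elim
      case (elim \<omega>)
      \<comment> \<open>Both \<open>v\<close> and \<open>- v\<close> lie in the dual of the family
        \<open>e n\<close>, which is also the dual of \<open>L\<close>; so orthogonality to the
        family extends to \<open>L\<close>.\<close>
      have perp: "\<eta> \<bullet> v = 0" if v: "\<And>n. e n \<omega> \<bullet> v = 0" and \<eta>: "\<eta> \<in> L \<omega>" for \<eta> v
      proof -
        have "v \<in> dual_cone (range (\<lambda>n. e n \<omega>))" "- v \<in> dual_cone (range (\<lambda>n. e n \<omega>))"
          using v by (auto simp: dual_cone_def)
        then have "v \<in> dual_cone (L \<omega>)" "- v \<in> dual_cone (L \<omega>)" by (simp_all add: e(3)[OF elim(3)])
        from dual_coneD[OF this(1) \<eta>] dual_coneD[OF this(2) \<eta>] show ?thesis by simp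
      qed
      have "rel_interior (dual_cone (K t \<omega>)) \<inter> rel_interior (Y \<omega>) \<noteq> {}"
      proof (rule rel_interior_cones_meet[OF convex_cone_dual_cone is_hullD(3)[OF Y]])
        fix \<eta> assume \<eta>: "\<eta> \<in> dual_cone (dual_cone (K t \<omega>))" "- \<eta> \<in> dual_cone (Y \<omega>)"
        then have L: "- \<eta> \<in> L \<omega>" by (simp add: L_def dual_dual_solvency_cone)
        show "\<forall>v\<in>dual_cone (K t \<omega>) \<union> Y \<omega>. \<eta> \<bullet> v = 0"
        proof
          fix v assume "v \<in> dual_cone (K t \<omega>) \<union> Y \<omega>"
          then have "e n \<omega> \<bullet> v = 0" for n
          proof
            assume v: "v \<in> dual_cone (K t \<omega>)"
            have "e n \<omega> \<in> K t \<omega>" using elim(1) by blast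
            moreover have "- e n \<omega> \<in> K t \<omega>" using e(2)[OF elim(3), of n] by (simp add: L_def)
            ultimately show ?thesis using dual_coneD[OF v, of "e n \<omega>"] dual_coneD[OF v, of "- e n \<omega>"] by simp
          qed (use elim(1) in blast)
          then have "(- \<eta>) \<bullet> v = 0" using L by (rule perp)
          then show "\<eta> \<bullet> v = 0" by simp
        qed
      qed
      then show ?case by (simp add: elim(2))
    qed
  qed
qed

text \<open>The martingale is built forward in time inside the relative interior of
  \<open>W' t\<close>. Before the last date this is the intersection of the relative interiors of
  the dual of \<open>K t\<close> and of the hull: the first makes the value strictly consistent, the
  second is what the next extension requires.\<close>

lemma W_nonempty_imp_consistent_martingale:
  assumes ne: "\<And>t. t \<le> T \<Longrightarrow> AE \<omega> in M. W t \<omega> \<noteq> {}"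
  shows "\<exists>Z. martingale M F T Z \<and> (\<forall>t\<le>T. Z t \<in> L0 M (F t) (\<lambda>\<omega>. rel_interior (dual_cone (K t \<omega>))))"
proof -
  interpret prob_space M by (rule prob)
  have reg: "regular t" if "t \<le> T" for t using that ne by (intro regular_if_nonempty) auto
  have "\<forall>t. \<exists>Y. t < T \<longrightarrow> is_hull t Y" using hull_exists reg by (metis Suc_leI)
  then obtain Y where Y: "\<And>t. t < T \<Longrightarrow> is_hull t (Y t)" by metis
  \<comment> \<open>A version of \<open>W\<close> whose values are closed convex cones at every
    \<omega>, as the one-step extension demands.\<close>
  define W' where "W' t \<omega> = (if t < T then dual_cone (K t \<omega>) \<inter> Y t \<omega> else dual_cone (K t \<omega>))" for t \<omega>
  have W'm: "effros_measurable (F t) (W' t)" if "t \<le> T" for t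
  proof (cases "t < T")
    case True
    have "effros_measurable (F t) (\<lambda>\<omega>. dual_cone (K t \<omega>) \<inter> Y t \<omega>)"
      by (rule effros_measurable_dual_K_Int[OF that Y[OF True]])
    then show ?thesis using True by (simp add: W'_def[abs_def])
  next
    case False
    then show ?thesis using effros_measurable_dual_K[OF that] by (simp add: W'_def[abs_def])
  qed
  have W'cl: "closed (W' t \<omega>)" for t \<omega>
    using is_hullD(2)[OF Y] by (simp add: W'_def closed_dual_cone closed_Int)
  have W'cone: "convex_cone (W' t \<omega>)" for t \<omega>
    using convex_cone_dual_cone[of "K t \<omega>"] is_hullD(3)[OF Y, of t \<omega>] by (simp add: W'_def convex_cone_iff)
  have W'pos: "W' t \<omega> \<subseteq> nonneg_orthant" for t \<omega>
    using dual_solvency_cone_nonneg[of "\<pi> t \<omega>"] by (auto simp: W'_def)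
  have WW': "AE \<omega> in M. W t \<omega> = W' t \<omega>" if "t \<le> T" for t
  proof (cases "t < T")
    case True
    show ?thesis using is_hull_Int[OF Y[OF True] ne[OF that]] by eventually_elim (simp add: W'_def True)
  next
    case False
    then have "t = T" using that by simp
    then show ?thesis by (simp add: W'_def W_seq_last)
  qed
  have riW': "AE \<omega> in M. rel_interior (W' t \<omega>) \<subseteq> rel_interior (dual_cone (K t \<omega>)) \<and>
      (t < T \<longrightarrow> rel_interior (W' t \<omega>) \<subseteq> rel_interior (Y t \<omega>))" if "t \<le> T" for t
  proof (cases "t < T")
    case True
    show ?thesis using is_hull_Int[OF Y[OF True] ne[OF that]]
    proof eventually_elim
      case (elim \<omega>)
      have "rel_interior (dual_cone (K t \<omega>) \<inter> Y t \<omega>) = rel_interior (dual_cone (K t \<omega>)) \<inter> rel_interior (Y t \<omega>)"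
        using elim convex_cone_dual_cone[of "K t \<omega>"] is_hullD(3)[OF Y[OF True], of \<omega>]
        by (intro convex_rel_interior_inter_two) (auto simp: convex_cone_def)
      then show ?case using True by (simp add: W'_def)
    qed
  qed (simp add: W'_def)
  define good where "good t z \<longleftrightarrow> z \<in> borel_measurable (F t) \<and> integrable M z \<and> (AE \<omega> in M. z \<omega> \<in> rel_interior (W' t \<omega>))"
    for t and z :: "'w \<Rightarrow> real ^ 'd"
  define next_step where "next_step t z z' \<longleftrightarrow> (\<forall>i. AE \<omega> in M. real_cond_exp M (F t) (\<lambda>\<omega>. z' \<omega> $ i) \<omega> = z \<omega> $ i)"
    for t and z z' :: "'w \<Rightarrow> real ^ 'd"
  have ex0: "\<exists>z. good 0 z"
  proof (rule measurable_selection_rel_interior[OF W'm[of 0] W'cl W'cone])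
    fix g assume g: "g \<in> borel_measurable (F 0)" "\<And>\<omega>. norm (g \<omega>) \<le> 1"
      "\<And>\<omega>. \<omega> \<in> space (F 0) \<Longrightarrow> g \<omega> \<in> rel_interior (W' 0 \<omega>)"
    have "integrable M g"
      by (rule integrable_const_bound[of _ 1]) (use g(2) measurable_from_subalg[OF sub g(1)] in auto)
    moreover have "AE \<omega> in M. g \<omega> \<in> rel_interior (W' 0 \<omega>)"
      using AE_space by eventually_elim (use g(3) space_F[of 0] in simp)
    ultimately show ?thesis using g(1) by (auto simp: good_def)
  qed simp
  have exS: "\<exists>z'. good (Suc t) z' \<and> next_step t z z'" if tT: "t < T" and z: "good t z" for t z
  proof -
    have t: "t \<le> T" "Suc t \<le> T" using tT by auto
    note hull = is_hullD[OF Y[OF tT]]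
    have sub': "AE \<omega> in M. W' (Suc t) \<omega> \<subseteq> Y t \<omega>" using WW'[OF t(2)] hull(5) by eventually_elim simp
    have min: "AE \<omega> in M. Y t \<omega> \<subseteq> S \<omega>"
      if "effros_measurable (F t) S" "\<And>\<omega>. closed (S \<omega>)" "\<And>\<omega>. convex_cone (S \<omega>)" "AE \<omega> in M. W' (Suc t) \<omega> \<subseteq> S \<omega>" for S
    proof (rule hull(6)[OF that(1)])
      show "AE \<omega> in M. W (Suc t) \<omega> \<subseteq> S \<omega>" using WW'[OF t(2)] that(4) by eventually_elim simp
    qed (rule that)+
    have zri: "AE \<omega> in M. z \<omega> \<in> rel_interior (Y t \<omega>)"
      using riW'[OF t(1)] z[unfolded good_def, THEN conjunct2, THEN conjunct2]
      by eventually_elim (use tT in auto)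
    have "\<exists>\<xi>. \<xi> \<in> borel_measurable (F (Suc t)) \<and> integrable M \<xi> \<and> (AE \<omega> in M. \<xi> \<omega> \<in> rel_interior (W' (Suc t) \<omega>)) \<and>
        (\<forall>i. AE \<omega> in M. real_cond_exp M (F t) (\<lambda>\<omega>. \<xi> \<omega> $ i) \<omega> = z \<omega> $ i)"
    proof (rule martingale_selection_step[OF prob sub[OF t(2)] sub[OF t(1)] nest[OF _ t(2)] W'm[OF t(2)] W'cl W'cone W'pos
          hull(1-3) sub' min _ _ zri])
      show "z \<in> borel_measurable (F t)" "integrable M z" using z by (auto simp: good_def)
    qed simp_all
    then show ?thesis by (auto simp: good_def next_step_def)
  qed
  \<comment> \<open>Dependent choice yields an infinite sequence; guarding both predicates by bounds
    on \<open>t\<close> makes them vacuous beyond \<open>T\<close>.\<close>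
  have "\<exists>Z. \<forall>t. (t \<le> T \<longrightarrow> good t (Z t)) \<and> (t < T \<longrightarrow> next_step t (Z t) (Z (Suc t)))"
    by (rule dependent_nat_choice[where P = "\<lambda>t z. t \<le> T \<longrightarrow> good t z" and Q = "\<lambda>t z z'. t < T \<longrightarrow> next_step t z z'"])
      (use ex0 exS in \<open>auto simp: Suc_le_eq\<close>)
  then obtain Z where Zg: "\<And>t. t \<le> T \<Longrightarrow> good t (Z t)" and Zn: "\<And>t. t < T \<Longrightarrow> next_step t (Z t) (Z (Suc t))"
    by blast
  have intZ: "integrable M (\<lambda>\<omega>. Z t \<omega> $ i)" if "t \<le> T" for t i
  proof -
    have "integrable M (Z t)" using Zg[OF that] by (simp add: good_def)
    from integrable_inner_left[OF this, of "axis i 1"] show ?thesis by (simp add: inner_axis)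
  qed
  have mg: "AE \<omega> in M. real_cond_exp M (F s) (\<lambda>\<omega>. Z t \<omega> $ i) \<omega> = Z s \<omega> $ i" if "s \<le> t" "t \<le> T" for s t i
    using that
  proof (induction rule: dec_induct)
    case base
    interpret finite_measure_subalgebra M "F s" by unfold_locales (rule sub[OF base])
    have "Z s \<in> borel_measurable (F s)" using Zg[OF base] by (simp add: good_def)
    then have "(\<lambda>\<omega>. Z s \<omega> $ i) \<in> borel_measurable (F s)" by measurable
    then show ?case by (rule real_cond_exp_F_meas[OF intZ[OF base]])
  next
    case (step n)
    have n: "n \<le> T" "n < T" "s \<le> T" using step by auto
    interpret finite_measure_subalgebra M "F s" by unfold_locales (rule sub[OF n(3)])
    have "AE \<omega> in M. real_cond_exp M (F s) (real_cond_exp M (F n) (\<lambda>\<omega>. Z (Suc n) \<omega> $ i)) \<omega> =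
        real_cond_exp M (F s) (\<lambda>\<omega>. Z (Suc n) \<omega> $ i) \<omega>"
      by (rule real_cond_exp_nested_subalg[OF sub[OF n(1)] nest[OF step.hyps(1) n(1)] intZ[OF step.prems]])
    moreover have "AE \<omega> in M. real_cond_exp M (F s) (real_cond_exp M (F n) (\<lambda>\<omega>. Z (Suc n) \<omega> $ i)) \<omega> =
        real_cond_exp M (F s) (\<lambda>\<omega>. Z n \<omega> $ i) \<omega>"
      using Zn[OF n(2)] intZ[OF n(1), of i] by (intro real_cond_exp_cong) (auto simp: next_step_def)
    ultimately show ?case using step.IH[OF n(1)] by eventually_elim simp
  qed
  have "martingale M F T Z"
    unfolding martingale_def using Zg mg by (auto simp: good_def)
  moreover have "Z t \<in> L0 M (F t) (\<lambda>\<omega>. rel_interior (dual_cone (K t \<omega>)))" if "t \<le> T" for t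
  proof -
    have "AE \<omega> in M. Z t \<omega> \<in> rel_interior (W' t \<omega>)" using Zg[OF that] by (simp add: good_def)
    then have "AE \<omega> in M. Z t \<omega> \<in> rel_interior (dual_cone (K t \<omega>))"
      using riW'[OF that] by eventually_elim auto
    then show ?thesis using Zg[OF that] by (simp add: L0_def good_def)
  qed
  ultimately show ?thesis by blast
qed

end

theorem theorem2:
  fixes M :: "'w measure" and F :: "nat \<Rightarrow> 'w measure" and T :: nat
    and \<pi> :: "nat \<Rightarrow> 'w \<Rightarrow> real ^ 'd ^ 'd"
  assumes "prob_space M"
    and "complete_filtration M F T"
    and "bid_ask_process M F T \<pi>"
  shows
    "(robust_no_arbitrage M F T \<pi> \<longleftrightarrow>
       (\<exists>Z. martingale M F T Z \<and>
          (\<forall>t\<le>T. Z t \<in> L0 M (F t) (\<lambda>\<omega>. rel_interior (dual_cone (solvency_cone (\<pi> t \<omega>))))))) \<and>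
     ((\<exists>Z. martingale M F T Z \<and>
          (\<forall>t\<le>T. Z t \<in> L0 M (F t) (\<lambda>\<omega>. rel_interior (dual_cone (solvency_cone (\<pi> t \<omega>)))))) \<longleftrightarrow>
       (\<forall>t\<le>T. AE \<omega> in M. W_seq M F T \<pi> t \<omega> \<noteq> {})) \<and>
     ((\<forall>t\<le>T. AE \<omega> in M. W_seq M F T \<pi> t \<omega> \<noteq> {}) \<longleftrightarrow>
       (\<forall>x. (\<forall>t\<le>T. x t \<in> L0 M (F t) (\<lambda>\<omega>. uminus ` solvency_cone (\<pi> t \<omega>))) \<and>
            (AE \<omega> in M. (\<Sum>t\<le>T. x t \<omega>) = 0) \<longrightarrow>
          (\<forall>t\<le>T. x t \<in> L0 M (F t) (\<lambda>\<omega>. solvency_cone (\<pi> t \<omega>) \<inter> uminus ` solvency_cone (\<pi> t \<omega>)))))"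
    (is "(?a \<longleftrightarrow> ?b) \<and> (?b \<longleftrightarrow> ?c) \<and> (?c \<longleftrightarrow> ?d)")
proof -
  interpret bid_ask_market M F T \<pi> by (rule bid_ask_market.intro[OF assms])
  have "?b \<Longrightarrow> ?a" using consistent_martingale_imp_robust_no_arbitrage[OF assms] by blast
  moreover have "?a \<Longrightarrow> ?d" using robust_no_arbitrage_imp_reversible[OF assms] by blast
  moreover have "?d \<Longrightarrow> ?c" by (intro allI impI reversible_imp_W_nonempty) blast+
  moreover have "?c \<Longrightarrow> ?b" by (rule W_nonempty_imp_consistent_martingale) blast
  ultimately show ?thesis by argo
qed

end
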